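(* Let $1\le p\le 2$, let $X$ be the complex Banach space $L_p(\mu)$ or the Schatten class $\mathcal S_p$, and let $P_1,\ldots,P_n:X\to\mathbb C$ be continuous homogeneous polynomials of norm one, of degrees $k_1,\ldots,k_n\ge 1$. Given real numbers $a_1,\ldots,a_n\geq 0$ satisfying $\sum_{i=1}^n a_i^p<\frac{1}{n^{n-1}}$, there is $z_0\in B_X$ such that $$|P_i(z_0)|\geq a_i^{k_i}\quad\text{for } i=1,\ldots,n.$$ Moreover, if $X$ is finite dimensional, the same conclusion also holds when $\sum_{i=1}^n a_i^p=\frac{1}{n^{n-1}}$.
   Context: $B_X$ denotes the (closed) unit ball of $X$. $L_p(\mu)$ is the usual space of complex-valued $p$-integrable functions on a measure space, and $\mathcal S_p$ is the Schatten $p$-class of operators on a complex Hilbert space, with norm the $\ell_p$-norm of the singular values. A function $P:X\to\mathbb C$ is a continuous $k$-homogeneous polynomial (of degree $k$) if there is a continuous $k$-linear function $T:X\times\cdots\times X\to\mathbb C$ with $P(z)=T(z,\ldots,z)$. The norm of a polynomial is $\|P\|=\sup_{z\in B_X}|P(z)|$. *)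

theory Defs
  imports "HOL-Analysis.Analysis"
begin

section \<open>Complex normed spaces given by a carrier set\<close>

record 'x cnormed =
  vcarrier :: "'x set"
  vzero :: 'x
  vadd :: "'x \<Rightarrow> 'x \<Rightarrow> 'x"
  vscale :: "complex \<Rightarrow> 'x \<Rightarrow> 'x"
  vnorm :: "'x \<Rightarrow> real"

definition vdist :: "'x cnormed \<Rightarrow> 'x \<Rightarrow> 'x \<Rightarrow> real" where
  "vdist X u v = vnorm X (vadd X u (vscale X (- 1) v))"

definition unit_ball :: "'x cnormed \<Rightarrow> 'x set" where
  "unit_ball X = {z \<in> vcarrier X. vnorm X z \<le> 1}"

inductive_set vspan :: "'x cnormed \<Rightarrow> 'x set \<Rightarrow> 'x set"
  for X :: "'x cnormed" and B :: "'x set" where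
  vspan_zero: "vzero X \<in> vspan X B"
| vspan_step: "x \<in> B \<Longrightarrow> y \<in> vspan X B \<Longrightarrow> vadd X (vscale X c x) y \<in> vspan X B"

definition finite_dimensional :: "'x cnormed \<Rightarrow> bool" where
  "finite_dimensional X \<longleftrightarrow>
     (\<exists>B. finite B \<and> B \<subseteq> vcarrier X \<and> vspan X B = vcarrier X)"


section \<open>Continuous homogeneous polynomials\<close>

text \<open>
  The \<open>k\<close>-fold product of \<open>X\<close> consists of the extensional functions on \<open>{..<k}\<close> with values in
  the carrier.
\<close>

definition multilinear_on :: "'x cnormed \<Rightarrow> nat \<Rightarrow> ((nat \<Rightarrow> 'x) \<Rightarrow> complex) \<Rightarrow> bool" where
  "multilinear_on X k T \<longleftrightarrow>
     (\<forall>x \<in> {..<k} \<rightarrow>\<^sub>E vcarrier X. \<forall>i<k. \<forall>u \<in> vcarrier X.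
        (\<forall>v \<in> vcarrier X. T (x(i := vadd X u v)) = T (x(i := u)) + T (x(i := v))) \<and>
        (\<forall>c. T (x(i := vscale X c u)) = c * T (x(i := u))))"

definition continuous_on_power :: "'x cnormed \<Rightarrow> nat \<Rightarrow> ((nat \<Rightarrow> 'x) \<Rightarrow> complex) \<Rightarrow> bool" where
  "continuous_on_power X k T \<longleftrightarrow>
     (\<forall>x \<in> {..<k} \<rightarrow>\<^sub>E vcarrier X. \<forall>e>0. \<exists>d>0. \<forall>y \<in> {..<k} \<rightarrow>\<^sub>E vcarrier X.
        (\<forall>i<k. vdist X (y i) (x i) < d) \<longrightarrow> dist (T y) (T x) < e)"

text \<open>Only the values of \<open>P\<close> on the carrier matter.\<close>

definition continuous_hom_poly :: "'x cnormed \<Rightarrow> nat \<Rightarrow> ('x \<Rightarrow> complex) \<Rightarrow> bool" where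
  "continuous_hom_poly X k P \<longleftrightarrow>
     (\<exists>T. multilinear_on X k T \<and> continuous_on_power X k T \<and>
          (\<forall>z \<in> vcarrier X. P z = T (\<lambda>i\<in>{..<k}. z)))"

definition poly_norm :: "'x cnormed \<Rightarrow> ('x \<Rightarrow> complex) \<Rightarrow> real" where
  "poly_norm X P = (SUP z\<in>unit_ball X. cmod (P z))"


section \<open>The space \<open>L\<^sub>p(\<mu>)\<close>\<close>

definition Lp_fun :: "real \<Rightarrow> 'a measure \<Rightarrow> ('a \<Rightarrow> complex) set" where
  "Lp_fun p M = {f \<in> borel_measurable M. integrable M (\<lambda>x. cmod (f x) powr p)}"

definition Lp_rel :: "real \<Rightarrow> 'a measure \<Rightarrow> ('a \<Rightarrow> complex) rel" where
  "Lp_rel p M = {(f, g). f \<in> Lp_fun p M \<and> g \<in> Lp_fun p M \<and> (AE x in M. f x = g x)}"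

text \<open>
  The elements are the classes of \<open>p\<close>-integrable functions modulo equality almost everywhere; the
  operations are those induced by the pointwise ones, and \<open>the_elem\<close> is the common value of the
  \<open>L\<^sub>p\<close>-seminorm on a class.
\<close>

definition Lp_space :: "real \<Rightarrow> 'a measure \<Rightarrow> ('a \<Rightarrow> complex) set cnormed" where
  "Lp_space p M =
     \<lparr> vcarrier = Lp_fun p M // Lp_rel p M,
       vzero = Lp_rel p M `` {\<lambda>x. 0},
       vadd = (\<lambda>A B. \<Union>f\<in>A. \<Union>g\<in>B. Lp_rel p M `` {\<lambda>x. f x + g x}),
       vscale = (\<lambda>c A. \<Union>f\<in>A. Lp_rel p M `` {\<lambda>x. c * f x}),
       vnorm = (\<lambda>A. the_elem ((\<lambda>f. (\<integral>x. cmod (f x) powr p \<partial>M) powr (1 / p)) ` A)) \<rparr>"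


section \<open>Complex Hilbert spaces\<close>

text \<open>
  The inner product is conjugate linear in its first argument. The last axiom says that it is
  positive definite and induces the (complete) norm.
\<close>

class chilbert_space = banach +
  fixes scaleC :: "complex \<Rightarrow> 'a \<Rightarrow> 'a" (infixr \<open>*\<^sub>C\<close> 75)
    and cinner :: "'a \<Rightarrow> 'a \<Rightarrow> complex"
  assumes scaleR_scaleC: "r *\<^sub>R x = complex_of_real r *\<^sub>C x"
    and scaleC_add_right: "c *\<^sub>C (x + y) = c *\<^sub>C x + c *\<^sub>C y"
    and scaleC_add_left: "(c + d) *\<^sub>C x = c *\<^sub>C x + d *\<^sub>C x"
    and scaleC_scaleC: "c *\<^sub>C d *\<^sub>C x = (c * d) *\<^sub>C x"
    and scaleC_one: "1 *\<^sub>C x = x"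
    and cinner_commute: "cinner x y = cnj (cinner y x)"
    and cinner_add_left: "cinner (x + y) z = cinner x z + cinner y z"
    and cinner_scaleC_left: "cinner (c *\<^sub>C x) y = cnj c * cinner x y"
    and cinner_self: "cinner x x = complex_of_real ((norm x)\<^sup>2)"

global_interpretation complex_vector:
  vector_space "scaleC :: complex \<Rightarrow> 'a \<Rightarrow> 'a::chilbert_space"
  by unfold_locales
    (simp_all add: scaleC_add_right scaleC_add_left scaleC_scaleC scaleC_one)

instantiation complex :: chilbert_space
begin

definition scaleC_complex :: "complex \<Rightarrow> complex \<Rightarrow> complex" where
  "scaleC_complex c x = c * x"

definition cinner_complex :: "complex \<Rightarrow> complex \<Rightarrow> complex" where
  "cinner_complex x y = cnj x * y"

instance
  by standard
    (simp_all add: scaleC_complex_def cinner_complex_def algebra_simps scaleR_conv_of_real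
      complex_norm_square flip: of_real_power)

end


section \<open>Schatten classes\<close>

definition compact_operator :: "('h::chilbert_space \<Rightarrow> 'h) \<Rightarrow> bool" where
  "compact_operator T \<longleftrightarrow>
     bounded_linear T \<and> (\<forall>c x. T (c *\<^sub>C x) = c *\<^sub>C T x) \<and> compact (closure (T ` cball 0 1))"

definition cadjoint :: "('h::chilbert_space \<Rightarrow> 'h) \<Rightarrow> 'h \<Rightarrow> 'h" where
  "cadjoint T = (SOME S. \<forall>x y. cinner (S x) y = cinner x (T y))"

text \<open>
  The nonzero singular values of \<open>T\<close> are the \<open>s > 0\<close> such that \<open>s\<^sup>2\<close> is an eigenvalue of \<open>T\<^sup>*T\<close>,
  counted with the dimension of the eigenspace. For compact \<open>T\<close> this dimension is finite when
  \<open>s > 0\<close> (\<open>complex_vector.dim\<close> would be \<open>0\<close> on an infinite-dimensional space).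
\<close>

definition sv_space :: "('h::chilbert_space \<Rightarrow> 'h) \<Rightarrow> real \<Rightarrow> 'h set" where
  "sv_space T s = {x. cadjoint T (T x) = complex_of_real (s\<^sup>2) *\<^sub>C x}"

definition singular_values :: "('h::chilbert_space \<Rightarrow> 'h) \<Rightarrow> real set" where
  "singular_values T = {s. s > 0 \<and> (\<exists>x \<in> sv_space T s. x \<noteq> 0)}"

definition sv_mult :: "('h::chilbert_space \<Rightarrow> 'h) \<Rightarrow> real \<Rightarrow> nat" where
  "sv_mult T s = complex_vector.dim (sv_space T s)"

definition schatten_class :: "real \<Rightarrow> ('h::chilbert_space \<Rightarrow> 'h) cnormed" where
  "schatten_class p =
     \<lparr> vcarrier = {T. compact_operator T \<and>
         (\<lambda>s. real (sv_mult T s) * s powr p) summable_on singular_values T},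
       vzero = (\<lambda>x. 0),
       vadd = (\<lambda>S T x. S x + T x),
       vscale = (\<lambda>c T x. c *\<^sub>C T x),
       vnorm = (\<lambda>T. (\<Sum>\<^sub>\<infinity>s\<in>singular_values T. real (sv_mult T s) * s powr p) powr (1 / p)) \<rparr>"

end

theory Submission
  imports Defs "HOL-Complex_Analysis.Complex_Analysis"
begin

text \<open>
  Write \<open>N = norm\<^sup>p\<close>. What distinguishes the two kinds of spaces is the Clarkson inequality
  \<open>N (x + y) + N (x - y) \<le> 2 N x + 2 N y\<close>, valid for \<open>p \<le> 2\<close>, and the theorem holds in every space with this
  inequality (locale \<open>clarkson_space\<close>).

  Let \<open>x\<^sub>1, \<dots>, x\<^sub>n\<close> be vectors and let the \<open>\<lambda>\<^sub>j\<close> run independently through the unit circle. Since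
  \<open>ln \<bar>P\<^sub>i\<bar>\<close> is subharmonic along every complex line, its mean at \<open>\<Sum>\<^sub>j \<lambda>\<^sub>j x\<^sub>j\<close> is at least
  \<open>ln \<bar>P\<^sub>i x\<^sub>i\<bar>\<close>, and by the Clarkson inequality the mean of \<open>N\<close> there is at most \<open>\<Sum>\<^sub>j N x\<^sub>j\<close>. So some
  choice of the \<open>\<lambda>\<^sub>j\<close> does at least as well as the mean for
  \<open>\<Sum>\<^sub>i m\<^sub>i ln \<bar>P\<^sub>i\<bar> - \<kappa> N\<close>, whatever the exponents \<open>m\<^sub>i\<close>. The lemma \<open>product_value\<close> makes this
  choice one coefficient at a time; \<open>poly_product_ge_extreme_coeffs\<close> takes the place of the mean values of
  logarithms, so no integral appears.

  Take \<open>x\<^sub>i\<close> to be a multiple of a nearly norming vector of \<open>P\<^sub>i\<close> with \<open>N x\<^sub>i \<le> w\<^sub>i\<close>, where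
  \<open>w\<^sub>i = m\<^sub>i k\<^sub>i / K\<close> and \<open>K = \<Sum>\<^sub>j m\<^sub>j k\<^sub>j\<close>. After normalisation this gives a unit vector \<open>z\<close> at which
  \<open>\<Prod>\<^sub>i \<bar>P\<^sub>i z\<bar>\<^bsup>m\<^sub>i\<^esup>\<close> is almost \<open>\<Prod>\<^sub>i w\<^sub>i\<^bsup>w\<^sub>i K/p\<^esup> = exp (- K H/p)\<close> or more, where \<open>H\<close> is the
  entropy of \<open>w\<close> (\<open>normalised_product\<close>). All factors are at most \<open>1\<close>, so each of them has this lower bound.
  With \<open>a\<^sub>i\<^sup>p = exp (- t\<^sub>i)\<close> it remains to find \<open>w\<close> with \<open>H < w\<^sub>i t\<^sub>i\<close> for all \<open>i\<close>. Weights
  proportional to \<open>1 / t\<^sub>i\<close> have this property when \<open>\<Sum> exp (- t\<^sub>i) < n\<^bsup>-(n-1)\<^esup>\<close>, by Gibbs' inequality and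
  \<open>H \<le> ln n\<close> (\<open>entropy_weights\<close>). The case of equality in finite dimension follows by compactness of the ball.

  For \<open>L\<^sub>p\<close> the Clarkson inequality holds pointwise. For \<open>S\<^sub>p\<close> it is an inequality between traces of \<open>r\<close>-th
  powers, \<open>r = p/2\<close>. It follows from the identity \<open>\<bar>A + B\<bar>\<^sup>2 + \<bar>A - B\<bar>\<^sup>2 = 2 (\<bar>A\<bar>\<^sup>2 + \<bar>B\<bar>\<^sup>2)\<close>,
  because the trace of the \<open>r\<close>-th power is concave and subadditive on positive operators (\<open>trace_clarkson\<close>). Both facts are reduced to the concavity of the
  scalar function \<open>x\<^sup>r\<close> by comparing two orthonormal families of eigenvectors; the spectral theorem for positive
  compact operators says that these families are large enough.
\<close>

section \<open>Extreme coefficients and values on the unit circle\<close>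

text \<open>
  On the unit circle \<open>\<bar>g\<bar>\<close> agrees with the modulus of the reflected polynomial
  \<open>\<Sum>\<^sub>l cnj (g\<^sub>l) z\<^bsup>k-l\<^esup>\<close>, whose constant term is \<open>cnj (g\<^sub>k)\<close>. The maximum principle, applied to its product
  with \<open>f\<close>, compares the value at \<open>0\<close> with a value on the circle. The same point \<open>z\<close> thus serves a lowest and
  a highest coefficient at once.
\<close>

lemma poly_product_ge_extreme_coeffs:
  fixes f g :: "complex poly"
  assumes "degree g \<le> k"
  shows "\<exists>z. cmod z = 1 \<and> cmod (coeff f 0) * cmod (coeff g k) \<le> cmod (poly f z) * cmod (poly g z)"
proof (rule ccontr)
  assume neg: "\<not> ?thesis"
  define r where "r z = (\<Sum>l\<le>k. cnj (coeff g l) * z ^ (k - l))" for z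
  define h where "h z = poly f z * r z" for z
  have r: "cmod (r z) = cmod (poly g z)" if "cmod z = 1" for z
  proof -
    have zz: "z * cnj z = 1"
      using that by (simp add: complex_norm_square[symmetric])
    have "z ^ (k - l) = z ^ k * cnj z ^ l" if "l \<le> k" for l
    proof -
      have "z ^ k * cnj z ^ l = z ^ (k - l) * (z * cnj z) ^ l"
        using that by (simp add: power_mult_distrib flip: power_add mult.assoc)
      then show ?thesis using zz by simp
    qed
    then have "r z = (\<Sum>l\<le>k. cnj (coeff g l) * (z ^ k * cnj z ^ l))"
      unfolding r_def by (intro sum.cong) auto
    also have "\<dots> = z ^ k * cnj (\<Sum>l\<le>k. coeff g l * z ^ l)"
      by (simp add: sum_distrib_left algebra_simps)
    also have "(\<Sum>l\<le>k. coeff g l * z ^ l) = poly g z"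
      unfolding poly_altdef using assms
      by (intro sum.mono_neutral_right) (auto simp: coeff_eq_0)
    finally show ?thesis using that by (simp add: norm_mult norm_power)
  qed
  have holo: "h holomorphic_on UNIV"
    unfolding h_def r_def by (intro holomorphic_intros)
  have "compact ((\<lambda>z. cmod (h z)) ` sphere 0 1)"
    by (intro compact_continuous_image continuous_intros holomorphic_on_imp_continuous_on
        holomorphic_on_subset[OF holo]) auto
  moreover have "sphere (0::complex) 1 \<noteq> {}" by simp
  ultimately obtain z1 where z1: "z1 \<in> sphere 0 1" 
    "\<forall>z \<in> sphere 0 1. cmod (h z) \<le> cmod (h z1)"
    using compact_attains_sup[of "(\<lambda>z. cmod (h z)) ` sphere 0 1"] by force
  have "cmod (h 0) \<le> cmod (h z1)"
    by (rule maximum_modulus_frontier[of h "ball 0 1"])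
       (use z1 in \<open>auto intro!: holomorphic_on_subset[OF holo] holomorphic_on_imp_continuous_on\<close>)
  moreover have "h 0 = coeff f 0 * cnj (coeff g k)"
  proof -
    have "r 0 = (\<Sum>l\<in>{k}. cnj (coeff g l) * 0 ^ (k - l))"
      unfolding r_def by (intro sum.mono_neutral_right) auto
    then show ?thesis by (simp add: h_def poly_0_coeff_0)
  qed
  ultimately have "cmod (coeff f 0) * cmod (coeff g k) \<le> cmod (poly f z1) * cmod (r z1)"
    unfolding h_def by (metis complex_mod_cnj h_def norm_mult)
  then show False
    using neg z1 r[of z1] by auto
qed

section \<open>Spaces with a Clarkson inequality\<close>

text \<open>
  The Clarkson inequality stands in for the triangle inequality: it contains a quasi-triangle inequality for
  \<open>norm\<^sup>p\<close> and enough continuity of the norm for compactness arguments.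
\<close>

locale clarkson_space =
  fixes X :: "'x cnormed" and p :: real
  assumes p_pos: "0 < p"
    and zero_closed: "vzero X \<in> vcarrier X"
    and add_closed: "\<lbrakk>x \<in> vcarrier X; y \<in> vcarrier X\<rbrakk> \<Longrightarrow> vadd X x y \<in> vcarrier X"
    and scale_closed: "x \<in> vcarrier X \<Longrightarrow> vscale X c x \<in> vcarrier X"
    and add_assoc: "\<lbrakk>x \<in> vcarrier X; y \<in> vcarrier X; z \<in> vcarrier X\<rbrakk> \<Longrightarrow>
      vadd X (vadd X x y) z = vadd X x (vadd X y z)"
    and add_commute: "\<lbrakk>x \<in> vcarrier X; y \<in> vcarrier X\<rbrakk> \<Longrightarrow> vadd X x y = vadd X y x"
    and add_zero: "x \<in> vcarrier X \<Longrightarrow> vadd X x (vzero X) = x"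
    and scale_add_right: "\<lbrakk>x \<in> vcarrier X; y \<in> vcarrier X\<rbrakk> \<Longrightarrow>
      vscale X c (vadd X x y) = vadd X (vscale X c x) (vscale X c y)"
    and scale_add_left: "x \<in> vcarrier X \<Longrightarrow>
      vscale X (c + d) x = vadd X (vscale X c x) (vscale X d x)"
    and scale_scale: "x \<in> vcarrier X \<Longrightarrow> vscale X c (vscale X d x) = vscale X (c * d) x"
    and scale_one: "x \<in> vcarrier X \<Longrightarrow> vscale X 1 x = x"
    and scale_zero: "x \<in> vcarrier X \<Longrightarrow> vscale X 0 x = vzero X"
    and norm_nonneg: "x \<in> vcarrier X \<Longrightarrow> 0 \<le> vnorm X x"
    and norm_scale: "x \<in> vcarrier X \<Longrightarrow> vnorm X (vscale X c x) = cmod c * vnorm X x"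
    and norm_eq_zero: "\<lbrakk>x \<in> vcarrier X; vnorm X x = 0\<rbrakk> \<Longrightarrow> x = vzero X"
    and clarkson: "\<lbrakk>x \<in> vcarrier X; y \<in> vcarrier X\<rbrakk> \<Longrightarrow>
      vnorm X (vadd X x y) powr p + vnorm X (vadd X x (vscale X (- 1) y)) powr p
        \<le> 2 * vnorm X x powr p + 2 * vnorm X y powr p"
begin

abbreviation add (infixl \<open>\<oplus>\<close> 65) where "add \<equiv> vadd X"
abbreviation scale (infixr \<open>\<odot>\<close> 75) where "scale \<equiv> vscale X"
abbreviation zero (\<open>\<zero>\<close>) where "zero \<equiv> vzero X"
abbreviation carrier (\<open>V\<close>) where "carrier \<equiv> vcarrier X"
abbreviation sub (infixl \<open>\<ominus>\<close> 65) where "x \<ominus> y \<equiv> x \<oplus> (- 1) \<odot> y"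
abbreviation N where "N x \<equiv> vnorm X x powr p"

lemmas closed = zero_closed add_closed scale_closed

lemma scale_zero_right: "c \<odot> \<zero> = \<zero>"
  using scale_scale[OF zero_closed, of c 0] by (simp add: scale_zero closed)

lemma norm_zero: "vnorm X \<zero> = 0"
  using norm_scale[of \<zero> 0] by (simp add: closed scale_zero)

lemma N_scale: "x \<in> V \<Longrightarrow> N (c \<odot> x) = cmod c powr p * N x"
  by (simp add: norm_scale norm_nonneg powr_mult)

lemma vdist_zero: "x \<in> V \<Longrightarrow> vdist X x \<zero> = vnorm X x"
  by (simp add: vdist_def scale_zero_right add_zero)

end

section \<open>Continuous homogeneous polynomials\<close>

locale hom_poly = clarkson_space X p for X :: "'x cnormed" and p +
  fixes k :: nat and P :: "'x \<Rightarrow> complex"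
  assumes chp: "continuous_hom_poly X k P"
begin

definition form where
  "form = (SOME T. multilinear_on X k T \<and> continuous_on_power X k T \<and>
                   (\<forall>z \<in> V. P z = T (\<lambda>i\<in>{..<k}. z)))"

lemma form:
  shows form_multilinear: "multilinear_on X k form"
    and form_continuous: "continuous_on_power X k form"
    and form_diagonal: "z \<in> V \<Longrightarrow> P z = form (\<lambda>i\<in>{..<k}. z)"
  using someI_ex[OF chp[unfolded continuous_hom_poly_def]] unfolding form_def by blast+

lemma form_add:
  assumes "x \<in> {..<k} \<rightarrow>\<^sub>E V" "i < k" "u \<in> V" "v \<in> V"
  shows "form (x(i := u \<oplus> v)) = form (x(i := u)) + form (x(i := v))"
  using form_multilinear assms unfolding multilinear_on_def by blast

lemma form_scale:
  assumes "x \<in> {..<k} \<rightarrow>\<^sub>E V" "i < k" "u \<in> V"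
  shows "form (x(i := c \<odot> u)) = c * form (x(i := u))"
  using form_multilinear assms unfolding multilinear_on_def by blast

abbreviation fill :: "nat \<Rightarrow> 'x \<Rightarrow> (nat \<Rightarrow> 'x) \<Rightarrow> nat \<Rightarrow> 'x" where
  "fill j w v \<equiv> (\<lambda>i. if i < j then w else v i)"

lemma fill_in: "\<lbrakk>v \<in> {..<k} \<rightarrow>\<^sub>E V; w \<in> V; j \<le> k\<rbrakk> \<Longrightarrow> fill j w v \<in> {..<k} \<rightarrow>\<^sub>E V"
  by (auto simp: PiE_def Pi_def extensional_def)

lemma fill_Suc': "fill (Suc j) w v = fill j w (v(j := w))"
  by (auto simp: fun_eq_iff)

lemma fill_all: "w \<in> V \<Longrightarrow> fill k w (\<lambda>i\<in>{..<k}. \<zero>) = (\<lambda>i\<in>{..<k}. w)"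
  by (auto simp: fun_eq_iff)

text \<open>
  Expanding \<open>T (y + c x, \<dots>, y + c x)\<close> slot by slot: each slot adds one to the degree in \<open>c\<close>, keeps
  the all-\<open>y\<close> term as the constant coefficient and makes the all-\<open>x\<close> term the top one.
\<close>

lemma form_line_poly:
  assumes "x \<in> V" "y \<in> V" "j \<le> k" "v \<in> {..<k} \<rightarrow>\<^sub>E V"
  shows "\<exists>q. degree q \<le> j \<and> coeff q 0 = form (fill j y v) \<and> coeff q j = form (fill j x v) \<and>
             (\<forall>c. poly q c = form (fill j (y \<oplus> c \<odot> x) v))"
  using assms(3,4)
proof (induction j arbitrary: v)
  case 0
  show ?case by (rule exI[of _ "[:form v:]"]) simp
next
  case (Suc j)
  have "v(j := y) \<in> {..<k} \<rightarrow>\<^sub>E V" "v(j := x) \<in> {..<k} \<rightarrow>\<^sub>E V"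
    using Suc.prems assms by (auto simp: PiE_def Pi_def extensional_def)
  then obtain q r where
    q: "degree q \<le> j" "coeff q 0 = form (fill j y (v(j := y)))"
      "\<And>c. poly q c = form (fill j (y \<oplus> c \<odot> x) (v(j := y)))" and
    r: "degree r \<le> j" "coeff r j = form (fill j x (v(j := x)))"
      "\<And>c. poly r c = form (fill j (y \<oplus> c \<odot> x) (v(j := x)))"
    using Suc.IH[of "v(j := y)"] Suc.IH[of "v(j := x)"] Suc_leD[OF Suc.prems(1)] by blast
  let ?s = "q + pCons 0 r"
  have "degree ?s \<le> Suc j"
    using q(1) r(1) by (intro degree_add_le) (auto intro: order.trans[OF degree_pCons_le])
  moreover have "coeff ?s 0 = form (fill (Suc j) y v)"
    using q(2) by (simp add: fill_Suc')
  moreover have "coeff ?s (Suc j) = form (fill (Suc j) x v)"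
    using q(1) r(2) by (simp add: fill_Suc' coeff_eq_0)
  moreover have "poly ?s c = form (fill (Suc j) (y \<oplus> c \<odot> x) v)" for c
  proof -
    let ?w = "y \<oplus> c \<odot> x"
    let ?u = "fill j ?w v"
    have u: "?u \<in> {..<k} \<rightarrow>\<^sub>E V"
      using Suc.prems assms by (intro fill_in) (auto intro: closed)
    have upd: "fill j ?w (v(j := z)) = ?u(j := z)" for z by (auto simp: fun_eq_iff)
    have "form (fill (Suc j) ?w v) = form (?u(j := y \<oplus> c \<odot> x))"
      by (rule arg_cong[of _ _ form]) (auto simp: fun_eq_iff)
    also have "\<dots> = form (?u(j := y)) + c * form (?u(j := x))"
      using u Suc.prems assms by (simp add: form_add form_scale closed)
    finally show ?thesis by (simp add: q(3) r(3) upd)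
  qed
  ultimately show ?case by blast
qed

lemma line_poly:
  assumes "x \<in> V" "y \<in> V"
  shows "\<exists>q. degree q \<le> k \<and> coeff q 0 = P y \<and> coeff q k = P x \<and>
             (\<forall>c. poly q c = P (y \<oplus> c \<odot> x))"
proof -
  have "(\<lambda>i\<in>{..<k}. \<zero>) \<in> {..<k} \<rightarrow>\<^sub>E V" by (auto intro: closed)
  from form_line_poly[OF assms order.refl this] show ?thesis
    using assms by (auto simp only: fill_all form_diagonal closed)
qed

lemma hom_scale:
  assumes "x \<in> V"
  shows "P (c \<odot> x) = c ^ k * P x"
proof -
  have "form (fill j (c \<odot> x) v) = c ^ j * form (fill j x v)"
    if "j \<le> k" "v \<in> {..<k} \<rightarrow>\<^sub>E V" for j v
    using that
  proof (induction j arbitrary: v)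
    case (Suc j)
    have v: "v(j := x) \<in> {..<k} \<rightarrow>\<^sub>E V"
      using Suc.prems assms by (auto simp: PiE_def Pi_def extensional_def)
    have u: "fill j (c \<odot> x) v \<in> {..<k} \<rightarrow>\<^sub>E V"
      using Suc.prems assms by (intro fill_in) (auto intro: closed)
    have "form (fill (Suc j) (c \<odot> x) v) = form ((fill j (c \<odot> x) v)(j := c \<odot> x))"
      by (rule arg_cong[of _ _ form]) (auto simp: fun_eq_iff)
    also have "\<dots> = c * form ((fill j (c \<odot> x) v)(j := x))"
      using u Suc.prems assms by (simp add: form_scale)
    also have "(fill j (c \<odot> x) v)(j := x) = fill j (c \<odot> x) (v(j := x))"
      by (auto simp: fun_eq_iff)
    also have "form \<dots> = c ^ j * form (fill j x (v(j := x)))"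
      using Suc.IH[OF _ v] Suc.prems by simp
    finally show ?case by (simp add: fill_Suc')
  qed simp
  from this[of k "\<lambda>i\<in>{..<k}. \<zero>"] show ?thesis
    using assms by (simp add: fill_all form_diagonal closed del: restrict_apply)
qed

lemma hom_poly_tendsto:
  assumes "x \<in> V" "\<And>m. u m \<in> V" "(\<lambda>m. vdist X (u m) x) \<longlonglongrightarrow> 0"
  shows "(\<lambda>m. P (u m)) \<longlonglongrightarrow> P x"
proof (rule tendstoI)
  fix e :: real assume "e > 0"
  then obtain d where d: "d > 0" "\<And>y. y \<in> {..<k} \<rightarrow>\<^sub>E V \<Longrightarrow>
      (\<forall>i<k. vdist X (y i) ((\<lambda>i\<in>{..<k}. x) i) < d) \<Longrightarrow> dist (form y) (form (\<lambda>i\<in>{..<k}. x)) < e"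
    using bspec[OF form_continuous[unfolded continuous_on_power_def], of "\<lambda>i\<in>{..<k}. x"] assms(1)
    by (auto simp del: restrict_apply)
  have "\<forall>\<^sub>F m in sequentially. vdist X (u m) x < d"
    using order_tendstoD(2)[OF assms(3) d(1)] .
  then show "\<forall>\<^sub>F m in sequentially. dist (P (u m)) (P x) < e"
  proof eventually_elim
    case (elim m)
    show ?case
      using d(2)[of "\<lambda>i\<in>{..<k}. u m"] elim assms by (auto simp: form_diagonal)
  qed
qed

end

locale unit_hom_poly = hom_poly +
  assumes degree_pos: "1 \<le> k" and unit_norm: "poly_norm X P = 1"
begin

lemma P_zero: "P \<zero> = 0"
  using hom_scale[of \<zero> 0] degree_pos by (simp add: scale_zero closed power_0_left)

text \<open>
  The supremum in \<^const>\<open>poly_norm\<close> bounds \<open>\<bar>P\<bar>\<close> only when it is taken over a bounded set of reals.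
  Boundedness comes from continuity at \<open>0\<close> and homogeneity.
\<close>

lemma bdd_on_unit_ball: "bdd_above ((\<lambda>z. cmod (P z)) ` unit_ball X)"
proof -
  have z: "(\<lambda>i\<in>{..<k}. \<zero>) \<in> {..<k} \<rightarrow>\<^sub>E V" by (auto intro: closed)
  have "\<exists>d>0. \<forall>y \<in> {..<k} \<rightarrow>\<^sub>E V. (\<forall>i<k. vdist X (y i) ((\<lambda>i\<in>{..<k}. \<zero>) i) < d)
      \<longrightarrow> dist (form y) (form (\<lambda>i\<in>{..<k}. \<zero>)) < 1"
    using bspec[OF form_continuous[unfolded continuous_on_power_def] z] zero_less_one by blast
  then obtain d where d: "d > 0" "\<And>y. y \<in> {..<k} \<rightarrow>\<^sub>E V \<Longrightarrow>
      (\<forall>i<k. vdist X (y i) ((\<lambda>i\<in>{..<k}. \<zero>) i) < d) \<Longrightarrow>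
      dist (form y) (form (\<lambda>i\<in>{..<k}. \<zero>)) < 1"
    by blast
  have P: "cmod (P y) < 1" if "y \<in> V" "vnorm X y < d" for y
    using d(2)[of "\<lambda>i\<in>{..<k}. y"] that
    by (auto simp: form_diagonal[symmetric] closed P_zero vdist_zero dist_norm)
  have "cmod (P z) \<le> 1 / (d / 2) ^ k" if "z \<in> unit_ball X" for z
  proof -
    have z: "z \<in> V" "vnorm X z \<le> 1" using that by (auto simp: unit_ball_def)
    have "vnorm X (of_real (d / 2) \<odot> z) \<le> d / 2"
      using d z mult_left_mono[OF z(2), of "d / 2"] by (simp add: norm_scale norm_divide)
    then have "cmod (P (of_real (d / 2) \<odot> z)) < 1"
      using d z by (intro P) (auto intro: closed)
    then have "(d / 2) ^ k * cmod (P z) < 1"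
      using z d by (simp add: hom_scale norm_mult norm_power norm_divide)
    then show ?thesis using d by (simp add: field_simps)
  qed
  then show ?thesis by (auto intro!: bdd_aboveI2)
qed

lemma P_le_on_ball: "z \<in> unit_ball X \<Longrightarrow> cmod (P z) \<le> 1"
  using cSUP_upper[OF _ bdd_on_unit_ball] unit_norm by (simp add: poly_norm_def)

lemma almost_norming:
  assumes "b < 1"
  shows "\<exists>z \<in> V. vnorm X z \<le> 1 \<and> b < cmod (P z)"
proof -
  have "unit_ball X \<noteq> {}" using zero_closed norm_zero by (auto simp: unit_ball_def)
  then have "\<exists>z\<in>unit_ball X. b < cmod (P z)"
    using less_cSUP_iff[OF _ bdd_on_unit_ball, of b] assms unit_norm
    by (simp add: poly_norm_def)
  then show ?thesis by (auto simp: unit_ball_def)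
qed

end

section \<open>Products of polynomials at sums with unimodular coefficients\<close>

context clarkson_space
begin

lemma line_pair:
  assumes "x \<in> V" "y \<in> V" "cmod z = 1"
  shows "N (y \<oplus> z \<odot> x) + N (y \<oplus> (- z) \<odot> x) \<le> 2 * N y + 2 * N x"
  using clarkson[of y "z \<odot> x"] assms by (simp add: closed scale_scale N_scale)

text \<open>
  Along the line \<open>y + \<lambda> x\<close> the polynomials \<open>P\<^sub>i\<close>, \<open>i < n\<close>, are bounded below through their constant
  coefficient \<open>P\<^sub>i y\<close>, and \<open>P\<^sub>n\<close> through its top coefficient \<open>P\<^sub>n x\<close>. The pair \<open>\<lambda>\<close>, \<open>-\<lambda>\<close> is treated
  together because the Clarkson inequality controls \<open>N\<close> only on average over such a pair; one of the two points is
  then at least as good as their geometric mean.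
\<close>

lemma product_value_step:
  fixes m k :: "nat \<Rightarrow> nat"
  assumes P: "\<And>i. i \<le> n \<Longrightarrow> hom_poly X p (k i) (P i)"
    and x: "x \<in> V" and y: "y \<in> V" and \<kappa>: "0 \<le> \<kappa>"
  shows "\<exists>w\<in>V. (\<Prod>i<n. cmod (P i y) ^ m i) * cmod (P n x) ^ m n * exp (- \<kappa> * (N y + N x))
               \<le> (\<Prod>i\<le>n. cmod (P i w) ^ m i) * exp (- \<kappa> * N w)"
proof (cases "P n x = 0 \<and> m n \<noteq> 0")
  case True
  then show ?thesis
    by (intro bexI[of _ \<zero>]) (auto simp: power_0_left intro!: mult_nonneg_nonneg prod_nonneg closed)
next
  case False
  have "\<forall>i\<in>{..n}. \<exists>q. degree q \<le> k i \<and> coeff q 0 = P i y \<and> coeff q (k i) = P i x \<and>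
             (\<forall>c. poly q c = P i (y \<oplus> c \<odot> x))"
    using hom_poly.line_poly[OF P x y] by blast
  then obtain q where q: "\<And>i. i \<le> n \<Longrightarrow> degree (q i) \<le> k i"
    "\<And>i. i \<le> n \<Longrightarrow> coeff (q i) 0 = P i y"
    "\<And>i. i \<le> n \<Longrightarrow> coeff (q i) (k i) = P i x"
    "\<And>i c. i \<le> n \<Longrightarrow> poly (q i) c = P i (y \<oplus> c \<odot> x)"
    by (metis atMost_iff)
  \<comment> \<open>As a polynomial in \<open>c\<close>, \<open>q2 i\<close> is \<open>(P\<^sub>i (y + c x) P\<^sub>i (y - c x))\<^bsup>m\<^sub>i\<^esup>\<close>.\<close>
  define q2 where "q2 i = (q i * pcompose (q i) [:0, -1:]) ^ m i" for i
  have q2: "cmod (poly (q2 i) c) = cmod (P i (y \<oplus> c \<odot> x)) ^ m i * cmod (P i (y \<oplus> (- c) \<odot> x)) ^ m i"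
    if "i \<le> n" for i c
    using q(4)[OF that] by (simp add: q2_def poly_pcompose norm_mult norm_power power_mult_distrib)
  define f where "f = (\<Prod>i<n. q2 i)"
  have f0: "cmod (coeff f 0) = (\<Prod>i<n. cmod (P i y) ^ m i)\<^sup>2"
  proof -
    have "cmod (coeff f 0) = (\<Prod>i<n. cmod (poly (q2 i) 0))"
      by (simp add: f_def poly_prod prod_norm[symmetric] flip: poly_0_coeff_0)
    also have "\<dots> = (\<Prod>i<n. (cmod (P i y) ^ m i)\<^sup>2)"
      using x y by (intro prod.cong) (auto simp: q2 scale_zero add_zero power2_eq_square)
    finally show ?thesis by (simp add: prod_power_distrib)
  qed
  have gl: "cmod (lead_coeff (q2 n)) = (cmod (P n x) ^ m n)\<^sup>2"
  proof (cases "m n = 0")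
    case True
    then show ?thesis by (simp add: q2_def)
  next
    case False
    with \<open>\<not> (P n x = 0 \<and> m n \<noteq> 0)\<close> have "coeff (q n) (k n) \<noteq> 0" using q(3)[of n] by simp
    then have "degree (q n) = k n" using q(1)[of n] le_degree by fastforce
    then have "lead_coeff (q n) = P n x" using q(3)[of n] by simp
    then show ?thesis
      by (simp add: q2_def lead_coeff_mult lead_coeff_power lead_coeff_comp norm_mult norm_power
          power_mult_distrib power2_eq_square)
  qed
  obtain z where z: "cmod z = 1"
    "cmod (coeff f 0) * cmod (lead_coeff (q2 n)) \<le> cmod (poly f z) * cmod (poly (q2 n) z)"
    using poly_product_ge_extreme_coeffs[of "q2 n" "degree (q2 n)" f] by auto
  define u v where "u = y \<oplus> z \<odot> x" and "v = y \<oplus> (- z) \<odot> x"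
  have uv: "u \<in> V" "v \<in> V" using x y by (auto simp: u_def v_def closed)
  define A where "A w = (\<Prod>i\<le>n. cmod (P i w) ^ m i)" for w
  define b where "b = (\<Prod>i<n. cmod (P i y) ^ m i) * cmod (P n x) ^ m n"
  have A: "A w \<ge> 0" for w unfolding A_def by (intro prod_nonneg) auto
  have "b\<^sup>2 \<le> A u * A v"
  proof -
    have "b\<^sup>2 = cmod (coeff f 0) * cmod (lead_coeff (q2 n))"
      unfolding f0 gl b_def by (simp add: power_mult_distrib)
    also have "\<dots> \<le> (\<Prod>i<n. cmod (poly (q2 i) z)) * cmod (poly (q2 n) z)"
      using z(2) by (simp add: f_def poly_prod prod_norm[symmetric])
    also have "\<dots> = (\<Prod>i\<le>n. cmod (poly (q2 i) z))"
      by (simp add: lessThan_Suc_atMost[symmetric])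
    also have "\<dots> = A u * A v"
      unfolding A_def u_def v_def prod.distrib[symmetric] by (intro prod.cong) (auto simp: q2)
    finally show ?thesis .
  qed
  moreover have "exp (- \<kappa> * (N y + N x)) ^ 2 \<le> exp (- \<kappa> * N u) * exp (- \<kappa> * N v)"
    using mult_left_mono[OF line_pair[OF x y z(1)] \<kappa>]
    by (simp add: u_def v_def algebra_simps flip: exp_add exp_of_nat_mult exp_double)
  ultimately have *: "(b * exp (- \<kappa> * (N y + N x)))\<^sup>2 \<le> (A u * exp (- \<kappa> * N u)) * (A v * exp (- \<kappa> * N v))"
    using mult_mono[of "b\<^sup>2" "A u * A v" "exp (- \<kappa> * (N y + N x)) ^ 2" "exp (- \<kappa> * N u) * exp (- \<kappa> * N v)"] A
    by (simp add: power_mult_distrib mult_ac)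
  have "b * exp (- \<kappa> * (N y + N x)) \<le> A u * exp (- \<kappa> * N u) \<or>
        b * exp (- \<kappa> * (N y + N x)) \<le> A v * exp (- \<kappa> * N v)"
  proof (rule ccontr)
    assume "\<not> ?thesis"
    then have "(A u * exp (- \<kappa> * N u)) * (A v * exp (- \<kappa> * N v)) < 
        (b * exp (- \<kappa> * (N y + N x))) * (b * exp (- \<kappa> * (N y + N x)))"
      using A by (intro mult_strict_mono'[where b = "b * exp (- \<kappa> * (N y + N x))"
            and d = "b * exp (- \<kappa> * (N y + N x))"]) (auto simp: not_le)
    with * show False by (simp add: power2_eq_square)
  qed
  then show ?thesis using uv unfolding A_def b_def by blast
qed

lemma product_value:
  fixes m k :: "nat \<Rightarrow> nat"
  assumes P: "\<And>i. i < n \<Longrightarrow> hom_poly X p (k i) (P i)"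
    and x: "\<And>i. i < n \<Longrightarrow> x i \<in> V" and \<kappa>: "0 \<le> \<kappa>"
  shows "\<exists>y\<in>V. (\<Prod>i<n. cmod (P i (x i)) ^ m i) * exp (- \<kappa> * (\<Sum>i<n. N (x i)))
               \<le> (\<Prod>i<n. cmod (P i y) ^ m i) * exp (- \<kappa> * N y)"
  using P x
proof (induction n)
  case 0
  show ?case using p_pos by (intro bexI[of _ \<zero>]) (auto simp: norm_zero closed)
next
  case (Suc n)
  have "\<exists>y\<in>V. (\<Prod>i<n. cmod (P i (x i)) ^ m i) * exp (- \<kappa> * (\<Sum>i<n. N (x i)))
               \<le> (\<Prod>i<n. cmod (P i y) ^ m i) * exp (- \<kappa> * N y)"
    by (rule Suc.IH) (simp_all add: Suc.prems)
  then obtain y where y: "y \<in> V"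
    "(\<Prod>i<n. cmod (P i (x i)) ^ m i) * exp (- \<kappa> * (\<Sum>i<n. N (x i)))
               \<le> (\<Prod>i<n. cmod (P i y) ^ m i) * exp (- \<kappa> * N y)"
    by blast
  have "\<exists>w\<in>V. (\<Prod>i<n. cmod (P i y) ^ m i) * cmod (P n (x n)) ^ m n * exp (- \<kappa> * (N y + N (x n)))
               \<le> (\<Prod>i\<le>n. cmod (P i w) ^ m i) * exp (- \<kappa> * N w)"
    by (rule product_value_step[of n k P]) (use Suc.prems y(1) \<kappa> in simp_all)
  then obtain w where w: "w \<in> V"
    "(\<Prod>i<n. cmod (P i y) ^ m i) * cmod (P n (x n)) ^ m n * exp (- \<kappa> * (N y + N (x n)))
               \<le> (\<Prod>i\<le>n. cmod (P i w) ^ m i) * exp (- \<kappa> * N w)"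
    by blast
  have "(\<Prod>i<Suc n. cmod (P i (x i)) ^ m i) * exp (- \<kappa> * (\<Sum>i<Suc n. N (x i)))
     = ((\<Prod>i<n. cmod (P i (x i)) ^ m i) * exp (- \<kappa> * (\<Sum>i<n. N (x i))))
       * (cmod (P n (x n)) ^ m n * exp (- \<kappa> * N (x n)))"
    by (simp add: algebra_simps flip: exp_add)
  also have "\<dots> \<le> ((\<Prod>i<n. cmod (P i y) ^ m i) * exp (- \<kappa> * N y))
       * (cmod (P n (x n)) ^ m n * exp (- \<kappa> * N (x n)))"
    by (intro mult_right_mono y) auto
  also have "\<dots> = (\<Prod>i<n. cmod (P i y) ^ m i) * cmod (P n (x n)) ^ m n * exp (- \<kappa> * (N y + N (x n)))"
    by (simp add: algebra_simps flip: exp_add)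
  also note w(2)
  finally show ?case using w(1) by (auto simp: lessThan_Suc_atMost)
qed

end

section \<open>Exponents from an entropy inequality\<close>

text \<open>
  The inequality \<open>ln u \<le> u - 1\<close> at \<open>u = x\<^sub>i / (v\<^sub>i \<Sum> x)\<close>, averaged with the weights \<open>v\<^sub>i\<close>.
\<close>

lemma gibbs_inequality:
  fixes v x :: "nat \<Rightarrow> real"
  assumes "\<And>i. i < n \<Longrightarrow> 0 < v i" "\<And>i. i < n \<Longrightarrow> 0 < x i" "(\<Sum>i<n. v i) = 1"
  shows "(\<Sum>i<n. v i * ln (x i)) - (\<Sum>i<n. v i * ln (v i)) \<le> ln (\<Sum>i<n. x i)"
proof -
  define S where "S = (\<Sum>i<n. x i)"
  have "n > 0" using assms(3) by (cases n) auto
  then have S: "S > 0" unfolding S_def using assms(2) by (intro sum_pos) auto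
  have "(\<Sum>i<n. v i * ln (x i)) - (\<Sum>i<n. v i * ln (v i)) - ln S
      = (\<Sum>i<n. v i * ln (x i) - v i * ln (v i) - v i * ln S)"
    using assms(3) by (simp add: sum_subtractf flip: sum_distrib_right)
  also have "\<dots> \<le> (\<Sum>i<n. x i / S - v i)"
  proof (intro sum_mono)
    fix i assume "i \<in> {..<n}"
    then have p: "v i > 0" "x i > 0" using assms by auto
    have "v i * ln (x i) - v i * ln (v i) - v i * ln S = v i * ln (x i / (v i * S))"
      using p S by (simp add: ln_div ln_mult algebra_simps)
    also have "\<dots> \<le> v i * (x i / (v i * S) - 1)"
      using p S by (intro mult_left_mono ln_le_minus_one) auto
    also have "\<dots> = x i / S - v i" using p S by (simp add: field_simps)
    finally show "v i * ln (x i) - v i * ln (v i) - v i * ln S \<le> x i / S - v i" .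
  qed
  also have "\<dots> = 0"
    using S assms(3) by (simp add: sum_subtractf S_def flip: sum_divide_distrib)
  finally show ?thesis by (simp add: S_def)
qed

text \<open>
  With \<open>v\<^sub>i = c / t\<^sub>i\<close> all \<open>v\<^sub>i t\<^sub>i\<close> equal \<open>c\<close>, and Gibbs' inequality for \<open>x\<^sub>i = exp (- t\<^sub>i)\<close> reads
  \<open>H - n c \<le> ln (\<Sum> exp (- t\<^sub>i)) < - (n - 1) ln n\<close>. As \<open>H \<le> ln n\<close>, the right-hand side is at most
  \<open>- (n - 1) H\<close>, hence \<open>n H < n c\<close>. This is where the bound \<open>1 / n\<^bsup>n-1\<^esup>\<close> comes from.
\<close>

lemma entropy_weights_real:
  fixes t :: "nat \<Rightarrow> real"
  assumes n: "n \<ge> 1" and t: "\<And>i. i < n \<Longrightarrow> 0 < t i"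
    and small: "(\<Sum>i<n. exp (- t i)) < 1 / real n ^ (n - 1)"
  shows "\<exists>v. (\<forall>i<n. 0 < v i) \<and> (\<Sum>i<n. v i) = 1 \<and> (\<forall>i<n. - (\<Sum>j<n. v j * ln (v j)) < v i * t i)"
proof -
  define c where "c = 1 / (\<Sum>i<n. 1 / t i)"
  have c: "c > 0" unfolding c_def using n t by (auto intro!: divide_pos_pos sum_pos simp: lessThan_empty_iff)
  define v where "v i = c / t i" for i
  have v: "\<And>i. i < n \<Longrightarrow> 0 < v i" using c t by (simp add: v_def)
  have sv: "(\<Sum>i<n. v i) = 1"
    using c by (simp add: v_def c_def divide_inverse flip: sum_distrib_left)
  have vt: "v i * t i = c" if "i < n" for i using t[OF that] by (simp add: v_def)
  define H where "H = - (\<Sum>j<n. v j * ln (v j))"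
  have "H \<le> ln n"
    using gibbs_inequality[of n v "\<lambda>_. 1"] v sv by (simp add: H_def)
  then have "real (n - 1) * H \<le> real (n - 1) * ln n" by (intro mult_left_mono) auto
  moreover have "- (real n * c) + H \<le> ln (\<Sum>i<n. exp (- t i))"
  proof -
    have "(\<Sum>i<n. v i * - t i) = - (real n * c)" using vt by simp
    then show ?thesis using gibbs_inequality[of n v "\<lambda>i. exp (- t i)"] v sv by (simp add: H_def)
  qed
  moreover have "ln (\<Sum>i<n. exp (- t i)) < ln (1 / real n ^ (n - 1))"
    using small n by (subst ln_less_cancel_iff) (auto intro!: sum_pos simp: lessThan_empty_iff)
  moreover have "ln (1 / real n ^ (n - 1)) = - (real (n - 1) * ln n)"
    using n by (simp add: ln_div ln_realpow)
  moreover have "real (n - 1) * H = real n * H - H"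
    using n by (simp add: of_nat_diff algebra_simps)
  ultimately have "real n * H < real n * c" by linarith
  then have "H < c" using n by simp
  then show ?thesis using v sv vt unfolding H_def by (intro exI[of _ v]) auto
qed

text \<open>
  The exponents \<open>m\<^sub>i\<close> must be integers, so the real weights are approximated by the weights
  \<open>m\<^sub>i k\<^sub>i / \<Sum> m\<^sub>j k\<^sub>j\<close> with \<open>m\<^sub>i \<approx> L v\<^sub>i / k\<^sub>i\<close>; the strict inequalities survive for large \<open>L\<close>.
\<close>

lemma entropy_weights:
  fixes t :: "nat \<Rightarrow> real" and k :: "nat \<Rightarrow> nat"
  assumes n: "n \<ge> 1" and t: "\<And>i. i < n \<Longrightarrow> 0 < t i"
    and small: "(\<Sum>i<n. exp (- t i)) < 1 / real n ^ (n - 1)"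
    and k: "\<And>i. i < n \<Longrightarrow> k i \<ge> 1"
  obtains m :: "nat \<Rightarrow> nat" and w :: "nat \<Rightarrow> real" where
    "\<And>i. i < n \<Longrightarrow> m i \<ge> 1"
    "\<And>i. i < n \<Longrightarrow> w i = real (m i * k i) / real (\<Sum>j<n. m j * k j)"
    "\<And>i. i < n \<Longrightarrow> - (\<Sum>j<n. w j * ln (w j)) < w i * t i"
proof -
  obtain v where v: "\<And>i. i < n \<Longrightarrow> 0 < v i" "(\<Sum>i<n. v i) = 1"
    "\<And>i. i < n \<Longrightarrow> - (\<Sum>j<n. v j * ln (v j)) < v i * t i"
    using entropy_weights_real[OF n t small] by blast
  define m where "m L i = nat \<lceil>real L * (v i / k i)\<rceil>" for L i
  define w where "w L i = real (m L i * k i) / real (\<Sum>j<n. m L j * k j)" for L i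
  have m1: "(\<lambda>L. real (m L i) / real L) \<longlonglongrightarrow> v i / k i" if "i < n" for i
  proof (rule tendsto_sandwich)
    have pos: "v i / k i > 0" using v(1)[OF that] k[OF that] by simp
    have m: "real (m L i) = real_of_int \<lceil>real L * (v i / k i)\<rceil>" for L
    proof -
      have "0 \<le> real L * (v i / k i)" using pos by (intro mult_nonneg_nonneg) auto
      then have "0 \<le> \<lceil>real L * (v i / k i)\<rceil>" by linarith
      then show ?thesis by (simp add: m_def)
    qed
    show "\<forall>\<^sub>F L in sequentially. v i / k i \<le> real (m L i) / real L"
      using eventually_gt_at_top[of 0]
    proof eventually_elim
      case (elim L)
      have "real L * (v i / k i) \<le> m L i" unfolding m by (rule le_of_int_ceiling)
      then show ?case using elim by (simp add: field_simps)
    qed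
    show "\<forall>\<^sub>F L in sequentially. real (m L i) / real L \<le> v i / k i + 1 / real L"
      using eventually_gt_at_top[of 0]
    proof eventually_elim
      case (elim L)
      have "m L i \<le> real L * (v i / k i) + 1" unfolding m by linarith
      then show ?case using elim by (simp add: field_simps)
    qed
    show "(\<lambda>L. v i / k i + 1 / real L) \<longlonglongrightarrow> v i / k i"
      using tendsto_add[OF tendsto_const[of "v i / k i"] lim_1_over_n] by simp
  qed simp
  have mk: "(\<lambda>L. real (m L i * k i) / real L) \<longlonglongrightarrow> v i" if "i < n" for i
    using tendsto_mult[OF m1[OF that] tendsto_const[of "real (k i)"]] k[OF that] by simp
  have w: "(\<lambda>L. w L i) \<longlonglongrightarrow> v i" if "i < n" for i
  proof -
    have "(\<lambda>L. (real (m L i * k i) / real L) / (\<Sum>j<n. real (m L j * k j) / real L)) 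
        \<longlonglongrightarrow> v i / (\<Sum>j<n. v j)"
      using v(2) by (intro tendsto_divide mk that tendsto_sum) auto
    moreover have "\<forall>\<^sub>F L in sequentially.
        (real (m L i * k i) / real L) / (\<Sum>j<n. real (m L j * k j) / real L) = w L i"
      using eventually_gt_at_top[of 0]
      by eventually_elim (simp add: w_def flip: sum_divide_distrib)
    ultimately show ?thesis using v(2) by (simp add: filterlim_cong)
  qed
  have "\<forall>\<^sub>F L in sequentially. \<forall>i\<in>{..<n}. - (\<Sum>j<n. w L j * ln (w L j)) < w L i * t i"
  proof (intro eventually_ball_finite ballI)
    fix i assume i: "i \<in> {..<n}"
    have "(\<lambda>L. w L i * t i + (\<Sum>j<n. w L j * ln (w L j)))
        \<longlonglongrightarrow> v i * t i + (\<Sum>j<n. v j * ln (v j))"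
      using i v(1) by (intro tendsto_intros w) (auto simp: less_imp_neq[symmetric] dest: v(1))
    from order_tendstoD(1)[OF this, of 0]
    have "\<forall>\<^sub>F L in sequentially. 0 < w L i * t i + (\<Sum>j<n. w L j * ln (w L j))"
      using v(3)[of i] i by simp
    then show "\<forall>\<^sub>F L in sequentially. - (\<Sum>j<n. w L j * ln (w L j)) < w L i * t i"
      by eventually_elim linarith
  qed auto
  then obtain L0 where "\<forall>L\<ge>L0. \<forall>i\<in>{..<n}. - (\<Sum>j<n. w L j * ln (w L j)) < w L i * t i"
    unfolding eventually_sequentially by blast
  then have L: "\<forall>i\<in>{..<n}. - (\<Sum>j<n. w (Suc L0) j * ln (w (Suc L0) j)) < w (Suc L0) i * t i"
    by simp
  show ?thesis
  proof (rule that[of "m (Suc L0)" "w (Suc L0)"])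
    fix i assume i: "i < n"
    have "real (Suc L0) * (v i / k i) > 0" using v(1)[OF i] k[OF i] by simp
    then have "\<lceil>real (Suc L0) * (v i / k i)\<rceil> > 0" by linarith
    then show "1 \<le> m (Suc L0) i" unfolding m_def by linarith
  qed (use L in \<open>auto simp: w_def\<close>)
qed

section \<open>The strict inequality\<close>

context clarkson_space
begin

text \<open>
  The vectors \<open>x\<^sub>i = w\<^sub>i\<^bsup>1/p\<^esup> z\<^sub>i\<close> have \<open>\<Sum> N x\<^sub>i \<le> 1\<close>. With \<open>\<kappa> = K / p\<close>, the factor
  \<open>exp (- \<kappa> (N y - 1))\<close> from \<open>product_value\<close> is at most \<open>norm y\<^bsup>-K\<^esup>\<close>, because \<open>ln s \<le> s - 1\<close>; this is what
  dividing \<open>y\<close> by its norm costs.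
\<close>

lemma normalised_product:
  fixes m k :: "nat \<Rightarrow> nat" and w :: "nat \<Rightarrow> real"
  assumes n: "n \<ge> 1" and P: "\<And>i. i < n \<Longrightarrow> unit_hom_poly X p (k i) (P i)"
    and m: "\<And>i. i < n \<Longrightarrow> m i \<ge> 1"
    and w: "\<And>i. i < n \<Longrightarrow> w i = real (m i * k i) / real (\<Sum>j<n. m j * k j)"
    and z: "\<And>i. i < n \<Longrightarrow> z i \<in> unit_ball X" "\<And>i. i < n \<Longrightarrow> P i (z i) \<noteq> 0"
  shows "\<exists>y\<in>unit_ball X. (\<Prod>i<n. (w i powr (k i / p) * cmod (P i (z i))) ^ m i)
                          \<le> (\<Prod>i<n. cmod (P i y) ^ m i)"
proof -
  define K where "K = (\<Sum>j<n. m j * k j)"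
  have k: "k i \<ge> 1" if "i < n" for i using unit_hom_poly.degree_pos[OF P[OF that]] .
  have hp: "hom_poly X p (k i) (P i)" if "i < n" for i
    using P[OF that] unfolding unit_hom_poly_def by blast
  have "m 0 * k 0 \<ge> 1" using m[of 0] k[of 0] n by simp
  also have "m 0 * k 0 \<le> K" unfolding K_def using n by (intro member_le_sum) auto
  finally have K: "K \<ge> 1" .
  have wK: "w i = real (m i * k i) / real K" if "i < n" for i using w[OF that] by (simp add: K_def)
  have w0: "w i > 0" if "i < n" for i using wK[OF that] K m[OF that] k[OF that] by simp
  have w1: "(\<Sum>i<n. w i) = 1"
  proof -
    have "(\<Sum>i<n. w i) = (\<Sum>i<n. real (m i * k i) / real K)" by (intro sum.cong) (auto simp: wK)
    also have "\<dots> = real (\<Sum>i<n. m i * k i) / real K"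
      by (simp only: of_nat_sum sum_divide_distrib)
    finally show ?thesis using K by (simp add: K_def[symmetric])
  qed
  define x where "x i = of_real (w i powr (1 / p)) \<odot> z i" for i
  have zV: "z i \<in> V" "vnorm X (z i) \<le> 1" if "i < n" for i
    using z(1)[OF that] by (auto simp: unit_ball_def)
  have xV: "x i \<in> V" if "i < n" for i using zV[OF that] by (simp add: x_def closed)
  have Nx: "N (x i) \<le> w i" if "i < n" for i
  proof -
    have "N (x i) = w i * N (z i)"
      using zV[OF that] w0[OF that] p_pos by (simp add: x_def N_scale powr_powr)
    also have "\<dots> \<le> w i * 1"
      using zV[OF that] w0[OF that] p_pos norm_nonneg[OF zV(1)[OF that]]
      by (intro mult_left_mono) (auto intro: powr_le1)
    finally show ?thesis by simp
  qed
  have Px: "cmod (P i (x i)) = w i powr (k i / p) * cmod (P i (z i))" if "i < n" for i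
  proof -
    have "(w i powr (1 / p)) ^ k i = w i powr (k i / p)"
      using w0[OF that] by (simp add: powr_powr flip: powr_realpow)
    then show ?thesis
      using zV[OF that] w0[OF that]
      by (simp add: x_def hom_poly.hom_scale[OF hp[OF that]] norm_mult norm_power)
  qed
  define b where "b = (\<Prod>i<n. cmod (P i (x i)) ^ m i)"
  have b: "b > 0" unfolding b_def
  proof (intro prod_pos ballI zero_less_power)
    fix i assume "i \<in> {..<n}"
    then show "0 < cmod (P i (x i))" using Px[of i] w0[of i] z(2)[of i] by simp
  qed
  define \<kappa> where "\<kappa> = real K / p"
  have \<kappa>: "\<kappa> > 0" using K p_pos by (simp add: \<kappa>_def)
  obtain y where y: "y \<in> V"
    "b * exp (- \<kappa> * (\<Sum>i<n. N (x i))) \<le> (\<Prod>i<n. cmod (P i y) ^ m i) * exp (- \<kappa> * N y)"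
    using product_value[of n k P x \<kappa> m] hp xV \<kappa> unfolding b_def by (auto simp: less_imp_le)
  define r where "r = vnorm X y"
  define A where "A = (\<Prod>i<n. cmod (P i y) ^ m i)"
  have "(\<Sum>i<n. N (x i)) \<le> 1"
    using sum_mono[of "{..<n}" "\<lambda>i. N (x i)" w] Nx w1 by simp
  then have "b * exp (- \<kappa>) \<le> b * exp (- \<kappa> * (\<Sum>i<n. N (x i)))"
    using b \<kappa> by (intro mult_left_mono) auto
  then have bA: "b * exp (- \<kappa>) \<le> A * exp (- \<kappa> * N y)" using y(2) by (simp add: A_def)
  have "r \<noteq> 0"
  proof
    assume "r = 0"
    then have "y = \<zero>" using norm_eq_zero y(1) by (simp add: r_def)
    moreover have "0 < n" using n by simp
    ultimately have "A = 0"
      unfolding A_def using unit_hom_poly.P_zero[OF P] m[of 0]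
      by (intro prod_zero) (auto intro!: bexI[of _ 0])
    moreover have "b * exp (- \<kappa>) > 0" using b by simp
    ultimately show False using bA by simp
  qed
  then have r: "r > 0" using norm_nonneg[OF y(1)] by (simp add: r_def)
  define u where "u = of_real (1 / r) \<odot> y"
  have u: "u \<in> unit_ball X"
    using y(1) r by (simp add: u_def unit_ball_def closed norm_scale r_def norm_divide)
  have "(\<Prod>i<n. cmod (P i u) ^ m i) = A / r ^ K"
  proof -
    have "(\<Prod>i<n. cmod (P i u) ^ m i) = (\<Prod>i<n. cmod (P i y) ^ m i / r ^ (m i * k i))"
    proof (intro prod.cong refl)
      fix i assume "i \<in> {..<n}"
      then have "cmod (P i u) = cmod (P i y) / r ^ k i"
        using r y(1) by (simp add: u_def hom_poly.hom_scale[OF hp] norm_mult norm_power norm_divide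
            power_divide)
      then show "cmod (P i u) ^ m i = cmod (P i y) ^ m i / r ^ (m i * k i)"
        by (simp add: power_divide mult.commute flip: power_mult)
    qed
    then show ?thesis by (simp add: A_def K_def prod_dividef power_sum)
  qed
  moreover have "b * r ^ K \<le> A"
  proof -
    have "r ^ K = exp (\<kappa> * ln (N y))"
      using r p_pos by (simp add: \<kappa>_def r_def[symmetric] ln_powr exp_of_nat_mult)
    also have "\<dots> \<le> exp (\<kappa> * (N y - 1))"
      using \<kappa> r ln_le_minus_one[of "N y"] by (simp add: r_def[symmetric])
    finally have "b * r ^ K \<le> b * exp (\<kappa> * (N y - 1))" using b by simp
    also have "\<dots> = (b * exp (- \<kappa>)) * exp (\<kappa> * N y)"
      by (simp add: algebra_simps flip: exp_add)
    also have "\<dots> \<le> (A * exp (- \<kappa> * N y)) * exp (\<kappa> * N y)"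
      by (intro mult_right_mono bA) auto
    also have "\<dots> = A" by (simp add: mult.assoc flip: exp_add)
    finally show ?thesis .
  qed
  ultimately have "b \<le> (\<Prod>i<n. cmod (P i u) ^ m i)"
    using r by (simp add: pos_le_divide_eq)
  moreover have "b = (\<Prod>i<n. (w i powr (k i / p) * cmod (P i (z i))) ^ m i)"
    unfolding b_def by (intro prod.cong) (auto simp: Px)
  ultimately show ?thesis using u by auto
qed

text \<open>
  The gap \<open>\<delta>\<close> between \<open>H\<close> and the smallest \<open>w\<^sub>i t\<^sub>i\<close> leaves room for vectors \<open>z\<^sub>i\<close> that norm \<open>P\<^sub>i\<close> only up to
  the factor \<open>exp (- \<delta> / p)\<close>.
\<close>

lemma plank_strict_positive:
  fixes k :: "nat \<Rightarrow> nat" and t :: "nat \<Rightarrow> real"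
  assumes n: "n \<ge> 1" and P: "\<And>i. i < n \<Longrightarrow> unit_hom_poly X p (k i) (P i)"
    and t: "\<And>i. i < n \<Longrightarrow> 0 < t i" "(\<Sum>i<n. exp (- t i)) < 1 / real n ^ (n - 1)"
  shows "\<exists>z\<in>unit_ball X. \<forall>i<n. exp (- t i / p) ^ k i \<le> cmod (P i z)"
proof -
  have k: "k i \<ge> 1" if "i < n" for i using unit_hom_poly.degree_pos[OF P[OF that]] .
  obtain m w where m: "\<And>i. i < n \<Longrightarrow> m i \<ge> 1"
    and w: "\<And>i. i < n \<Longrightarrow> w i = real (m i * k i) / real (\<Sum>j<n. m j * k j)"
    and tw: "\<And>i. i < n \<Longrightarrow> - (\<Sum>j<n. w j * ln (w j)) < w i * t i"
    using entropy_weights[of n t k] n t k by blast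
  define K where "K = (\<Sum>j<n. m j * k j)"
  define H where "H = - (\<Sum>j<n. w j * ln (w j))"
  define M where "M = (\<Sum>j<n. m j)"
  have MK: "M \<le> K" unfolding M_def K_def using k by (intro sum_mono) auto
  have "m 0 * k 0 \<ge> 1" using m[of 0] k[of 0] n by simp
  also have "m 0 * k 0 \<le> K" unfolding K_def using n by (intro member_le_sum) auto
  finally have K: "K \<ge> 1" .
  have wK: "w i * K = real (m i * k i)" if "i < n" for i using w[OF that] K by (simp add: K_def[symmetric])
  have w0: "w i > 0" if "i < n" for i using w[OF that] K m[OF that] k[OF that] by (simp add: K_def[symmetric])
  define \<delta> where "\<delta> = Min ((\<lambda>i. w i * t i - H) ` {..<n})"
  have ne: "(\<lambda>i. w i * t i - H) ` {..<n} \<noteq> {}" using n by (auto simp: lessThan_empty_iff)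
  have \<delta>: "\<delta> > 0" unfolding \<delta>_def using ne by (subst Min_gr_iff) (auto simp: H_def dest: tw)
  have \<delta>i: "H + \<delta> \<le> w i * t i" if "i < n" for i
  proof -
    have "\<delta> \<le> w i * t i - H" unfolding \<delta>_def using that by (intro Min_le) auto
    then show ?thesis by simp
  qed
  define b where "b = exp (- \<delta> / p)"
  have b: "0 < b" "b < 1" using \<delta> p_pos by (auto simp: b_def)
  have "\<forall>i\<in>{..<n}. \<exists>z\<in>V. vnorm X z \<le> 1 \<and> b < cmod (P i z)"
    using unit_hom_poly.almost_norming[OF P b(2)] by blast
  then obtain z where z: "\<And>i. i < n \<Longrightarrow> z i \<in> unit_ball X" "\<And>i. i < n \<Longrightarrow> b < cmod (P i (z i))"
    unfolding unit_ball_def by (metis (no_types, lifting) lessThan_iff mem_Collect_eq)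
  then have "\<And>i. i < n \<Longrightarrow> P i (z i) \<noteq> 0" using b by fastforce
  then obtain y where y: "y \<in> unit_ball X"
    "(\<Prod>i<n. (w i powr (k i / p) * cmod (P i (z i))) ^ m i) \<le> (\<Prod>i<n. cmod (P i y) ^ m i)"
    using normalised_product[of n k P m w z] n P m w z(1) by blast
  have lower: "exp (- real K * (H + \<delta>) / p) \<le> (\<Prod>i<n. cmod (P i y) ^ m i)"
  proof -
    have "- real K * H / p = (\<Sum>i<n. real (m i * k i) / p * ln (w i))"
    proof -
      have "- real K * H / p = (\<Sum>i<n. real K * (w i * ln (w i)) / p)"
        by (simp add: H_def sum_distrib_left sum_divide_distrib flip: sum_negf)
      also have "\<dots> = (\<Sum>i<n. real (m i * k i) / p * ln (w i))"
        by (intro sum.cong) (auto simp: wK[symmetric] simp del: of_nat_mult)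
      finally show ?thesis .
    qed
    then have eH: "exp (- real K * H / p) = (\<Prod>i<n. (w i powr (k i / p)) ^ m i)"
      proof -
      have "exp (real (m i * k i) / p * ln (w i)) = (w i powr (k i / p)) ^ m i" if "i < n" for i
        using w0[OF that] by (simp add: powr_def mult_ac flip: exp_of_nat_mult)
      then show ?thesis
        unfolding \<open>- real K * H / p = _\<close> by (simp add: exp_sum)
    qed
    have eB: "exp (- real K * \<delta> / p) \<le> (\<Prod>i<n. b ^ m i)"
    proof -
      have "real M * \<delta> / p \<le> real K * \<delta> / p"
        using MK \<delta> p_pos by (intro divide_right_mono mult_right_mono) auto
      then have "exp (- real K * \<delta> / p) \<le> exp (real M * (- \<delta> / p))" by simp
      also have "\<dots> = b ^ M" unfolding b_def by (rule exp_of_nat_mult)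
      finally show ?thesis by (simp add: M_def power_sum)
    qed
    have "exp (- real K * (H + \<delta>) / p) \<le> (\<Prod>i<n. (w i powr (k i / p)) ^ m i) * (\<Prod>i<n. b ^ m i)"
    proof -
      have "exp (- real K * (H + \<delta>) / p) = exp (- real K * H / p) * exp (- real K * \<delta> / p)"
        by (simp add: algebra_simps add_divide_distrib diff_divide_distrib flip: exp_add)
      then show ?thesis
        unfolding eH by (simp only:) (intro mult_left_mono eB prod_nonneg; simp)
    qed
    also have "\<dots> = (\<Prod>i<n. (w i powr (k i / p) * b) ^ m i)"
      by (simp add: prod.distrib power_mult_distrib)
    also have "\<dots> \<le> (\<Prod>i<n. (w i powr (k i / p) * cmod (P i (z i))) ^ m i)"
      using z(2) b by (intro prod_mono conjI power_mono mult_left_mono) (auto intro: less_imp_le)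
    finally show ?thesis using y(2) by simp
  qed
  have "exp (- t i / p) ^ k i \<le> cmod (P i y)" if "i < n" for i
  proof -
    have "(exp (- t i / p) ^ k i) ^ m i = exp (real (m i * k i) * (- t i / p))"
      by (simp add: mult.commute flip: exp_of_nat_mult power_mult)
    also have "\<dots> = exp (- real K * (w i * t i) / p)"
      unfolding wK[OF that, symmetric] by (simp add: mult_ac)
    also have "\<dots> \<le> exp (- real K * (H + \<delta>) / p)"
      using mult_left_mono[OF \<delta>i[OF that], of "real K"] p_pos by (simp add: divide_right_mono)
    also note lower
    also have "(\<Prod>i<n. cmod (P i y) ^ m i)
        = cmod (P i y) ^ m i * (\<Prod>j\<in>{..<n} - {i}. cmod (P j y) ^ m j)"
      using that by (intro prod.remove) auto
    also have "\<dots> \<le> cmod (P i y) ^ m i * 1"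
      using unit_hom_poly.P_le_on_ball[OF P y(1)]
      by (intro mult_left_mono prod_le_1) (auto intro: power_le_one)
    finally have "(exp (- t i / p) ^ k i) ^ m i \<le> cmod (P i y) ^ m i" by simp
    then show ?thesis using m[OF that] by (auto dest: power_le_imp_le_base[of _ "m i - 1"] intro: power_mono_iff[THEN iffD1])
  qed
  then show ?thesis using y(1) by blast
qed

text \<open>
  Some \<open>a\<^sub>i\<close> may vanish, and then \<open>- ln (a\<^sub>i\<^sup>p)\<close> does not make sense. The slack in the hypothesis allows all
  \<open>a\<^sub>i\<^sup>p\<close> to be raised by the same \<open>\<gamma> > 0\<close>.
\<close>

lemma plank_strict:
  fixes k :: "nat \<Rightarrow> nat" and a :: "nat \<Rightarrow> real"
  assumes n: "n \<ge> 1" and P: "\<And>i. i < n \<Longrightarrow> unit_hom_poly X p (k i) (P i)"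
    and a: "\<And>i. i < n \<Longrightarrow> 0 \<le> a i" "(\<Sum>i<n. a i powr p) < 1 / real n ^ (n - 1)"
  shows "\<exists>z\<in>unit_ball X. \<forall>i<n. a i ^ k i \<le> cmod (P i z)"
proof -
  \<comment> \<open>Half of the slack, distributed evenly.\<close>
  define \<gamma> where "\<gamma> = (1 / real n ^ (n - 1) - (\<Sum>i<n. a i powr p)) / (2 * n)"
  have \<gamma>: "\<gamma> > 0" using a(2) n by (simp add: \<gamma>_def)
  define t where "t i = - ln (a i powr p + \<gamma>)" for i
  have e: "exp (- t i) = a i powr p + \<gamma>" for i
    using \<gamma> powr_ge_zero[of "a i" p] by (simp add: t_def add_nonneg_pos)
  have sum: "(\<Sum>i<n. exp (- t i)) < 1 / real n ^ (n - 1)"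
  proof -
    have "(\<Sum>i<n. exp (- t i)) = (\<Sum>i<n. a i powr p) + n * \<gamma>" by (simp add: e sum.distrib)
    also have "n * \<gamma> = (1 / real n ^ (n - 1) - (\<Sum>i<n. a i powr p)) / 2"
      using n by (simp add: \<gamma>_def)
    also have "(\<Sum>i<n. a i powr p) + (1 / real n ^ (n - 1) - (\<Sum>i<n. a i powr p)) / 2
      < 1 / real n ^ (n - 1)" using a(2) by argo
    finally show ?thesis .
  qed
  also have "\<dots> \<le> 1" using n by simp
  finally have le1: "(\<Sum>i<n. exp (- t i)) < 1" .
  have "t i > 0" if "i < n" for i
  proof -
    have "exp (- t i) \<le> (\<Sum>i<n. exp (- t i))" using that by (intro member_le_sum) auto
    then have "exp (- t i) < 1" using le1 by linarith
    then show ?thesis by simp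
  qed
  then obtain z where
    z: "z \<in> unit_ball X" "\<And>i. i < n \<Longrightarrow> exp (- t i / p) ^ k i \<le> cmod (P i z)"
    using plank_strict_positive[of n k P t] n P sum by blast
  have "a i ^ k i \<le> cmod (P i z)" if "i < n" for i
  proof -
    have "a i = (a i powr p) powr (1 / p)" using p_pos a(1)[OF that] by (simp add: powr_powr)
    also have "\<dots> \<le> exp (- t i) powr (1 / p)"
      unfolding e using \<gamma> p_pos by (intro powr_mono2) auto
    also have "\<dots> = exp (- t i / p)" by (simp add: powr_def)
    finally show ?thesis using z(2)[OF that] power_mono[of "a i" _ "k i"] a(1)[OF that] by force
  qed
  then show ?thesis using z(1) by blast
qed

end

section \<open>Compactness of the ball in finite dimension\<close>

context clarkson_space
begin

lemma quasi_triangle: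
  assumes "x \<in> V" "y \<in> V"
  shows "N (x \<oplus> y) \<le> 2 * N x + 2 * N y"
  using clarkson[OF assms] powr_ge_zero[of "vnorm X (x \<ominus> y)" p] by linarith

lemma add_left_commute:
  "\<lbrakk>x \<in> V; y \<in> V; z \<in> V\<rbrakk> \<Longrightarrow> x \<oplus> (y \<oplus> z) = y \<oplus> (x \<oplus> z)"
  by (metis add_assoc add_commute)

lemma add_swap:
  assumes "a \<in> V" "b \<in> V" "c \<in> V" "d \<in> V"
  shows "(a \<oplus> b) \<oplus> (c \<oplus> d) = (a \<oplus> c) \<oplus> (b \<oplus> d)"
  using assms add_left_commute[of b c d] by (simp only: add_assoc closed)

lemma zero_add: "x \<in> V \<Longrightarrow> \<zero> \<oplus> x = x"
  using add_commute[of \<zero> x] by (simp add: add_zero closed)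

lemma sub_self: "x \<in> V \<Longrightarrow> x \<ominus> x = \<zero>"
  using scale_add_left[of x 1 "-1"] by (simp add: scale_one scale_zero)

lemma add_sub_cancel: "\<lbrakk>x \<in> V; y \<in> V\<rbrakk> \<Longrightarrow> (x \<oplus> y) \<ominus> y = x"
  by (simp add: add_assoc sub_self closed add_zero)

lemma sub_add_cancel: "\<lbrakk>x \<in> V; y \<in> V\<rbrakk> \<Longrightarrow> y \<oplus> (x \<ominus> y) = x"
  by (simp add: add_left_commute[of y x] sub_self closed add_zero)

lemma N_eq_zero: "x \<in> V \<Longrightarrow> N x = 0 \<Longrightarrow> x = \<zero>"
  using norm_eq_zero by simp

lemma N_zero: "N \<zero> = 0"
  by (simp add: norm_zero)

definition conv :: "(nat \<Rightarrow> 'x) \<Rightarrow> 'x \<Rightarrow> bool" where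
  "conv u x \<longleftrightarrow> (\<lambda>m. N (u m \<ominus> x)) \<longlonglongrightarrow> 0"

lemma conv_unique:
  assumes "conv u x" "conv u y" "\<And>m. u m \<in> V" "x \<in> V" "y \<in> V"
  shows "x = y"
proof -
  have "N (x \<ominus> y) \<le> 2 * N (u m \<ominus> x) + 2 * N (u m \<ominus> y)" for m
  proof -
    let ?y = "(- 1) \<odot> y" and ?u = "(- 1) \<odot> u m"
    have V: "u m \<in> V" "?u \<in> V" "?y \<in> V" "x \<in> V" using assms by (auto intro: closed)
    have "(u m \<ominus> y) \<ominus> (u m \<ominus> x) = (u m \<oplus> ?y) \<oplus> (?u \<oplus> x)"
      using V assms(4) by (simp only: scale_add_right scale_scale closed) (simp add: scale_one)
    also have "\<dots> = (?y \<oplus> u m) \<oplus> (?u \<oplus> x)" by (simp only: add_commute[OF V(1,3)])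
    also have "\<dots> = ?y \<oplus> ((u m \<ominus> u m) \<oplus> x)" using V by (simp only: add_assoc closed)
    also have "\<dots> = x \<ominus> y" using V by (simp only: sub_self zero_add) (rule add_commute)
    finally show ?thesis
      using clarkson[of "u m \<ominus> y" "u m \<ominus> x"] powr_ge_zero[of "vnorm X ((u m \<ominus> y) \<oplus> (u m \<ominus> x))" p]
        add_closed[OF V(1,3)] add_closed[OF V(1) scale_closed[OF V(4), of "- 1"]] by (simp del: powr_ge_zero)
  qed
  moreover have "(\<lambda>m. 2 * N (u m \<ominus> x) + 2 * N (u m \<ominus> y)) \<longlonglongrightarrow> 2 * 0 + 2 * 0"
    using assms(1,2) unfolding conv_def by (intro tendsto_intros)
  ultimately have "N (x \<ominus> y) \<le> 2 * 0 + 2 * 0"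
    by (intro LIMSEQ_le_const) auto
  then have "x \<ominus> y = \<zero>" using assms by (intro N_eq_zero) (auto simp: closed order_antisym)
  then show ?thesis using sub_add_cancel[of x y] assms by (simp add: add_zero)
qed

lemma conv_scale_coeff:
  assumes "c \<longlonglongrightarrow> d" "x \<in> V"
  shows "conv (\<lambda>m. c m \<odot> x) (d \<odot> x)"
proof -
  have "N (c m \<odot> x \<ominus> d \<odot> x) = cmod (c m - d) powr p * N x" for m
  proof -
    have "c m \<odot> x \<ominus> d \<odot> x = (c m - d) \<odot> x"
      using assms(2) scale_add_left[of x "c m" "- d"] by (simp add: scale_scale)
    then show ?thesis using assms(2) by (simp add: N_scale)
  qed
  moreover have "(\<lambda>m. cmod (c m - d) powr p * N x) \<longlonglongrightarrow> 0"
  proof -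
    have "(\<lambda>m. cmod (c m - d)) \<longlonglongrightarrow> 0"
      using assms(1) by (simp add: LIM_zero tendsto_norm_zero)
    then have "(\<lambda>m. cmod (c m - d) powr p) \<longlonglongrightarrow> 0"
      using p_pos by (intro tendsto_zero_powrI) auto
    then show ?thesis by (rule tendsto_mult_left_zero)
  qed
  ultimately show ?thesis by (simp add: conv_def)
qed

lemma conv_add:
  assumes "conv u x" "conv v y" "\<And>m. u m \<in> V" "\<And>m. v m \<in> V" "x \<in> V" "y \<in> V"
  shows "conv (\<lambda>m. u m \<oplus> v m) (x \<oplus> y)"
proof -
  have le: "N ((u m \<oplus> v m) \<ominus> (x \<oplus> y)) \<le> 2 * N (u m \<ominus> x) + 2 * N (v m \<ominus> y)" for m
  proof -
    let ?x = "(- 1) \<odot> x" and ?y = "(- 1) \<odot> y"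
    have V: "?x \<in> V" "?y \<in> V" using assms by (auto intro: closed)
    have "(u m \<oplus> v m) \<ominus> (x \<oplus> y) = (u m \<oplus> v m) \<oplus> (?x \<oplus> ?y)"
      by (simp only: scale_add_right[OF assms(5,6)])
    also have "\<dots> = (u m \<ominus> x) \<oplus> (v m \<ominus> y)"
      by (rule add_swap[OF assms(3,4) V])
    finally show ?thesis
      using quasi_triangle[OF add_closed[OF assms(3) V(1)] add_closed[OF assms(4) V(2)], of m m]
      by (simp only:)
  qed
  have lim: "(\<lambda>m. 2 * N (u m \<ominus> x) + 2 * N (v m \<ominus> y)) \<longlonglongrightarrow> 0"
  proof -
    have "(\<lambda>m. 2 * N (u m \<ominus> x) + 2 * N (v m \<ominus> y)) \<longlonglongrightarrow> 2 * 0 + 2 * 0"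
      by (rule tendsto_add; rule tendsto_mult_left) (rule assms(1,2)[unfolded conv_def])+
    then show ?thesis by (simp only: mult_zero_right add_0)
  qed
  show ?thesis
    unfolding conv_def
  proof (rule Lim_null_comparison[OF _ lim], rule always_eventually, rule allI)
    show "norm (N ((u m \<oplus> v m) \<ominus> (x \<oplus> y))) \<le> 2 * N (u m \<ominus> x) + 2 * N (v m \<ominus> y)" for m
      using le[of m] by (simp only: real_norm_def abs_of_nonneg[OF powr_ge_zero])
  qed
qed

lemma conv_subseq: "conv u x \<Longrightarrow> strict_mono r \<Longrightarrow> conv (u \<circ> r) x"
  unfolding conv_def using LIMSEQ_subseq_LIMSEQ[of "\<lambda>m. N (u m \<ominus> x)" 0 r] by (simp add: o_def)

text \<open>
  Lower semicontinuity of the norm from the Clarkson inequality. Along the progression \<open>x + j b\<close> with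
  \<open>b = u\<^sub>m - x\<close> the second differences of \<open>N\<close> are at most \<open>2 N b\<close>, which is tiny. If \<open>N\<close> dropped by
  \<open>d > 0\<close> from \<open>x\<close> to \<open>x + b = u\<^sub>m\<close>, it would go on dropping by almost \<open>d\<close> in each step and become negative.
\<close>

lemma conv_norm_le:
  assumes "conv u x" "\<And>m. u m \<in> V" "x \<in> V" "\<And>m. N (u m) \<le> C"
  shows "N x \<le> C"
proof (rule ccontr)
  assume "\<not> N x \<le> C"
  define d where "d = N x - C"
  have d: "d > 0" using \<open>\<not> N x \<le> C\<close> by (simp add: d_def)
  obtain J :: nat where J: "real J * d > N x + 1"
    using d by (metis reals_Archimedean3)
  have "0 < 1 / (real J * real J + 1)" by (simp add: add_nonneg_pos)
  from order_tendstoD(2)[OF assms(1)[unfolded conv_def] this]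
  obtain m where m: "N (u m \<ominus> x) < 1 / (real J * real J + 1)"
    unfolding eventually_sequentially by blast
  define b where "b = u m \<ominus> x"
  have bV: "b \<in> V" using assms(2,3) by (simp add: b_def closed)
  define g where "g j = N (x \<oplus> of_nat j \<odot> b)" for j :: nat
  have g0: "g 0 = N x" using assms(3) bV by (simp add: g_def scale_zero add_zero)
  have g1: "g 1 \<le> C"
    using sub_add_cancel[of "u m" x] assms(2,3,4) bV by (simp add: g_def scale_one b_def)
  have step: "g (Suc (Suc j)) - g (Suc j) \<le> g (Suc j) - g j + 2 * N b" for j
  proof -
    let ?c = "x \<oplus> of_nat (Suc j) \<odot> b"
    have "?c \<in> V" using assms(3) bV by (simp add: closed del: of_nat_Suc)
    moreover have "?c \<oplus> b = x \<oplus> of_nat (Suc (Suc j)) \<odot> b"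
      using scale_add_left[OF bV, of "of_nat (Suc j)" 1] assms(3) bV
      by (simp add: add_assoc closed scale_one add.commute)
    moreover have "?c \<ominus> b = x \<oplus> of_nat j \<odot> b"
      using scale_add_left[OF bV, of "of_nat (Suc j)" "- 1"] assms(3) bV
      by (simp add: add_assoc closed)
    ultimately show ?thesis
      using clarkson[of ?c b] bV unfolding g_def by simp
  qed
  have incr: "g (Suc j) - g j \<le> - d + 2 * real j * N b" for j
  proof (induction j)
    case 0
    then show ?case using g0 g1 by (simp add: d_def)
  next
    case (Suc j)
    then show ?case using step[of j] by (simp add: algebra_simps)
  qed
  have sum: "g j \<le> N x - real j * d + real j * real j * N b" for j
  proof (induction j)
    case 0
    then show ?case using g0 by simp
  next
    case (Suc j)
    have "real (Suc j) * real (Suc j) * N b = real j * real j * N b + 2 * real j * N b + N b"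
      by (simp add: algebra_simps)
    moreover have "real (Suc j) * d = real j * d + d" by (simp add: algebra_simps)
    ultimately show ?case using Suc incr[of j] powr_ge_zero[of "vnorm X b" p] by linarith
  qed
  have "real J * real J * N b \<le> 1"
  proof -
    have "real J * real J * N b \<le> real J * real J * (1 / (real J * real J + 1))"
      using m by (intro mult_left_mono) (auto simp: b_def)
    also have "\<dots> \<le> 1" by (simp add: divide_le_eq_1 add_nonneg_pos)
    finally show ?thesis .
  qed
  then have "g J < 0" using sum[of J] J by linarith
  then show False by (simp add: g_def)
qed

lemma vspan_closed: "B \<subseteq> V \<Longrightarrow> vspan X B \<subseteq> V"
proof
  fix x assume "B \<subseteq> V" "x \<in> vspan X B"
  from this(2,1) show "x \<in> V" by induction (auto intro: closed)
qed

lemma vspan_scale: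
  assumes "B \<subseteq> V" "x \<in> vspan X B" shows "c \<odot> x \<in> vspan X B"
  using assms(2)
proof induction
  case vspan_zero
  show ?case unfolding scale_zero_right by (rule vspan.vspan_zero)
next
  case (vspan_step x y d)
  then have "x \<in> V" "y \<in> V" using assms(1) vspan_closed by blast+
  then show ?case
    using vspan.vspan_step[OF vspan_step(1,3), of "c * d"] by (simp add: scale_add_right scale_scale closed)
qed

lemma vspan_insert:
  assumes "insert b B \<subseteq> V" "x \<in> vspan X (insert b B)"
  shows "\<exists>c. \<exists>y\<in>vspan X B. x = c \<odot> b \<oplus> y"
  using assms(2)
proof induction
  case vspan_zero
  have "\<zero> = 0 \<odot> b \<oplus> \<zero>" using assms(1) by (simp add: scale_zero add_zero closed)
  then show ?case using vspan.vspan_zero by blast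
next
  case (vspan_step x y d)
  then obtain c z where z: "z \<in> vspan X B" "y = c \<odot> b \<oplus> z" by blast
  have V: "b \<in> V" "z \<in> V" "x \<in> V" using assms(1) z vspan_closed vspan_step(1) by blast+
  show ?case
  proof (cases "x = b")
    case True
    then have "d \<odot> x \<oplus> y = (d + c) \<odot> b \<oplus> z"
      using z V by (simp add: scale_add_left add_assoc closed)
    then show ?thesis using z by blast
  next
    case False
    then have "d \<odot> x \<oplus> z \<in> vspan X B" using vspan_step(1) z by (intro vspan.vspan_step) auto
    moreover have "d \<odot> x \<oplus> y = c \<odot> b \<oplus> (d \<odot> x \<oplus> z)"
      using z V by (simp add: add_left_commute closed)
    ultimately show ?thesis by blast
  qed
qed

text \<open>
  If \<open>c\<^sub>m\<close> were unbounded, dividing the bounded vectors \<open>c\<^sub>m b + y\<^sub>m\<close> by \<open>- c\<^sub>m\<close> would exhibit \<open>b\<close> as a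
  limit of the bounded vectors \<open>- y\<^sub>m / c\<^sub>m\<close>. By compactness \<open>b\<close> would belong to the span.
\<close>

lemma bounded_new_coeff:
  assumes b: "b \<in> V" and B: "B \<subseteq> V" and new: "b \<notin> vspan X B"
    and compact: "\<And>u C. (\<And>m. u m \<in> vspan X B) \<Longrightarrow> (\<And>m. N (u m) \<le> C) \<Longrightarrow>
      \<exists>r x. strict_mono (r :: nat \<Rightarrow> nat) \<and> x \<in> vspan X B \<and> conv (u \<circ> r) x"
    and y: "\<And>m. y m \<in> vspan X B" and bounded: "\<And>m. N (c m \<odot> b \<oplus> y m) \<le> C"
  shows "bounded (range (c :: nat \<Rightarrow> complex))"
proof (rule ccontr)
  assume "\<not> bounded (range c)"
  have "\<exists>m. cmod (c m) > real j" for j :: nat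
  proof (rule ccontr)
    assume "\<not> ?thesis"
    then have "bounded (range c)" by (auto simp: bounded_iff not_less)
    with \<open>\<not> bounded (range c)\<close> show False by simp
  qed
  then obtain s where s: "\<And>j::nat. cmod (c (s j)) > real j" by metis
  have c0: "c (s j) \<noteq> 0" for j using s[of j] by auto
  define v where "v j = (- (1 / c (s j))) \<odot> y (s j)" for j
  have vs: "v j \<in> vspan X B" for j using y vspan_scale[OF B] by (simp add: v_def)
  have vV: "v j \<in> V" for j using vs vspan_closed[OF B] by blast
  have yV: "y m \<in> V" for m using y vspan_closed[OF B] by blast
  define u where "u m = c m \<odot> b \<oplus> y m" for m
  have uV: "u m \<in> V" for m using yV b by (simp add: u_def closed)
  have vb: "v j \<ominus> b = (- (1 / c (s j))) \<odot> u (s j)" for j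
  proof -
    have "(- (1 / c (s j))) \<odot> u (s j) = (- (1 / c (s j)) * c (s j)) \<odot> b \<oplus> v j"
      using b yV by (simp only: u_def v_def scale_add_right scale_closed scale_scale)
    also have "- (1 / c (s j)) * c (s j) = - 1" using c0 by simp
    also have "(- 1) \<odot> b \<oplus> v j = v j \<ominus> b" by (rule add_commute[OF scale_closed[OF b] vV])
    finally show ?thesis ..
  qed
  have inv0: "(\<lambda>j. 1 / cmod (c (s j))) \<longlonglongrightarrow> 0"
  proof (rule Lim_null_comparison[OF _ lim_1_over_n])
    show "\<forall>\<^sub>F j in sequentially. norm (1 / cmod (c (s j))) \<le> 1 / real j"
      using eventually_gt_at_top[of 0]
    proof eventually_elim
      case (elim j)
      then show ?case using s[of j] by (simp add: frac_le)
    qed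
  qed
  have conv_b: "conv v b"
    unfolding conv_def
  proof (rule Lim_null_comparison)
    have "N (v j \<ominus> b) \<le> (1 / cmod (c (s j))) powr p * C" for j
    proof -
      have "N (v j \<ominus> b) = (1 / cmod (c (s j))) powr p * N (u (s j))"
        using uV[of "s j"] unfolding vb by (simp add: N_scale norm_divide)
      then show ?thesis using bounded[of "s j"] by (simp add: mult_left_mono u_def)
    qed
    then show "\<forall>\<^sub>F j in sequentially. norm (N (v j \<ominus> b)) \<le> (1 / cmod (c (s j))) powr p * C"
      by simp
    show "(\<lambda>j. (1 / cmod (c (s j))) powr p * C) \<longlonglongrightarrow> 0"
      by (rule tendsto_mult_left_zero, rule tendsto_zero_powrI[OF inv0 tendsto_const]) (use p_pos in auto)
  qed
  have "bounded (range (\<lambda>j. N (v j \<ominus> b)))"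
    by (rule convergent_imp_bounded[OF conv_b[unfolded conv_def]])
  then obtain D where "\<forall>x\<in>range (\<lambda>j. N (v j \<ominus> b)). norm x \<le> D"
    unfolding bounded_iff by blast
  then have D: "N (v j \<ominus> b) \<le> D" for j
    by (metis abs_le_D1 rangeI real_norm_def)
  have Nv: "N (v j) \<le> 2 * N b + 2 * D" for j
  proof -
    have "N (v j) = N (b \<oplus> (v j \<ominus> b))" by (simp only: sub_add_cancel[OF vV b])
    also have "\<dots> \<le> 2 * N b + 2 * N (v j \<ominus> b)"
      by (rule quasi_triangle[OF b add_closed[OF vV scale_closed[OF b]]])
    finally show ?thesis using D[of j] by linarith
  qed
  have "\<exists>r x. strict_mono (r :: nat \<Rightarrow> nat) \<and> x \<in> vspan X B \<and> conv (v \<circ> r) x"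
    by (rule compact[OF vs Nv])
  then obtain r x where rx: "strict_mono r" "x \<in> vspan X B" "conv (v \<circ> r) x"
    by (elim exE conjE) (rule that)
  have "x = b"
    by (rule conv_unique[OF rx(3) conv_subseq[OF conv_b rx(1)] _ _ b])
       (use vV rx(2) vspan_closed[OF B] in \<open>unfold o_def, blast+\<close>)
  then show False using new rx by blast
qed

lemma vspan_sequentially_compact:
  assumes "finite B" "B \<subseteq> V" "\<And>m. u m \<in> vspan X B" "\<And>m. N (u m) \<le> C"
  shows "\<exists>r x. strict_mono (r :: nat \<Rightarrow> nat) \<and> x \<in> vspan X B \<and> conv (u \<circ> r) x"
  using assms
proof (induction B arbitrary: u C rule: finite_induct)
  case empty
  have "u m = \<zero>" for m
    using empty(2)[of m] by (cases rule: vspan.cases) auto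
  then have "conv (u \<circ> id) \<zero>" by (simp add: conv_def o_def sub_self closed N_zero)
  then show ?case using strict_mono_id vspan.vspan_zero by blast
next
  case (insert b B)
  have bB: "b \<in> V" "B \<subseteq> V" using insert.prems by auto
  have mono: "vspan X B \<subseteq> vspan X (insert b B)"
  proof
    fix x assume "x \<in> vspan X B" then show "x \<in> vspan X (insert b B)"
      by induction (auto intro: vspan.intros)
  qed
  show ?case
  proof (cases "b \<in> vspan X B")
    case True
    have "vspan X (insert b B) \<subseteq> vspan X B"
    proof
      fix x assume "x \<in> vspan X (insert b B)"
      then obtain c y where y: "y \<in> vspan X B" "x = c \<odot> b \<oplus> y" using vspan_insert insert.prems(1) by blast
      have "d \<odot> w \<oplus> y \<in> vspan X B" if "w \<in> vspan X B" for w d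
        using that
      proof (induction arbitrary: d)
        case vspan_zero
        then show ?case using y vspan_closed[OF bB(2)] by (auto simp: scale_zero_right zero_add)
      next
        case (vspan_step w1 w2 e)
        have "w1 \<in> V" "w2 \<in> V" "y \<in> V" using vspan_step y bB vspan_closed by blast+
        then show ?case
          using vspan.vspan_step[OF vspan_step(1) vspan_step(3)[of d], of "d * e"]
          by (simp add: scale_add_right scale_scale closed add_assoc)
      qed
      then show "x \<in> vspan X B" using y True by blast
    qed
    then have "\<exists>r x. strict_mono (r :: nat \<Rightarrow> nat) \<and> x \<in> vspan X B \<and> conv (u \<circ> r) x"
      using insert.IH[OF bB(2), of u C] insert.prems by blast
    then show ?thesis using mono by blast
  next
    case False
    have "\<forall>m. \<exists>c y. y \<in> vspan X B \<and> u m = c \<odot> b \<oplus> y"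
      using vspan_insert[OF insert.prems(1)] insert.prems(2) by blast
    then obtain c y where y: "\<And>m. y m \<in> vspan X B" "\<And>m. u m = c m \<odot> b \<oplus> y m"
      by metis
    have yV: "y m \<in> V" for m using y(1) vspan_closed[OF bB(2)] by blast
    have uV: "u m \<in> V" for m using yV bB y(2) by (simp add: closed)
    have "bounded (range c)"
      by (rule bounded_new_coeff[OF bB False insert.IH[OF bB(2)] y(1)])
         (use insert.prems(3) in \<open>auto simp: y(2)\<close>)
    then obtain r1 d where r1: "strict_mono r1" "(c \<circ> r1) \<longlonglongrightarrow> d"
      using bounded_imp_convergent_subsequence[of c] by blast
    from \<open>bounded (range c)\<close> obtain D where D: "\<And>m. cmod (c m) \<le> D"
      unfolding bounded_iff by blast
    have "N (y m) \<le> 2 * C + 2 * (D powr p * N b)" for m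
    proof -
      have "y m = u m \<oplus> (- c m) \<odot> b"
      proof -
        have "u m = y m \<oplus> c m \<odot> b"
          unfolding y(2) by (rule add_commute) (use yV bB in \<open>auto intro: closed\<close>)
        then show ?thesis
          using add_sub_cancel[OF yV scale_closed[OF bB(1)], of m "c m"] bB by (simp add: scale_scale)
      qed
      then have "N (y m) \<le> 2 * N (u m) + 2 * (cmod (c m) powr p * N b)"
        using quasi_triangle[of "u m" "(- c m) \<odot> b"] uV[of m] bB by (simp add: closed N_scale)
      moreover have "cmod (c m) powr p * N b \<le> D powr p * N b"
        using D[of m] p_pos by (intro mult_right_mono powr_mono2) auto
      ultimately show ?thesis using insert.prems(3)[of m] by linarith
    qed
    then have "\<And>m. N ((y \<circ> r1) m) \<le> 2 * C + 2 * (D powr p * N b)" by simp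
    moreover have "\<And>m. (y \<circ> r1) m \<in> vspan X B" by (simp add: y(1))
    ultimately obtain r2 x where r2: "strict_mono r2" "x \<in> vspan X B" "conv ((y \<circ> r1) \<circ> r2) x"
      using insert.IH[OF bB(2)] by blast
    have xV: "x \<in> V" using r2 vspan_closed[OF bB(2)] by blast
    have "conv (\<lambda>m. (c \<circ> r1 \<circ> r2) m \<odot> b \<oplus> ((y \<circ> r1) \<circ> r2) m) (d \<odot> b \<oplus> x)"
      by (rule conv_add[OF conv_scale_coeff[OF LIMSEQ_subseq_LIMSEQ[OF r1(2) r2(1)] bB(1)] r2(3)])
         (use bB yV xV in \<open>auto simp: closed\<close>)
    then have "conv (u \<circ> (r1 \<circ> r2)) (d \<odot> b \<oplus> x)" by (simp add: o_def y(2))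
    moreover have "d \<odot> b \<oplus> x \<in> vspan X (insert b B)" using r2 mono by (intro vspan.vspan_step) auto
    ultimately show ?thesis using strict_mono_o[OF r1(1) r2(1)] by blast
  qed
qed

text \<open>
  Solutions for the numbers \<open>(1 - 1/m) a\<^sub>i\<close>, which satisfy the strict inequality, accumulate at a solution for the
  \<open>a\<^sub>i\<close>.
\<close>

lemma plank_equality:
  fixes k :: "nat \<Rightarrow> nat" and a :: "nat \<Rightarrow> real"
  assumes n: "n \<ge> 1" and P: "\<And>i. i < n \<Longrightarrow> unit_hom_poly X p (k i) (P i)"
    and fd: "finite_dimensional X"
    and a: "\<And>i. i < n \<Longrightarrow> 0 \<le> a i" "(\<Sum>i<n. a i powr p) = 1 / real n ^ (n - 1)"
  shows "\<exists>z\<in>unit_ball X. \<forall>i<n. a i ^ k i \<le> cmod (P i z)"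
proof -
  obtain B where B: "finite B" "B \<subseteq> V" "vspan X B = V"
    using fd unfolding finite_dimensional_def by blast
  define s where "s m = 1 - 1 / real (Suc (Suc m))" for m
  have s: "0 < s m" "s m < 1" for m by (auto simp: s_def)
  have s1: "s \<longlonglongrightarrow> 1"
    unfolding s_def using tendsto_diff[OF tendsto_const[of 1] LIMSEQ_Suc[OF LIMSEQ_inverse_real_of_nat]]
    by (simp add: divide_inverse)
  have "\<exists>z\<in>unit_ball X. \<forall>i<n. (s m * a i) ^ k i \<le> cmod (P i z)" for m
  proof (rule plank_strict[OF n P])
    have "(\<Sum>i<n. (s m * a i) powr p) = s m powr p * (\<Sum>i<n. a i powr p)"
      unfolding sum_distrib_left using s[of m] a(1) by (intro sum.cong) (auto simp: powr_mult less_imp_le)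
    also have "\<dots> < 1 * (1 / real n ^ (n - 1))"
      unfolding a(2) using s[of m] p_pos n by (intro mult_strict_right_mono) (auto simp: powr01_less_one)
    finally show "(\<Sum>i<n. (s m * a i) powr p) < 1 / real n ^ (n - 1)" by simp
  qed (use s a(1) in \<open>auto intro: mult_nonneg_nonneg less_imp_le\<close>)
  then obtain z where z: "\<And>m. z m \<in> unit_ball X" "\<And>m i. i < n \<Longrightarrow> (s m * a i) ^ k i \<le> cmod (P i (z m))"
    by metis
  have zV: "z m \<in> V" "vnorm X (z m) \<le> 1" for m using z(1)[of m] by (auto simp: unit_ball_def)
  have Nz: "N (z m) \<le> 1" for m using zV[of m] norm_nonneg p_pos by (intro powr_le1) auto
  obtain r x where r: "strict_mono r" "x \<in> V" "conv (z \<circ> r) x"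
    using vspan_sequentially_compact[OF B(1,2), of z 1] zV Nz B(3) by auto
  have "N x \<le> 1" using conv_norm_le[OF r(3) _ r(2)] zV Nz by simp
  then have "vnorm X x \<le> 1" using p_pos by (rule_tac ccontr) (auto simp: not_le dest: gr_one_powr[of _ p])
  then have "x \<in> unit_ball X" using r by (simp add: unit_ball_def)
  moreover have "a i ^ k i \<le> cmod (P i x)" if i: "i < n" for i
  proof -
    have "(\<lambda>m. (N ((z \<circ> r) m \<ominus> x)) powr (1 / p)) \<longlonglongrightarrow> 0"
      by (rule tendsto_zero_powrI[OF r(3)[unfolded conv_def] tendsto_const]) (use p_pos in auto)
    moreover have "(N ((z \<circ> r) m \<ominus> x)) powr (1 / p) = vdist X ((z \<circ> r) m) x" for m
      using p_pos zV r norm_nonneg[of "z (r m) \<ominus> x"] by (simp add: powr_powr vdist_def closed)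
    ultimately have "(\<lambda>m. vdist X ((z \<circ> r) m) x) \<longlonglongrightarrow> 0" by simp
    then have "(\<lambda>m. P i ((z \<circ> r) m)) \<longlonglongrightarrow> P i x"
      using hom_poly.hom_poly_tendsto[of X p "k i" "P i" x "z \<circ> r"] P[OF i] zV r(2)
      by (auto simp: unit_hom_poly_def)
    then have "(\<lambda>m. cmod (P i ((z \<circ> r) m))) \<longlonglongrightarrow> cmod (P i x)" by (rule tendsto_norm)
    moreover have "(\<lambda>m. ((s \<circ> r) m * a i) ^ k i) \<longlonglongrightarrow> (1 * a i) ^ k i"
      by (intro tendsto_intros LIMSEQ_subseq_LIMSEQ s1 r)
    ultimately show ?thesis
      using z(2)[OF i] by (auto intro: LIMSEQ_le)
  qed
  ultimately show ?thesis by blast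
qed

end

section \<open>Complex Hilbert spaces\<close>

lemma cinner_add_right: "cinner x (y + z) = cinner x y + cinner x (z :: 'h::chilbert_space)"
  by (metis cinner_add_left cinner_commute complex_cnj_add)

lemma cinner_scaleC_right: "cinner x (c *\<^sub>C y) = c * cinner x (y :: 'h::chilbert_space)"
  by (metis cinner_commute cinner_scaleC_left complex_cnj_cnj complex_cnj_mult)

lemma cinner_scaleR_left: "cinner (r *\<^sub>R x) y = r *\<^sub>R cinner x (y :: 'h::chilbert_space)"
  unfolding scaleR_scaleC[of r x] cinner_scaleC_left by (simp add: scaleR_conv_of_real)

lemma cinner_scaleR_right: "cinner x (r *\<^sub>R y) = r *\<^sub>R cinner x (y :: 'h::chilbert_space)"
  unfolding scaleR_scaleC[of r y] cinner_scaleC_right by (simp add: scaleR_conv_of_real)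

lemma Re_cinner_self: "Re (cinner x x) = (norm (x :: 'h::chilbert_space))\<^sup>2"
  by (simp add: cinner_self)

lemma norm_scaleC: "norm (c *\<^sub>C x) = cmod c * norm (x :: 'h::chilbert_space)"
proof -
  have "(norm (c *\<^sub>C x))\<^sup>2 = Re ((c * cnj c) * cinner x x)"
    by (simp add: Re_cinner_self[symmetric] cinner_scaleC_left cinner_scaleC_right mult_ac)
  also have "\<dots> = (cmod c * norm x)\<^sup>2"
    by (simp add: complex_norm_square[symmetric] cinner_self power_mult_distrib del: of_real_power flip: of_real_mult of_real_power)
  finally show ?thesis by (rule power2_eq_imp_eq) auto
qed

text \<open>
  Applied to the inner product and, later, to the form of a positive operator.
\<close>

lemma semidefinite_cauchy_schwarz:
  fixes B :: "'h::chilbert_space \<Rightarrow> 'h \<Rightarrow> complex"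
  assumes add: "\<And>x y z. B x (y + z) = B x y + B x z"
    and scale: "\<And>c x y. B x (c *\<^sub>C y) = c * B x y"
    and herm: "\<And>x y. B y x = cnj (B x y)"
    and pos: "\<And>x. 0 \<le> Re (B x x)"
  shows "(cmod (B x y))\<^sup>2 \<le> Re (B x x) * Re (B y y)"
proof -
  let ?b = "B x y"
  have addl: "B (x + z) y = B x y + B z y" for x y z by (metis add herm complex_cnj_add)
  have scalel: "B (c *\<^sub>C x) y = cnj c * B x y" for c x y by (metis scale herm complex_cnj_mult)
  have *: "0 \<le> Re (B x x) - 2 * t * (cmod ?b)\<^sup>2 + t\<^sup>2 * (cmod ?b)\<^sup>2 * Re (B y y)" for t :: real
  proof -
    define c where "c = - of_real t * cnj ?b"
    have "B (x + c *\<^sub>C y) (x + c *\<^sub>C y) = B x x + (c * ?b + cnj (c * ?b)) + (c * cnj c) * B y y"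
      using herm[of x y] by (simp add: add addl scale scalel algebra_simps)
    moreover have "c * ?b = of_real (- t * (cmod ?b)\<^sup>2)"
      unfolding c_def of_real_mult complex_norm_square by simp
    moreover have "c * cnj c = of_real (t\<^sup>2 * (cmod ?b)\<^sup>2)"
      unfolding c_def of_real_mult complex_norm_square by (simp add: power2_eq_square)
    ultimately have "Re (B (x + c *\<^sub>C y) (x + c *\<^sub>C y))
        = Re (B x x) - 2 * t * (cmod ?b)\<^sup>2 + t\<^sup>2 * (cmod ?b)\<^sup>2 * Re (B y y)"
      by (simp del: of_real_mult of_real_power)
    then show ?thesis using pos[of "x + c *\<^sub>C y"] by simp
  qed
  show ?thesis
  proof (cases "Re (B y y) = 0")
    case True
    have "(cmod ?b)\<^sup>2 = 0"
    proof (rule ccontr)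
      assume "(cmod ?b)\<^sup>2 \<noteq> 0"
      then show False
        using *[of "(Re (B x x) + 1) / (2 * (cmod ?b)\<^sup>2)"] True by simp
    qed
    then show ?thesis using True by simp
  next
    case False
    then have p: "Re (B y y) > 0" using pos[of y] by simp
    have "0 \<le> Re (B x x) - (cmod ?b)\<^sup>2 / Re (B y y)"
      using *[of "1 / Re (B y y)"] p by (simp add: power2_eq_square)
    then show ?thesis using p by (simp add: field_simps)
  qed
qed

lemma cauchy_schwarz: "cmod (cinner x y) \<le> norm x * norm (y :: 'h::chilbert_space)"
proof -
  have "(cmod (cinner x y))\<^sup>2 \<le> Re (cinner x x) * Re (cinner y y)"
    by (rule semidefinite_cauchy_schwarz)
       (auto simp: cinner_add_right cinner_scaleC_right Re_cinner_self intro: cinner_commute)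
  then have "(cmod (cinner x y))\<^sup>2 \<le> (norm x * norm y)\<^sup>2"
    by (simp add: Re_cinner_self power_mult_distrib)
  then show ?thesis by (rule power2_le_imp_le) auto
qed

global_interpretation cinner: bounded_bilinear "cinner :: 'h::chilbert_space \<Rightarrow> 'h \<Rightarrow> complex"
  by unfold_locales
     (auto simp: cinner_add_left cinner_add_right cinner_scaleR_left cinner_scaleR_right
       intro!: exI[of _ 1] cauchy_schwarz)

lemma bounded_linear_scaleC: "bounded_linear (\<lambda>x :: 'h::chilbert_space. c *\<^sub>C x)"
  by (rule bounded_linear_intro[where K = "cmod c"])
     (auto simp: scaleC_add_right norm_scaleC scaleR_scaleC scaleC_scaleC mult.commute)

lemma norm_add_sq:
  "(norm (x + y))\<^sup>2 = (norm x)\<^sup>2 + 2 * Re (cinner x y) + (norm (y :: 'h::chilbert_space))\<^sup>2"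
  using arg_cong[OF cinner_commute[of x y], of Re]
  by (simp add: Re_cinner_self[symmetric] cinner_add_left cinner_add_right)

lemma norm_diff_sq:
  "(norm (x - y))\<^sup>2 = (norm x)\<^sup>2 - 2 * Re (cinner x y) + (norm (y :: 'h::chilbert_space))\<^sup>2"
  using norm_add_sq[of x "- y"] by (simp add: cinner.minus_right)

lemma cinner_eqI: "(\<And>z. cinner z x = cinner z y) \<Longrightarrow> x = (y :: 'h::chilbert_space)"
proof -
  assume "\<And>z. cinner z x = cinner z y"
  then have "cinner (x - y) (x - y) = 0" by (simp add: cinner.diff_right)
  then show ?thesis by (simp add: cinner_self)
qed

lemma cinner_eqI_left: "(\<And>z. cinner x z = cinner y z) \<Longrightarrow> x = (y :: 'h::chilbert_space)"
  by (rule cinner_eqI) (metis cinner_commute)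

lemma cinner_eq_0_commute: "cinner x y = 0 \<longleftrightarrow> cinner y (x :: 'h::chilbert_space) = 0"
  by (metis cinner_commute complex_cnj_zero)

subsection \<open>Projections\<close>

text \<open>
  A minimising sequence for the distance to \<open>W\<close> is Cauchy by the parallelogram law; its limit is the foot of
  the perpendicular.
\<close>

lemma projection_exists:
  fixes v :: "'h::chilbert_space"
  assumes W: "closed W" "complex_vector.subspace W"
  shows "\<exists>w\<in>W. \<forall>u\<in>W. cinner u (v - w) = 0"
proof -
  define d where "d = (INF w\<in>W. (norm (v - w))\<^sup>2)"
  have ne: "W \<noteq> {}" using complex_vector.subspace_0[OF W(2)] by blast
  have bdd: "bdd_below ((\<lambda>w. (norm (v - w))\<^sup>2) ` W)" by (rule bdd_belowI2[of _ 0]) auto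
  have d_le: "d \<le> (norm (v - w))\<^sup>2" if "w \<in> W" for w
    unfolding d_def by (rule cINF_lower[OF bdd that])
  have "\<exists>w\<in>W. (norm (v - w))\<^sup>2 < d + 1 / real (Suc n)" for n
    using cINF_less_iff[OF ne bdd, of "d + 1 / real (Suc n)"] by (simp add: d_def)
  then obtain w where w: "\<And>n. w n \<in> W" "\<And>n. (norm (v - w n))\<^sup>2 < d + 1 / real (Suc n)"
    by metis
  have dist: "(norm (w m - w n))\<^sup>2 \<le> 2 / real (Suc m) + 2 / real (Suc n)" for m n
  proof -
    let ?h = "(1 / 2 :: real) *\<^sub>R (w m + w n)"
    have "?h \<in> W"
      using w(1) W(2) unfolding scaleR_scaleC
      by (intro complex_vector.subspace_scale complex_vector.subspace_add)
    then have "d \<le> (norm (v - ?h))\<^sup>2" by (rule d_le)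
    moreover have "(norm ((v - w n) + (v - w m)))\<^sup>2 = 4 * (norm (v - ?h))\<^sup>2"
    proof -
      have "(v - w n) + (v - w m) = 2 *\<^sub>R (v - ?h)" by (simp add: algebra_simps scaleR_2)
      then show ?thesis by (simp add: power_mult_distrib)
    qed
    moreover have "(norm ((v - w n) - (v - w m)))\<^sup>2 + (norm ((v - w n) + (v - w m)))\<^sup>2
        = 2 * (norm (v - w n))\<^sup>2 + 2 * (norm (v - w m))\<^sup>2"
      unfolding norm_add_sq norm_diff_sq by simp
    moreover have "(v - w n) - (v - w m) = w m - w n" by simp
    ultimately show ?thesis using w(2)[of m] w(2)[of n] by (simp only: add_divide_distrib)
  qed
  have "Cauchy w"
  proof (rule metric_CauchyI)
    fix e :: real assume e: "e > 0"
    then obtain M where M: "1 / real (Suc M) < e\<^sup>2 / 4"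
      using nat_approx_posE[of "e\<^sup>2 / 4"] by auto
    have "dist (w m) (w n) < e" if "m \<ge> M" "n \<ge> M" for m n
    proof -
      have "2 / real (Suc m) \<le> 2 / real (Suc M)" "2 / real (Suc n) \<le> 2 / real (Suc M)"
        using that by (auto intro!: divide_left_mono)
      then have "(norm (w m - w n))\<^sup>2 < e\<^sup>2" using dist[of m n] M by simp
      then show ?thesis using power2_less_imp_less[of "norm (w m - w n)" e] e by (simp add: dist_norm)
    qed
    then show "\<exists>M. \<forall>m\<ge>M. \<forall>n\<ge>M. dist (w m) (w n) < e" by blast
  qed
  then obtain x where x: "w \<longlonglongrightarrow> x" using Cauchy_convergent convergent_def by blast
  have xW: "x \<in> W" using closed_sequentially[OF W(1)] w(1) x by blast
  have "(norm (v - x))\<^sup>2 \<le> d + 0"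
  proof (rule LIMSEQ_le)
    show "(\<lambda>n. (norm (v - w n))\<^sup>2) \<longlonglongrightarrow> (norm (v - x))\<^sup>2"
      by (intro tendsto_intros x)
    show "(\<lambda>n. d + 1 / real (Suc n)) \<longlonglongrightarrow> d + 0"
      using LIMSEQ_inverse_real_of_nat by (intro tendsto_intros) (simp add: divide_inverse)
  qed (use w(2) less_imp_le in blast)
  then have min: "(norm (v - x))\<^sup>2 \<le> (norm (v - y))\<^sup>2" if "y \<in> W" for y
    using d_le[OF that] by linarith
  have "cinner u (v - x) = 0" if u: "u \<in> W" for u
  proof -
    define b where "b = cinner u (v - x)"
    \<comment> \<open>Small enough that moving from \<open>x\<close> by \<open>t b u\<close> would decrease the distance if \<open>b \<noteq> 0\<close>.\<close>
    define t where "t = 1 / ((norm u)\<^sup>2 + 1)"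
    have t: "t > 0" "t * (norm u)\<^sup>2 < 1" by (auto simp: t_def add_nonneg_pos)
    have "x + (of_real t * b) *\<^sub>C u \<in> W"
      using xW u W(2) by (intro complex_vector.subspace_add complex_vector.subspace_scale)
    from min[OF this] have "(norm (v - x))\<^sup>2 \<le> (norm ((v - x) - (of_real t * b) *\<^sub>C u))\<^sup>2"
      by (simp add: diff_diff_add)
    also have "\<dots> = (norm (v - x))\<^sup>2 - 2 * Re (cinner (v - x) ((of_real t * b) *\<^sub>C u))
        + (cmod (of_real t * b) * norm u)\<^sup>2"
      by (simp add: norm_diff_sq norm_scaleC)
    also have "cinner (v - x) ((of_real t * b) *\<^sub>C u) = of_real (t * (cmod b)\<^sup>2)"
      using cinner_commute[of "v - x" u] unfolding of_real_mult complex_norm_square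
      by (simp add: cinner_scaleC_right b_def[symmetric])
    also have "(cmod (of_real t * b) * norm u)\<^sup>2 = t * (cmod b)\<^sup>2 * (t * (norm u)\<^sup>2)"
      using t by (simp add: norm_mult power_mult_distrib power2_eq_square)
    finally have "2 * (t * (cmod b)\<^sup>2) \<le> (t * (cmod b)\<^sup>2) * (t * (norm u)\<^sup>2)" by simp
    moreover have "(t * (cmod b)\<^sup>2) * (t * (norm u)\<^sup>2) \<le> (t * (cmod b)\<^sup>2) * 1"
      using t by (intro mult_left_mono) auto
    ultimately have "t * (cmod b)\<^sup>2 \<le> 0" by linarith
    then show ?thesis using t b_def by (simp add: mult_le_0_iff)
  qed
  then show ?thesis using xW by blast
qed

lemma riesz_representation:
  fixes \<phi> :: "'h::chilbert_space \<Rightarrow> complex"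
  assumes "bounded_linear \<phi>" and homog: "\<And>c x. \<phi> (c *\<^sub>C x) = c * \<phi> x"
  shows "\<exists>u. \<forall>y. \<phi> y = cinner u y"
proof (cases "\<forall>y. \<phi> y = 0")
  case True
  then show ?thesis by (intro exI[of _ 0]) (simp add: cinner.zero_left)
next
  case False
  interpret bounded_linear \<phi> by fact
  let ?W = "{x. \<phi> x = 0}"
  obtain v where v: "\<phi> v \<noteq> 0" using False by blast
  have "closed ?W" by (intro closed_Collect_eq continuous_on continuous_on_const continuous_on_id)
  moreover have "complex_vector.subspace ?W"
    by (rule complex_vector.subspaceI) (auto simp: zero add homog)
  ultimately obtain w where w: "\<phi> w = 0" "\<And>u. \<phi> u = 0 \<Longrightarrow> cinner u (v - w) = 0"
    using projection_exists[of ?W v] by auto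
  define e where "e = v - w"
  have e: "\<phi> e \<noteq> 0" using v w(1) by (simp add: e_def diff)
  then have e0: "e \<noteq> 0" using zero by auto
  have "\<phi> y = cinner ((cnj (\<phi> e) / of_real ((norm e)\<^sup>2)) *\<^sub>C e) y" for y
  proof -
    have "\<phi> (y - (\<phi> y / \<phi> e) *\<^sub>C e) = 0" using e by (simp add: diff homog)
    then have "cinner e (y - (\<phi> y / \<phi> e) *\<^sub>C e) = 0"
      using w(2) cinner_eq_0_commute unfolding e_def by blast
    then have "cinner e y = (\<phi> y / \<phi> e) * of_real ((norm e)\<^sup>2)"
      by (simp add: cinner.diff_right cinner_scaleC_right cinner_self)
    then show ?thesis using e e0 by (simp add: cinner_scaleC_left)
  qed
  then show ?thesis by blast
qed

subsection \<open>Adjoints\<close>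

locale bounded_operator =
  fixes T :: "'h::chilbert_space \<Rightarrow> 'h"
  assumes blin: "bounded_linear T" and scaleC: "\<And>c x. T (c *\<^sub>C x) = c *\<^sub>C T x"
begin

sublocale bounded_linear T by (rule blin)

lemma cinner_cadjoint: "cinner (cadjoint T x) y = cinner x (T y)"
proof -
  have "\<exists>u. \<forall>y. cinner x (T y) = cinner u y" for x
    by (rule riesz_representation)
       (auto intro: bounded_linear_compose[OF cinner.bounded_linear_right blin]
         simp: scaleC cinner_scaleC_right)
  then have "\<exists>S. \<forall>x y. cinner (S x) y = cinner x (T y)" by metis
  from someI_ex[OF this] show ?thesis unfolding cadjoint_def by blast
qed

lemma cinner_cadjoint_right: "cinner y (cadjoint T x) = cinner (T y) x"
  by (metis cinner_cadjoint cinner_commute)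

lemma cadjoint_unique: "(\<And>x y. cinner (S x) y = cinner x (T y)) \<Longrightarrow> cadjoint T = S"
  by (rule ext, rule cinner_eqI_left) (simp add: cinner_cadjoint)

lemma bounded_operator_cadjoint: "bounded_operator (cadjoint T)"
proof
  show "cadjoint T (x + y) = cadjoint T x + cadjoint T y" for x y
    by (rule cinner_eqI_left) (simp add: cinner_cadjoint cinner_add_left)
  show sc: "cadjoint T (c *\<^sub>C x) = c *\<^sub>C cadjoint T x" for c x
    by (rule cinner_eqI_left) (simp add: cinner_cadjoint cinner_scaleC_left)
  show "cadjoint T (r *\<^sub>R x) = r *\<^sub>R cadjoint T x" for r x
    by (simp add: scaleR_scaleC sc)
  obtain K where K: "\<And>x. norm (T x) \<le> norm x * K" "K > 0" using pos_bounded by blast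
  have "norm (cadjoint T x) \<le> norm x * K" for x
  proof (cases "cadjoint T x = 0")
    case False
    let ?y = "cadjoint T x"
    have "norm ?y * norm ?y = Re (cinner ?y ?y)" by (simp add: Re_cinner_self power2_eq_square)
    also have "\<dots> \<le> cmod (cinner x (T ?y))" unfolding cinner_cadjoint by (rule complex_Re_le_cmod)
    also have "\<dots> \<le> norm x * norm (T ?y)" by (rule cauchy_schwarz)
    also have "\<dots> \<le> norm x * (norm ?y * K)" by (intro mult_left_mono K) auto
    finally have "norm ?y * norm ?y \<le> norm ?y * (norm x * K)" by (simp add: mult_ac)
    then show ?thesis using False by simp
  qed (use K in auto)
  then show "\<exists>K. \<forall>x. norm (cadjoint T x) \<le> norm x * K" by blast
qed

end

subsection \<open>Orthonormal families\<close>

definition orthonormal :: "'h::chilbert_space set \<Rightarrow> bool" where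
  "orthonormal E \<longleftrightarrow> (\<forall>e\<in>E. norm e = 1) \<and> (\<forall>e\<in>E. \<forall>f\<in>E. e \<noteq> f \<longrightarrow> cinner e f = 0)"

lemma orthonormal_subset: "orthonormal E \<Longrightarrow> F \<subseteq> E \<Longrightarrow> orthonormal F"
  unfolding orthonormal_def by (meson subsetD)

lemma orthonormal_cinner:
  "\<lbrakk>orthonormal E; e \<in> E; f \<in> E\<rbrakk> \<Longrightarrow> cinner e f = (if e = f then 1 else 0)"
  unfolding orthonormal_def by (auto simp: cinner_self)

lemma cinner_orthonormal_sum:
  assumes "orthonormal F" "finite F" "e \<in> F"
  shows "cinner e (\<Sum>f\<in>F. c f *\<^sub>C f) = c e"
proof -
  have "cinner e (\<Sum>f\<in>F. c f *\<^sub>C f) = (\<Sum>f\<in>F. if f = e then c f else 0)"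
    unfolding cinner.sum_right cinner_scaleC_right
    by (intro sum.cong) (auto simp: orthonormal_cinner[OF assms(1,3)])
  then show ?thesis using assms by (simp add: sum.delta)
qed

lemma norm_orthonormal_sum:
  assumes "orthonormal F" "finite F"
  shows "(norm (\<Sum>f\<in>F. c f *\<^sub>C f))\<^sup>2 = (\<Sum>f\<in>F. (cmod (c f))\<^sup>2)"
proof -
  have "(norm (\<Sum>f\<in>F. c f *\<^sub>C f))\<^sup>2 = Re (\<Sum>e\<in>F. cnj (c e) * cinner e (\<Sum>f\<in>F. c f *\<^sub>C f))"
    by (simp add: Re_cinner_self[symmetric] cinner.sum_left cinner_scaleC_left)
  also have "(\<Sum>e\<in>F. cnj (c e) * cinner e (\<Sum>f\<in>F. c f *\<^sub>C f)) = (\<Sum>e\<in>F. of_real ((cmod (c e))\<^sup>2))"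
    unfolding complex_norm_square
    by (intro sum.cong) (auto simp: cinner_orthonormal_sum[OF assms] mult.commute)
  finally show ?thesis by simp
qed

lemma norm_residual:
  assumes "orthonormal F" "finite F"
  shows "(norm (v - (\<Sum>f\<in>F. c f *\<^sub>C f)))\<^sup>2
     = (norm v)\<^sup>2 - (\<Sum>f\<in>F. (cmod (cinner f v))\<^sup>2) + (\<Sum>f\<in>F. (cmod (c f - cinner f v))\<^sup>2)"
proof -
  have "Re (cinner v (\<Sum>f\<in>F. c f *\<^sub>C f)) = (\<Sum>f\<in>F. Re (c f * cnj (cinner f v)))"
    using cinner_commute[of v] by (simp add: cinner.sum_right cinner_scaleC_right)
  moreover have "(cmod (c f - cinner f v))\<^sup>2
      = (cmod (c f))\<^sup>2 - 2 * Re (c f * cnj (cinner f v)) + (cmod (cinner f v))\<^sup>2" for f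
    unfolding cmod_power2 by (simp add: algebra_simps power2_eq_square)
  ultimately show ?thesis
    by (simp add: norm_diff_sq[of v "\<Sum>f\<in>F. c f *\<^sub>C f"] norm_orthonormal_sum[OF assms] sum.distrib sum_subtractf sum_distrib_left)
qed

lemma bessel:
  assumes "orthonormal F" "finite F"
  shows "(\<Sum>f\<in>F. (cmod (cinner f v))\<^sup>2) \<le> (norm v)\<^sup>2"
  using norm_residual[OF assms, of v "\<lambda>f. cinner f v"] zero_le_power2[of "norm (v - (\<Sum>f\<in>F. cinner f v *\<^sub>C f))"]
  by simp

lemma closure_subspace:
  fixes S :: "'h::chilbert_space set"
  assumes "complex_vector.subspace S"
  shows "complex_vector.subspace (closure S)"
proof (rule complex_vector.subspaceI)
  show "0 \<in> closure S" using complex_vector.subspace_0[OF assms] closure_subset by blast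
next
  fix x y assume "x \<in> closure S" "y \<in> closure S"
  then obtain u v where "\<And>n. u n \<in> S" "u \<longlonglongrightarrow> x" "\<And>n. v n \<in> S" "v \<longlonglongrightarrow> y"
    unfolding closure_sequential by metis
  then show "x + y \<in> closure S"
    unfolding closure_sequential
    by (intro exI[of _ "\<lambda>n. u n + v n"]) (auto intro: tendsto_add complex_vector.subspace_add[OF assms])
next
  fix c x assume "x \<in> closure S"
  then obtain u where "\<And>n. u n \<in> S" "u \<longlonglongrightarrow> x"
    unfolding closure_sequential by metis
  then show "c *\<^sub>C x \<in> closure S"
    unfolding closure_sequential
    by (intro exI[of _ "\<lambda>n. c *\<^sub>C u n"])
       (auto intro: bounded_linear.tendsto[OF bounded_linear_scaleC] complex_vector.subspace_scale[OF assms])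
qed

text \<open>
  Here \<open>w\<close> is the projection of \<open>v\<close> to the closed span of \<open>E\<close>. The Fourier sums of \<open>v\<close> over finite subsets of
  \<open>E\<close> approximate \<open>w\<close>, and enlarging the subset does not spoil the approximation. In this form only finite sums
  occur, whatever the cardinality of \<open>E\<close>.
\<close>

lemma orthonormal_approx:
  assumes E: "orthonormal E"
  shows "\<exists>w. (\<forall>e\<in>E. cinner e (v - w) = 0) \<and> (\<forall>u. (\<forall>e\<in>E. cinner e u = 0) \<longrightarrow> cinner u w = 0) \<and>
    (\<forall>\<epsilon>>0. \<exists>F\<subseteq>E. finite F \<and> (\<forall>G. finite G \<longrightarrow> F \<subseteq> G \<longrightarrow> G \<subseteq> E \<longrightarrow>
        (norm (w - (\<Sum>e\<in>G. cinner e v *\<^sub>C e)))\<^sup>2 < \<epsilon>))"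
proof -
  let ?W = "closure (complex_vector.span E)"
  have "complex_vector.subspace ?W" by (intro closure_subspace complex_vector.subspace_span)
  then obtain w where w: "w \<in> ?W" "\<And>u. u \<in> ?W \<Longrightarrow> cinner u (v - w) = 0"
    using projection_exists[of ?W v] by auto
  have orth: "cinner e (v - w) = 0" if "e \<in> E" for e
    using w(2) closure_subset complex_vector.span_superset that by blast
  have "cinner u w = 0" if u: "\<And>e. e \<in> E \<Longrightarrow> cinner e u = 0" for u
  proof -
    have "complex_vector.span E \<subseteq> {x. cinner u x = 0}"
    proof (rule complex_vector.span_minimal)
      show "E \<subseteq> {x. cinner u x = 0}" using u cinner_eq_0_commute by blast
      show "complex_vector.subspace {x. cinner u x = 0}"
        by (rule complex_vector.subspaceI) (auto simp: cinner.zero_right cinner_add_right cinner_scaleC_right)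
    qed
    moreover have "closed {x. cinner u x = 0}"
      by (intro closed_Collect_eq cinner.continuous_on continuous_on_const continuous_on_id)
    ultimately have "?W \<subseteq> {x. cinner u x = 0}" by (rule closure_minimal)
    then show ?thesis using w(1) by blast
  qed
  moreover have "\<exists>F\<subseteq>E. finite F \<and> (\<forall>G. finite G \<longrightarrow> F \<subseteq> G \<longrightarrow> G \<subseteq> E \<longrightarrow>
        (norm (w - (\<Sum>e\<in>G. cinner e v *\<^sub>C e)))\<^sup>2 < \<epsilon>)" if "\<epsilon> > 0" for \<epsilon>
  proof -
    obtain x where x: "x \<in> complex_vector.span E" "dist x w < sqrt \<epsilon>"
      using w(1) \<open>\<epsilon> > 0\<close> unfolding closure_approachable by (meson real_sqrt_gt_zero)
    then obtain F c where F: "finite F" "F \<subseteq> E" "x = (\<Sum>e\<in>F. c e *\<^sub>C e)"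
      unfolding complex_vector.span_explicit by blast
    have "(norm (w - (\<Sum>e\<in>G. cinner e v *\<^sub>C e)))\<^sup>2 < \<epsilon>" if G: "finite G" "F \<subseteq> G" "G \<subseteq> E" for G
    proof -
      define c' where "c' e = (if e \<in> F then c e else 0)" for e
      have x': "x = (\<Sum>e\<in>G. c' e *\<^sub>C e)"
        unfolding F(3) using G by (intro sum.mono_neutral_cong_left) (auto simp: c'_def)
      have on: "orthonormal G" using orthonormal_subset[OF E G(3)] .
      have coef: "cinner e v = cinner e w" if "e \<in> G" for e
        using orth[of e] that G by (auto simp: cinner.diff_right)
      have "(\<Sum>e\<in>G. cinner e v *\<^sub>C e) = (\<Sum>e\<in>G. cinner e w *\<^sub>C e)" by (simp add: coef)
      then have "(norm (w - (\<Sum>e\<in>G. cinner e v *\<^sub>C e)))\<^sup>2 \<le> (norm (w - x))\<^sup>2"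
        unfolding x' by (simp add: norm_residual[OF on G(1)] sum_nonneg)
      also have "norm (w - x) < sqrt \<epsilon>" using x(2) by (simp add: dist_norm norm_minus_commute)
      then have "(norm (w - x))\<^sup>2 < \<epsilon>"
        using \<open>\<epsilon> > 0\<close> by (metis norm_ge_zero power_strict_mono real_sqrt_pow2 less_imp_le pos2)
      finally show ?thesis .
    qed
    then show ?thesis using F by blast
  qed
  ultimately show ?thesis using orth by (intro exI[of _ w]) blast
qed

lemma orthonormal_independent:
  assumes "orthonormal E" shows "complex_vector.independent E"
  unfolding complex_vector.independent_explicit_finite_subsets
proof (intro allI impI ballI)
  fix S u v assume S: "S \<subseteq> E" "finite S" "(\<Sum>v\<in>S. u v *\<^sub>C v) = 0" "v \<in> S"
  show "u v = 0"
    using cinner_orthonormal_sum[OF orthonormal_subset[OF assms S(1)] S(2,4), of u] S(3)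
    by (simp add: cinner.zero_right)
qed

section \<open>Positive compact operators\<close>

locale positive_operator = bounded_operator Z for Z :: "'h::chilbert_space \<Rightarrow> 'h" +
  assumes herm: "\<And>x y. cinner (Z x) y = cinner x (Z y)"
    and pos: "\<And>x. 0 \<le> Re (cinner x (Z x))"
begin

definition form :: "'h \<Rightarrow> real" where "form x = Re (cinner x (Z x))"

lemma form_nonneg: "0 \<le> form x"
  by (simp add: form_def pos)

lemma form_cauchy_schwarz: "(cmod (cinner x (Z y)))\<^sup>2 \<le> form x * form y"
  unfolding form_def
proof (rule semidefinite_cauchy_schwarz)
  show "cinner y (Z x) = cnj (cinner x (Z y))" for x y
    using herm[of x y] cinner_commute[of y "Z x"] by simp
qed (simp_all add: add scaleC cinner_add_right cinner_scaleC_right pos)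

lemma form_eq_0_imp: "form x = 0 \<Longrightarrow> Z x = 0"
  using form_cauchy_schwarz[of "Z x" x] by (simp add: cinner_self)

lemma form_add:
  "form (x + y) = form x + 2 * Re (cinner x (Z y)) + form y"
  using arg_cong[OF cinner_commute[of "Z x" y], of Re] herm[of x y]
  by (simp add: form_def add cinner_add_left cinner_add_right)

definition eigen_family :: "'h set \<Rightarrow> bool" where
  "eigen_family E \<longleftrightarrow> orthonormal E \<and> (\<forall>e\<in>E. 0 < form e \<and> Z e = of_real (form e) *\<^sub>C e)"

lemma eigen_familyD:
  assumes "eigen_family E"
  shows "orthonormal E" "e \<in> E \<Longrightarrow> 0 < form e" "e \<in> E \<Longrightarrow> Z e = of_real (form e) *\<^sub>C e"
    "e \<in> E \<Longrightarrow> norm e = 1"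
  using assms by (auto simp: eigen_family_def orthonormal_def)

lemma eigen_family_subset: "eigen_family E \<Longrightarrow> F \<subseteq> E \<Longrightarrow> eigen_family F"
  unfolding eigen_family_def using orthonormal_subset by (meson subsetD)

lemma cinner_eigen:
  assumes "eigen_family E" "e \<in> E"
  shows "cinner e (Z v) = of_real (form e) * cinner e v"
  using eigen_familyD(3)[OF assms] herm[of e v] by (simp add: cinner_scaleC_left)

lemma eigen_family_perp:
  assumes "eigen_family E" "e \<in> E" "form u = 0"
  shows "cinner u e = 0"
proof -
  have "cinner e (Z u) = 0" using form_eq_0_imp[OF assms(3)] by (simp add: cinner.zero_right)
  then have "cinner e u = 0" using cinner_eigen[OF assms(1,2), of u] eigen_familyD(2)[OF assms(1,2)] by simp
  then show ?thesis using cinner_eq_0_commute by blast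
qed

lemma form_eigen_sum:
  assumes "eigen_family F" "finite F"
  shows "form (\<Sum>e\<in>F. c e *\<^sub>C e) = (\<Sum>e\<in>F. form e * (cmod (c e))\<^sup>2)"
proof -
  have "form (\<Sum>e\<in>F. c e *\<^sub>C e) = Re (\<Sum>e\<in>F. cnj (c e) * cinner e (Z (\<Sum>f\<in>F. c f *\<^sub>C f)))"
    by (simp add: form_def cinner.sum_left cinner_scaleC_left)
  also have "(\<Sum>e\<in>F. cnj (c e) * cinner e (Z (\<Sum>f\<in>F. c f *\<^sub>C f)))
      = (\<Sum>e\<in>F. of_real (form e) * of_real ((cmod (c e))\<^sup>2))"
    unfolding complex_norm_square
    by (intro sum.cong)
       (auto simp: cinner_eigen[OF assms(1)] cinner_orthonormal_sum[OF eigen_familyD(1)[OF assms(1)] assms(2)])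
  finally show ?thesis by simp
qed

text \<open>
  The Fourier sum and the residual are orthogonal for the form of \<open>Z\<close> as well, since \<open>Z\<close> maps the span of
  \<open>F\<close> into itself.
\<close>

lemma form_split:
  assumes "eigen_family F" "finite F"
  shows "form v = (\<Sum>e\<in>F. form e * (cmod (cinner e v))\<^sup>2) + form (v - (\<Sum>e\<in>F. cinner e v *\<^sub>C e))"
proof -
  let ?s = "\<Sum>e\<in>F. cinner e v *\<^sub>C e"
  have "cinner ?s (Z (v - ?s)) = (\<Sum>e\<in>F. cnj (cinner e v) * cinner e (Z (v - ?s)))"
    by (simp add: cinner.sum_left cinner_scaleC_left)
  also have "\<dots> = 0"
    by (intro sum.neutral ballI)
       (simp add: cinner_eigen[OF assms(1)] cinner.diff_right
         cinner_orthonormal_sum[OF eigen_familyD(1)[OF assms(1)] assms(2)])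
  finally have "Re (cinner ?s (Z (v - ?s))) = 0" by simp
  then show ?thesis using form_add[of ?s "v - ?s"] form_eigen_sum[OF assms] by simp
qed

lemma form_bessel:
  assumes "eigen_family F" "finite F"
  shows "(\<Sum>e\<in>F. form e * (cmod (cinner e v))\<^sup>2) \<le> form v"
  using form_split[OF assms, of v] form_nonneg by simp

text \<open>
  Eigenvectors for the eigenvalue \<open>0\<close> are left out: the singular values of the definition are positive, and the
  kernel need not have finite or even countable dimension.
\<close>

definition spectral_basis :: "'h set \<Rightarrow> bool" where
  "spectral_basis E \<longleftrightarrow> eigen_family E \<and> (\<forall>v. (\<forall>e\<in>E. cinner e v = 0) \<longrightarrow> Z v = 0)"

lemma form_approx:
  assumes E: "spectral_basis E" and "\<epsilon> > 0"
  shows "\<exists>F\<subseteq>E. finite F \<and> (\<forall>G. finite G \<longrightarrow> F \<subseteq> G \<longrightarrow> G \<subseteq> E \<longrightarrow>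
           form v < (\<Sum>e\<in>G. form e * (cmod (cinner e v))\<^sup>2) + \<epsilon>)"
proof -
  have ef: "eigen_family E" using E by (simp add: spectral_basis_def)
  obtain K where K: "\<And>x. norm (Z x) \<le> norm x * K" "K > 0" using pos_bounded by blast
  obtain w where w: "\<forall>e\<in>E. cinner e (v - w) = 0"
    "\<forall>u. (\<forall>e\<in>E. cinner e u = 0) \<longrightarrow> cinner u w = 0"
    "\<forall>\<epsilon>>0. \<exists>F\<subseteq>E. finite F \<and> (\<forall>G. finite G \<longrightarrow> F \<subseteq> G \<longrightarrow> G \<subseteq> E \<longrightarrow>
        (norm (w - (\<Sum>e\<in>G. cinner e v *\<^sub>C e)))\<^sup>2 < \<epsilon>)"
    using orthonormal_approx[OF eigen_familyD(1)[OF ef], of v] by (elim exE conjE) (rule that)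
  obtain F where F: "F \<subseteq> E" "finite F" "\<And>G. \<lbrakk>finite G; F \<subseteq> G; G \<subseteq> E\<rbrakk> \<Longrightarrow>
        (norm (w - (\<Sum>e\<in>G. cinner e v *\<^sub>C e)))\<^sup>2 < \<epsilon> / K"
    using w(3)[rule_format, OF divide_pos_pos[OF \<open>\<epsilon> > 0\<close> K(2)]] by blast
  have "Z (v - w) = 0" using E w(1) unfolding spectral_basis_def by blast
  then have Zv: "Z v = Z w" by (simp add: diff)
  have "form v < (\<Sum>e\<in>G. form e * (cmod (cinner e v))\<^sup>2) + \<epsilon>"
    if G: "finite G" "F \<subseteq> G" "G \<subseteq> E" for G
  proof -
    let ?s = "\<Sum>e\<in>G. cinner e v *\<^sub>C e"
    have "Z (v - ?s) = Z (w - ?s)" using Zv by (simp add: diff)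
    then have "form (v - ?s) = Re (cinner (w - ?s) (Z (w - ?s)))"
      unfolding form_def by (simp only: herm[symmetric])
    also have "\<dots> \<le> norm (w - ?s) * norm (Z (w - ?s))"
      by (rule order.trans[OF complex_Re_le_cmod cauchy_schwarz])
    also have "\<dots> \<le> norm (w - ?s) * (norm (w - ?s) * K)" by (intro mult_left_mono K) auto
    also have "\<dots> = (norm (w - ?s))\<^sup>2 * K" by (simp add: power2_eq_square)
    also have "\<dots> < \<epsilon> / K * K" using F(3)[OF G] K(2) by (intro mult_strict_right_mono)
    also have "\<dots> = \<epsilon>" using K(2) by simp
    finally show ?thesis
      using form_split[OF eigen_family_subset[OF ef G(3)] G(1), of v] by simp
  qed
  then show ?thesis using F by blast
qed

text \<open>
  Parseval's identity for vectors orthogonal to the kernel of \<open>Z\<close>, up to \<open>\<epsilon>\<close>.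
\<close>

lemma norm_approx:
  assumes E: "spectral_basis E" and v: "\<And>u. Z u = 0 \<Longrightarrow> cinner u v = 0" and "\<epsilon> > 0"
  shows "\<exists>F\<subseteq>E. finite F \<and> (\<forall>G. finite G \<longrightarrow> F \<subseteq> G \<longrightarrow> G \<subseteq> E \<longrightarrow>
           (norm v)\<^sup>2 - \<epsilon> < (\<Sum>e\<in>G. (cmod (cinner e v))\<^sup>2))"
proof -
  have ef: "eigen_family E" using E by (simp add: spectral_basis_def)
  obtain w where w: "\<forall>e\<in>E. cinner e (v - w) = 0"
    "\<forall>u. (\<forall>e\<in>E. cinner e u = 0) \<longrightarrow> cinner u w = 0"
    "\<forall>\<epsilon>>0. \<exists>F\<subseteq>E. finite F \<and> (\<forall>G. finite G \<longrightarrow> F \<subseteq> G \<longrightarrow> G \<subseteq> E \<longrightarrow>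
        (norm (w - (\<Sum>e\<in>G. cinner e v *\<^sub>C e)))\<^sup>2 < \<epsilon>)"
    using orthonormal_approx[OF eigen_familyD(1)[OF ef], of v] by (elim exE conjE) (rule that)
  have "Z (v - w) = 0" using E w(1) unfolding spectral_basis_def by blast
  then have "cinner (v - w) v = 0" by (rule v)
  moreover have "cinner (v - w) w = 0" using w(1,2) by blast
  ultimately have "cinner (v - w) (v - w) = 0" by (simp add: cinner.diff_right)
  then have vw: "w = v" by (simp add: cinner_self)
  obtain F where F: "F \<subseteq> E" "finite F" "\<And>G. \<lbrakk>finite G; F \<subseteq> G; G \<subseteq> E\<rbrakk> \<Longrightarrow>
        (norm (w - (\<Sum>e\<in>G. cinner e v *\<^sub>C e)))\<^sup>2 < \<epsilon>"
    using w(3)[rule_format, OF \<open>\<epsilon> > 0\<close>] by blast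
  have "(norm v)\<^sup>2 - \<epsilon> < (\<Sum>e\<in>G. (cmod (cinner e v))\<^sup>2)" if G: "finite G" "F \<subseteq> G" "G \<subseteq> E" for G
    using F(3)[OF G] norm_residual[OF orthonormal_subset[OF eigen_familyD(1)[OF ef] G(3)] G(1), of v "\<lambda>e. cinner e v"]
    by (simp add: vw)
  then show ?thesis using F by blast
qed

end

locale positive_compact = positive_operator +
  assumes compact: "\<And>v :: nat \<Rightarrow> _. (\<And>n. norm (v n) \<le> 1) \<Longrightarrow> \<exists>r l. strict_mono r \<and> (\<lambda>n. Z (v (r n))) \<longlonglongrightarrow> l"
begin

text \<open>
  The supremum \<open>\<mu>\<close> of the form on the unit sphere of \<open>U\<close> is attained. For a maximising sequence the
  Cauchy--Schwarz inequality of the form gives \<open>\<parallel>Z v\<parallel>\<^sup>2 \<le> \<mu> \<langle>v, Z v\<rangle>\<close>, so \<open>\<parallel>Z v - \<mu> v\<parallel>\<^sup>2 \<le> \<mu> (\<mu> - \<langle>v, Z v\<rangle>)\<close>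
  tends to \<open>0\<close>. As \<open>Z v\<close> has a convergent subsequence, so has \<open>\<mu> v\<close>, and the limit is an eigenvector.
\<close>

lemma eigenvector_in_invariant_subspace:
  assumes U: "closed U" "complex_vector.subspace U" "\<And>u. u \<in> U \<Longrightarrow> Z u \<in> U"
    and u0: "u0 \<in> U" "Z u0 \<noteq> 0"
  shows "\<exists>e\<in>U. norm e = 1 \<and> 0 < form e \<and> Z e = of_real (form e) *\<^sub>C e"
proof -
  define B where "B = {u \<in> U. norm u = 1}"
  define \<mu> where "\<mu> = (SUP u\<in>B. form u)"
  obtain K where K: "\<And>x. norm (Z x) \<le> norm x * K" "K > 0" using pos_bounded by blast
  have bdd: "bdd_above (form ` B)"
  proof (rule bdd_aboveI2)
    fix u assume "u \<in> B"
    then have "norm u = 1" by (simp add: B_def)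
    have "form u \<le> norm u * norm (Z u)"
      unfolding form_def by (rule order.trans[OF complex_Re_le_cmod cauchy_schwarz])
    also have "\<dots> \<le> K" using K(1)[of u] \<open>norm u = 1\<close> by simp
    finally show "form u \<le> K" .
  qed
  have form_scale: "form (of_real r *\<^sub>C u) = r\<^sup>2 * form u" for r u
    by (simp add: form_def scaleC cinner_scaleC_left cinner_scaleC_right power2_eq_square)
  have form_le: "form u \<le> \<mu> * (norm u)\<^sup>2" if "u \<in> U" for u
  proof (cases "u = 0")
    case True
    then show ?thesis by (simp add: form_def zero cinner.zero_right)
  next
    case False
    let ?u = "of_real (1 / norm u) *\<^sub>C u"
    have "?u \<in> B" using that False complex_vector.subspace_scale[OF U(2)]
      by (simp add: B_def norm_scaleC norm_divide)
    then have "form ?u \<le> \<mu>" unfolding \<mu>_def by (rule cSUP_upper[OF _ bdd])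
    then show ?thesis using False unfolding form_scale by (simp add: power_divide field_simps)
  qed
  have "u0 \<noteq> 0" using u0(2) zero by auto
  have "form u0 \<noteq> 0" using form_eq_0_imp u0(2) by blast
  then have "0 < \<mu> * (norm u0)\<^sup>2" using form_nonneg[of u0] form_le[OF u0(1)] by linarith
  then have \<mu>: "\<mu> > 0" using \<open>u0 \<noteq> 0\<close> by (simp add: zero_less_mult_iff)
  have "of_real (1 / norm u0) *\<^sub>C u0 \<in> B"
    using u0(1) \<open>u0 \<noteq> 0\<close> complex_vector.subspace_scale[OF U(2)] by (simp add: B_def norm_scaleC norm_divide)
  then have ne: "B \<noteq> {}" by blast
  have "\<exists>u\<in>B. \<mu> - 1 / real (Suc n) < form u" for n
    using less_cSUP_iff[OF ne bdd, of "\<mu> - 1 / real (Suc n)"] by (simp add: \<mu>_def)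
  then obtain v where v: "\<And>n. v n \<in> B" "\<And>n. \<mu> - 1 / real (Suc n) < form (v n)" by metis
  have vU: "v n \<in> U" "norm (v n) = 1" for n using v(1)[of n] by (auto simp: B_def)
  have vle: "form (v n) \<le> \<mu>" for n using form_le[OF vU(1), of n] by (simp add: vU)
  have Zv: "(norm (Z (v n)))\<^sup>2 \<le> \<mu> * form (v n)" for n
  proof (cases "Z (v n) = 0")
    case True
    then show ?thesis using \<mu> form_nonneg by simp
  next
    case False
    have "(cmod (cinner (Z (v n)) (Z (v n))))\<^sup>2 \<le> form (Z (v n)) * form (v n)" by (rule form_cauchy_schwarz)
    also have "\<dots> \<le> \<mu> * (norm (Z (v n)))\<^sup>2 * form (v n)"
      by (intro mult_right_mono form_le U vU form_nonneg)
    finally have "(norm (Z (v n)))\<^sup>2 * (norm (Z (v n)))\<^sup>2 \<le> (norm (Z (v n)))\<^sup>2 * (\<mu> * form (v n))"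
      unfolding cinner_self norm_of_real by (simp add: power2_eq_square[of "_\<^sup>2"] mult_ac)
    then show ?thesis using False by (simp only: mult_le_cancel_left) simp
  qed
  have res: "(norm (Z (v n) - of_real \<mu> *\<^sub>C v n))\<^sup>2 \<le> \<mu> * (1 / real (Suc n))" for n
  proof -
    have "Re (cinner (Z (v n)) (of_real \<mu> *\<^sub>C v n)) = \<mu> * form (v n)"
      by (simp add: cinner_scaleC_right form_def herm)
    then have "(norm (Z (v n) - of_real \<mu> *\<^sub>C v n))\<^sup>2
        = (norm (Z (v n)))\<^sup>2 - 2 * (\<mu> * form (v n)) + \<mu>\<^sup>2"
      using \<mu> by (simp add: norm_diff_sq norm_scaleC vU)
    also have "\<dots> \<le> \<mu> * (\<mu> - form (v n))"
      using Zv[of n] by (simp add: algebra_simps power2_eq_square)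
    also have "\<dots> \<le> \<mu> * (1 / real (Suc n))" using v(2)[of n] \<mu> by (intro mult_left_mono) auto
    finally show ?thesis .
  qed
  obtain r y where r: "strict_mono r" "(\<lambda>n. Z (v (r n))) \<longlonglongrightarrow> y"
    using compact[of v] vU by auto
  have "(\<lambda>n. \<mu> * (1 / real (Suc n))) \<longlonglongrightarrow> 0"
    using tendsto_mult_right_zero[OF LIMSEQ_inverse_real_of_nat, of \<mu>] by (simp add: divide_inverse)
  then have "(\<lambda>n. (norm (Z (v n) - of_real \<mu> *\<^sub>C v n))\<^sup>2) \<longlonglongrightarrow> 0"
    by (rule Lim_null_comparison[rotated]) (use res in auto)
  then have "(\<lambda>n. sqrt ((norm (Z (v n) - of_real \<mu> *\<^sub>C v n))\<^sup>2)) \<longlonglongrightarrow> sqrt 0"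
    by (rule tendsto_real_sqrt)
  then have "(\<lambda>n. Z (v n) - of_real \<mu> *\<^sub>C v n) \<longlonglongrightarrow> 0"
    by (simp add: tendsto_norm_zero_iff)
  then have "(\<lambda>n. Z (v (r n)) - of_real \<mu> *\<^sub>C v (r n)) \<longlonglongrightarrow> 0"
    using LIMSEQ_subseq_LIMSEQ[OF _ r(1)] by (fastforce simp: o_def)
  from tendsto_diff[OF r(2) this] have muv: "(\<lambda>n. of_real \<mu> *\<^sub>C v (r n)) \<longlonglongrightarrow> y" by simp
  have "y \<in> U"
    using closed_sequentially[OF U(1) _ muv] complex_vector.subspace_scale[OF U(2) vU(1)] by blast
  have "(\<lambda>n. norm (of_real \<mu> *\<^sub>C v (r n))) \<longlonglongrightarrow> norm y" by (intro tendsto_norm muv)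
  then have ny: "norm y = \<mu>"
    using \<mu> by (simp add: norm_scaleC vU LIMSEQ_const_iff)
  have "(\<lambda>n. Z (of_real \<mu> *\<^sub>C v (r n))) \<longlonglongrightarrow> Z y" by (intro tendsto muv)
  moreover have "(\<lambda>n. of_real \<mu> *\<^sub>C Z (v (r n))) \<longlonglongrightarrow> of_real \<mu> *\<^sub>C y"
    by (intro bounded_linear.tendsto[OF bounded_linear_scaleC] r)
  ultimately have Zy: "Z y = of_real \<mu> *\<^sub>C y" by (simp add: scaleC LIMSEQ_unique)
  define e where "e = of_real (1 / \<mu>) *\<^sub>C y"
  have e: "e \<in> U" "norm e = 1"
    using \<open>y \<in> U\<close> complex_vector.subspace_scale[OF U(2)] ny \<mu> by (auto simp: e_def norm_scaleC norm_divide)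
  have Ze: "Z e = of_real \<mu> *\<^sub>C e" by (simp add: e_def scaleC Zy scaleC_scaleC mult.commute)
  have "form e = \<mu>" using e(2) by (simp add: form_def Ze cinner_scaleC_right cinner_self)
  then show ?thesis using e Ze \<mu> by auto
qed

text \<open>
  A maximal orthonormal family of eigenvectors with positive eigenvalues, from Zorn's lemma. On its orthogonal
  complement, which is invariant, \<open>Z\<close> vanishes, for otherwise the complement would contain one more eigenvector.
\<close>

theorem spectral_basis_exists: "\<exists>E. spectral_basis E"
proof -
  have "\<exists>M\<in>Collect eigen_family. \<forall>E\<in>Collect eigen_family. M \<subseteq> E \<longrightarrow> E = M"
  proof (rule subset_Zorn_nonempty)
    show "Collect eigen_family \<noteq> {}" by (auto simp: eigen_family_def orthonormal_def intro!: exI[of _ "{}"])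
  next
    fix \<C> assume C: "\<C> \<noteq> {}" "subset.chain (Collect eigen_family) \<C>"
    have "orthonormal (\<Union>\<C>)"
      unfolding orthonormal_def
    proof (intro conjI ballI impI)
      fix e f assume ef: "e \<in> \<Union>\<C>" "f \<in> \<Union>\<C>" "e \<noteq> f"
      then obtain A B where AB: "A \<in> \<C>" "B \<in> \<C>" "e \<in> A" "f \<in> B" by blast
      then have "A \<subseteq> B \<or> B \<subseteq> A" using C(2) by (meson subset_chain_def)
      then obtain D where D: "D \<in> \<C>" "e \<in> D" "f \<in> D" using AB by blast
      then have "eigen_family D" using C(2) by (auto simp: subset_chain_def)
      then show "cinner e f = 0" using D ef by (auto simp: eigen_family_def orthonormal_def)
    next
      fix e assume "e \<in> \<Union>\<C>"
      then show "norm e = 1" using C(2) eigen_familyD(4) by (auto simp: subset_chain_def)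
    qed
    moreover have "\<forall>e\<in>\<Union>\<C>. 0 < form e \<and> Z e = of_real (form e) *\<^sub>C e"
      using C(2) by (auto simp: subset_chain_def eigen_family_def)
    ultimately show "\<Union>\<C> \<in> Collect eigen_family" by (simp add: eigen_family_def)
  qed
  then obtain E where E: "eigen_family E" "\<And>F. eigen_family F \<Longrightarrow> E \<subseteq> F \<Longrightarrow> F = E" by blast
  have "Z u = 0" if u: "\<forall>e\<in>E. cinner e u = 0" for u
  proof (rule ccontr)
    assume "Z u \<noteq> 0"
    define U where "U = (\<Inter>e\<in>E. {x. cinner e x = 0})"
    have "closed U"
      unfolding U_def
      by (intro closed_INT ballI closed_Collect_eq cinner.continuous_on continuous_on_const continuous_on_id)
    moreover have "complex_vector.subspace U"
      by (rule complex_vector.subspaceI)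
         (auto simp: U_def cinner.zero_right cinner_add_right cinner_scaleC_right)
    moreover have "Z x \<in> U" if "x \<in> U" for x
      using that cinner_eigen[OF E(1)] by (auto simp: U_def)
    moreover have "u \<in> U" using u by (auto simp: U_def)
    ultimately obtain e where e: "e \<in> U" "norm e = 1" "0 < form e" "Z e = of_real (form e) *\<^sub>C e"
      using eigenvector_in_invariant_subspace \<open>Z u \<noteq> 0\<close> by blast
    have ort: "cinner f e = 0 \<and> cinner e f = 0" if "f \<in> E" for f
      using e(1) that cinner_eq_0_commute by (auto simp: U_def)
    have "eigen_family (insert e E)"
      using E(1) e ort unfolding eigen_family_def orthonormal_def by (simp add: ball_conj_distrib) 
    then have "e \<in> E" using E(2) by blast
    then have "cinner e e = 0" using ort by blast
    then show False using e(2) by (simp add: cinner_self)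
  qed
  then show ?thesis using E(1) unfolding spectral_basis_def by blast
qed

text \<open>
  Orthonormal eigenvectors with the same eigenvalue \<open>c\<close> have images at mutual distance \<open>c \<surd>2\<close>, so a sequence
  of them contradicts compactness.
\<close>

lemma finite_eigenspace:
  assumes "eigen_family E" "c > 0"
  shows "finite {e \<in> E. form e = c}"
proof (rule ccontr)
  assume "infinite {e \<in> E. form e = c}"
  then obtain v :: "nat \<Rightarrow> _" where v: "inj v" "range v \<subseteq> {e \<in> E. form e = c}"
    using infinite_countable_subset by blast
  have vE: "v n \<in> E" "form (v n) = c" for n using v(2) by auto
  obtain r l where r: "strict_mono r" "(\<lambda>n. Z (v (r n))) \<longlonglongrightarrow> l"
    using compact[of v] eigen_familyD(4)[OF assms(1) vE(1)] by auto
  have "Cauchy (\<lambda>n. Z (v (r n)))" by (rule LIMSEQ_imp_Cauchy[OF r(2)])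
  then obtain M where M: "\<forall>m\<ge>M. \<forall>n\<ge>M. norm (Z (v (r m)) - Z (v (r n))) < c"
    using \<open>c > 0\<close> unfolding Cauchy_iff by blast
  have "r M \<noteq> r (Suc M)" using strict_mono_eq[OF r(1), of M "Suc M"] by simp
  then have ne: "v (r M) \<noteq> v (r (Suc M))" using injD[OF v(1)] by blast
  have "Z (v n) = of_real c *\<^sub>C v n" for n
    using eigen_familyD(3)[OF assms(1) vE(1), of n] by (simp only: vE(2))
  then have "Z (v (r M)) - Z (v (r (Suc M))) = of_real c *\<^sub>C (v (r M) - v (r (Suc M)))"
    by (simp only: complex_vector.scale_right_diff_distrib)
  then have "norm (v (r M) - v (r (Suc M))) < 1"
    using M[rule_format, of M "Suc M"] \<open>c > 0\<close> by (simp add: norm_scaleC)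
  then have "(norm (v (r M) - v (r (Suc M))))\<^sup>2 < 1" by (simp add: power_less_one_iff)
  moreover have "(norm (v (r M) - v (r (Suc M))))\<^sup>2 = 2"
    using orthonormal_cinner[OF eigen_familyD(1)[OF assms(1)] vE(1) vE(1), of "r M" "r (Suc M)"] ne
      eigen_familyD(4)[OF assms(1) vE(1)]
    by (simp add: norm_diff_sq)
  ultimately show False by simp
qed

end

section \<open>Trace inequalities\<close>

text \<open>
  Jensen's inequality for \<open>x\<^sup>r\<close>. Weights of total mass less than \<open>1\<close> are possible because \<open>0\<^sup>r = 0\<close>;
  they arise from Bessel's inequality.
\<close>

lemma powr_concave:
  fixes x :: "'i \<Rightarrow> real"
  assumes "finite A" "\<And>i. i \<in> A \<Longrightarrow> 0 \<le> w i" "(\<Sum>i\<in>A. w i) \<le> 1" "\<And>i. i \<in> A \<Longrightarrow> 0 \<le> x i"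
    and r: "0 < r" "r \<le> 1"
  shows "(\<Sum>i\<in>A. w i * x i powr r) \<le> (\<Sum>i\<in>A. w i * x i) powr r"
proof -
  define s where "s = (\<Sum>i\<in>A. w i * x i)"
  have s: "s \<ge> 0" unfolding s_def using assms by (intro sum_nonneg) auto
  show ?thesis
  proof (cases "s = 0")
    case True
    then have "\<forall>i\<in>A. w i * x i = 0"
      unfolding s_def using assms by (subst (asm) sum_nonneg_eq_0_iff) auto
    then have "(\<Sum>i\<in>A. w i * x i powr r) = 0" by (intro sum.neutral) auto
    then show ?thesis by simp
  next
    case False
    then have s: "s > 0" using s by simp
    have tangent: "y powr r \<le> (1 - r) * s powr r + r * s powr (r - 1) * y" if "0 \<le> y" for y
    proof (cases "y = 0")
      case True
      then show ?thesis using r by simp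
    next
      case False
      have "y powr r * s powr (1 - r) \<le> r * y + (1 - r) * s"
        using r that s False by (intro Youngs_inequality_0) auto
      then have "y powr r * s powr (1 - r) * s powr (r - 1) \<le> (r * y + (1 - r) * s) * s powr (r - 1)"
        by (intro mult_right_mono) auto
      moreover have "s powr (1 - r) * s powr (r - 1) = 1" using s by (simp flip: powr_add)
      moreover have "s * s powr (r - 1) = s powr r" using s powr_mult_base[of s "r - 1"] by simp
      ultimately show ?thesis by (simp add: algebra_simps)
    qed
    have "(\<Sum>i\<in>A. w i * x i powr r) \<le> (\<Sum>i\<in>A. w i * ((1 - r) * s powr r + r * s powr (r - 1) * x i))"
      using assms by (intro sum_mono mult_left_mono tangent) auto
    also have "\<dots> = (1 - r) * s powr r * (\<Sum>i\<in>A. w i) + r * s powr (r - 1) * (\<Sum>i\<in>A. w i * x i)"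
      by (simp add: sum_distrib_left sum_distrib_right sum.distrib distrib_left mult_ac)
    also have "(\<Sum>i\<in>A. w i * x i) = s" by (simp add: s_def)
    also have "(1 - r) * s powr r * (\<Sum>i\<in>A. w i) + r * s powr (r - 1) * s
        \<le> (1 - r) * s powr r * 1 + r * s powr (r - 1) * s"
      using assms r by (intro add_mono mult_left_mono) auto
    also have "r * s powr (r - 1) * s = r * s powr r" using s powr_mult_base[of s "r - 1"] by (simp add: mult_ac)
    finally show ?thesis unfolding s_def[symmetric] by (simp add: algebra_simps)
  qed
qed

text \<open>
  The trace of \<open>Z\<^sup>r\<close> is at most \<open>S\<close>, finiteness included. Finite families of eigenvectors suffice to express
  this, without powers of operators.
\<close>

definition trace_bound :: "('h::chilbert_space \<Rightarrow> 'h) \<Rightarrow> real \<Rightarrow> real \<Rightarrow> bool" where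
  "trace_bound Z r S \<longleftrightarrow> (\<forall>F. finite F \<and> positive_operator.eigen_family Z F \<longrightarrow>
     (\<Sum>e\<in>F. positive_operator.form Z e powr r) \<le> S)"

text \<open>
  The left-hand side is a partial sum of the trace of \<open>C Z\<^bsup>r-1\<^esup>\<close>; instead of operator monotonicity, the proof
  uses only the concavity of \<open>x\<^sup>r\<close>. With \<open>f\<close> running through eigenvectors of \<open>C\<close> with eigenvalues \<open>c\<^sub>f\<close> and
  \<open>\<zeta>\<^sub>e\<close> the eigenvalue of \<open>e\<close>, the left-hand side is \<open>\<Sum>\<^sub>f \<Sum>\<^sub>e w\<^sub>f\<^sub>e \<zeta>\<^sub>e\<^sup>r\<close> for
  \<open>w\<^sub>f\<^sub>e = c\<^sub>f \<bar>\<langle>f, e\<rangle>\<bar>\<^sup>2 / \<zeta>\<^sub>e\<close>. For fixed \<open>f\<close> these weights have sum at most \<open>1\<close>, because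
  \<open>C \<le> Z\<close> (test with \<open>\<Sum>\<^sub>e \<langle>e, f\<rangle> / \<zeta>\<^sub>e e\<close>), and \<open>\<Sum>\<^sub>e w\<^sub>f\<^sub>e \<zeta>\<^sub>e \<le> c\<^sub>f\<close> by Bessel's inequality. Concavity
  bounds the inner sum by \<open>c\<^sub>f\<^sup>r\<close>.
\<close>

lemma trace_of_smaller_operator:
  fixes C Z :: "'h::chilbert_space \<Rightarrow> 'h"
  assumes C: "positive_compact C" and Z: "positive_operator Z"
    and le: "\<And>x. positive_operator.form C x \<le> positive_operator.form Z x"
    and r: "0 < r" "r \<le> 1" and S: "trace_bound C r S"
    and I: "finite I" "positive_operator.eigen_family Z I"
  shows "(\<Sum>e\<in>I. positive_operator.form Z e powr (r - 1) * positive_operator.form C e) \<le> S"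
proof -
  interpret C: positive_compact C by fact
  interpret Z: positive_operator Z by fact
  have on: "orthonormal I" using Z.eigen_familyD(1)[OF I(2)] .
  have \<zeta>: "Z.form e > 0" if "e \<in> I" for e using Z.eigen_familyD(2)[OF I(2) that] .
  obtain E where E: "C.spectral_basis E" using C.spectral_basis_exists by blast
  then have ef: "C.eigen_family E" by (simp add: C.spectral_basis_def)
  have column: "(\<Sum>e\<in>I. Z.form e powr (r - 1) * (C.form f * (cmod (cinner f e))\<^sup>2)) \<le> C.form f powr r"
    if f: "f \<in> E" for f
  proof -
    have cf: "C.form f > 0" using C.eigen_familyD(2)[OF ef f] .
    have f1: "norm f = 1" using C.eigen_familyD(4)[OF ef f] .
    have efs: "C.eigen_family {f}" using C.eigen_family_subset[OF ef] f by blast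
    define \<sigma> where "\<sigma> = (\<Sum>e\<in>I. (cmod (cinner e f))\<^sup>2 / Z.form e)"
    have \<sigma>: "\<sigma> \<ge> 0" unfolding \<sigma>_def using \<zeta> by (intro sum_nonneg divide_nonneg_pos) auto
    have sym: "cmod (cinner f e) = cmod (cinner e f)" for e
      by (metis cinner_commute complex_mod_cnj)
    \<comment> \<open>Formally the projection of \<open>Z\<^bsup>-1\<^esup> f\<close> to the span of \<open>I\<close>, the test vector for \<open>C \<le> Z\<close>.\<close>
    define v where "v = (\<Sum>e\<in>I. (cinner e f / of_real (Z.form e)) *\<^sub>C e)"
    have "Z.form v = (\<Sum>e\<in>I. Z.form e * (cmod (cinner e f / of_real (Z.form e)))\<^sup>2)"
      unfolding v_def by (rule Z.form_eigen_sum[OF I(2,1)])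
    also have "\<dots> = \<sigma>" unfolding \<sigma>_def
    proof (intro sum.cong refl)
      fix e assume "e \<in> I"
      then show "Z.form e * (cmod (cinner e f / of_real (Z.form e)))\<^sup>2 = (cmod (cinner e f))\<^sup>2 / Z.form e"
        using \<zeta>[of e] by (simp add: norm_divide power_divide power2_eq_square)
    qed
    finally have Zv: "Z.form v = \<sigma>" .
    have "cinner f v = (\<Sum>e\<in>I. of_real ((cmod (cinner e f))\<^sup>2) / of_real (Z.form e))"
      unfolding v_def cinner.sum_right cinner_scaleC_right complex_norm_square
      by (intro sum.cong refl) (metis cinner_commute times_divide_eq_left)
    also have "\<dots> = of_real \<sigma>" by (simp add: \<sigma>_def)
    finally have "C.form f * \<sigma>\<^sup>2 \<le> C.form v"
      using C.form_bessel[OF efs, of v] \<sigma> by simp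
    then have "C.form f * \<sigma> * \<sigma> \<le> 1 * \<sigma>" using le[of v] Zv by (simp add: power2_eq_square)
    then have c\<sigma>: "C.form f * \<sigma> \<le> 1" using \<sigma> by (cases "\<sigma> = 0") (auto simp: mult_le_cancel_right)
    define w where "w e = C.form f * ((cmod (cinner e f))\<^sup>2 / Z.form e)" for e
    have "(\<Sum>e\<in>I. Z.form e powr (r - 1) * (C.form f * (cmod (cinner f e))\<^sup>2)) = (\<Sum>e\<in>I. w e * Z.form e powr r)"
    proof (intro sum.cong refl)
      fix e assume "e \<in> I"
      then have "Z.form e powr (r - 1) = Z.form e powr r / Z.form e"
        using \<zeta>[of e] by (simp add: powr_diff)
      then show "Z.form e powr (r - 1) * (C.form f * (cmod (cinner f e))\<^sup>2) = w e * Z.form e powr r"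
        by (simp add: w_def sym)
    qed
    also have "\<dots> \<le> (\<Sum>e\<in>I. w e * Z.form e) powr r"
    proof (rule powr_concave[OF I(1) _ _ _ r])
      show "(\<Sum>e\<in>I. w e) \<le> 1" using c\<sigma> by (simp add: w_def \<sigma>_def sum_distrib_left)
    qed (use \<zeta> cf in \<open>auto simp: w_def less_imp_le\<close>)
    also have "(\<Sum>e\<in>I. w e * Z.form e) = C.form f * (\<Sum>e\<in>I. (cmod (cinner e f))\<^sup>2)"
      unfolding sum_distrib_left
    proof (intro sum.cong refl)
      fix e assume "e \<in> I"
      then show "w e * Z.form e = C.form f * (cmod (cinner e f))\<^sup>2" using \<zeta>[of e] by (simp add: w_def)
    qed
    also have "(C.form f * (\<Sum>e\<in>I. (cmod (cinner e f))\<^sup>2)) powr r \<le> (C.form f * 1) powr r"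
      using bessel[OF on I(1), of f] f1 cf r
      by (intro powr_mono2 mult_left_mono) (auto intro!: mult_nonneg_nonneg sum_nonneg)
    finally show ?thesis by simp
  qed
  show ?thesis
  proof (rule field_le_epsilon)
    fix \<epsilon> :: real assume "\<epsilon> > 0"
    define W where "W = (\<Sum>e\<in>I. Z.form e powr (r - 1)) + 1"
    have W: "W > 0" unfolding W_def by (intro add_nonneg_pos sum_nonneg) auto
    have "\<forall>e. \<exists>F\<subseteq>E. finite F \<and> (\<forall>G. finite G \<longrightarrow> F \<subseteq> G \<longrightarrow> G \<subseteq> E \<longrightarrow>
           C.form e < (\<Sum>f\<in>G. C.form f * (cmod (cinner f e))\<^sup>2) + \<epsilon> / W)"
      using C.form_approx[OF E divide_pos_pos[OF \<open>\<epsilon> > 0\<close> W]] by blast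
    then obtain F where F: "\<And>e. F e \<subseteq> E" "\<And>e. finite (F e)"
      "\<And>e G. \<lbrakk>finite G; F e \<subseteq> G; G \<subseteq> E\<rbrakk> \<Longrightarrow>
           C.form e < (\<Sum>f\<in>G. C.form f * (cmod (cinner f e))\<^sup>2) + \<epsilon> / W"
      by metis
    define G where "G = (\<Union>e\<in>I. F e)"
    have G: "finite G" "G \<subseteq> E" "\<And>e. e \<in> I \<Longrightarrow> F e \<subseteq> G" using F(1,2) I(1) by (auto simp: G_def)
    have "(\<Sum>e\<in>I. Z.form e powr (r - 1) * C.form e)
        \<le> (\<Sum>e\<in>I. Z.form e powr (r - 1) * ((\<Sum>f\<in>G. C.form f * (cmod (cinner f e))\<^sup>2) + \<epsilon> / W))"
      using F(3)[OF G(1) G(3) G(2)] by (intro sum_mono mult_left_mono) (auto intro: less_imp_le)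
    also have "\<dots> = (\<Sum>f\<in>G. \<Sum>e\<in>I. Z.form e powr (r - 1) * (C.form f * (cmod (cinner f e))\<^sup>2))
        + (\<Sum>e\<in>I. Z.form e powr (r - 1)) * (\<epsilon> / W)"
      by (subst sum.swap) (simp add: distrib_left sum.distrib sum_distrib_left sum_distrib_right sum_divide_distrib)
    also have "\<dots> \<le> (\<Sum>f\<in>G. C.form f powr r) + W * (\<epsilon> / W)"
      using G(2) \<open>\<epsilon> > 0\<close> W
      by (intro add_mono sum_mono column mult_right_mono) (auto simp: W_def)
    also have "(\<Sum>f\<in>G. C.form f powr r) \<le> S"
      using S G(1) C.eigen_family_subset[OF ef G(2)] unfolding trace_bound_def by blast
    finally show "(\<Sum>e\<in>I. Z.form e powr (r - 1) * C.form e) \<le> S + \<epsilon>" using W by simp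
  qed
qed

lemma positive_compact_add:
  fixes C D :: "'h::chilbert_space \<Rightarrow> 'h"
  assumes "positive_compact C" "positive_compact D"
  shows "positive_compact (\<lambda>x. C x + D x)"
proof -
  interpret C: positive_compact C by fact
  interpret D: positive_compact D by fact
  show ?thesis
  proof
    show "C (x + y) + D (x + y) = C x + D x + (C y + D y)" for x y by (simp add: C.add D.add)
    show "C (q *\<^sub>R x) + D (q *\<^sub>R x) = q *\<^sub>R (C x + D x)" for q x
      by (simp add: C.scaleR D.scaleR scaleR_add_right)
    have "bounded_linear (\<lambda>x. C x + D x)" by (intro bounded_linear_add C.blin D.blin)
    then show "\<exists>K. \<forall>x. norm (C x + D x) \<le> norm x * K" by (rule bounded_linear.bounded)
    show "C (c *\<^sub>C x) + D (c *\<^sub>C x) = c *\<^sub>C (C x + D x)" for c x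
      by (simp add: C.scaleC D.scaleC scaleC_add_right)
    show "cinner (C x + D x) y = cinner x (C y + D y)" for x y
      by (simp add: cinner_add_left cinner_add_right C.herm D.herm)
    show "0 \<le> Re (cinner x (C x + D x))" for x by (simp add: cinner_add_right C.pos D.pos)
  next
    fix v :: "nat \<Rightarrow> 'h" assume v: "\<And>n. norm (v n) \<le> 1"
    obtain r l where r: "strict_mono r" "(\<lambda>n. C (v (r n))) \<longlonglongrightarrow> l" using C.compact[of v] v by blast
    obtain s m where s: "strict_mono s" "(\<lambda>n. D (v (r (s n)))) \<longlonglongrightarrow> m"
      using D.compact[of "\<lambda>n. v (r n)"] v by blast
    have "(\<lambda>n. C (v (r (s n)))) \<longlonglongrightarrow> l" using LIMSEQ_subseq_LIMSEQ[OF r(2) s(1)] by (simp add: o_def)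
    from tendsto_add[OF this s(2)]
    have "(\<lambda>n. C (v ((r \<circ> s) n)) + D (v ((r \<circ> s) n))) \<longlonglongrightarrow> l + m" by simp
    then show "\<exists>r l. strict_mono r \<and> (\<lambda>n. C (v (r n)) + D (v (r n))) \<longlonglongrightarrow> l"
      using strict_mono_o[OF r(1) s(1)] by blast
  qed
qed

text \<open>
  Eigenvalues are more spread out than the diagonal entries in any other orthonormal family, so they give a smaller
  sum for a concave function. The number \<open>q\<close>, close to \<open>1\<close> in the application, measures how well the finite
  family \<open>I\<close> captures the eigenvectors in \<open>G\<close>.
\<close>

lemma eigen_sum_le_diagonal_sum:
  fixes X :: "'h::chilbert_space \<Rightarrow> 'h"
  assumes X: "positive_operator X" and r: "0 < r" "r \<le> 1"
    and G: "finite G" "positive_operator.eigen_family X G"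
    and I: "finite I" "orthonormal I"
    and q: "\<And>g. g \<in> G \<Longrightarrow> q \<le> (\<Sum>e\<in>I. (cmod (cinner e g))\<^sup>2)"
  shows "q * (\<Sum>g\<in>G. positive_operator.form X g powr r) \<le> (\<Sum>e\<in>I. positive_operator.form X e powr r)"
proof -
  interpret X: positive_operator X by fact
  have sym: "cmod (cinner f e) = cmod (cinner e f)" for e f :: 'h
    by (metis cinner_commute complex_mod_cnj)
  have on: "orthonormal G" by (rule X.eigen_familyD(1)[OF G(2)])
  have "q * (\<Sum>g\<in>G. X.form g powr r) = (\<Sum>g\<in>G. q * X.form g powr r)" by (simp add: sum_distrib_left)
  also have "\<dots> \<le> (\<Sum>g\<in>G. (\<Sum>e\<in>I. (cmod (cinner e g))\<^sup>2) * X.form g powr r)"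
    using q by (intro sum_mono mult_right_mono) auto
  also have "\<dots> = (\<Sum>e\<in>I. \<Sum>g\<in>G. (cmod (cinner g e))\<^sup>2 * X.form g powr r)"
    by (subst sum.swap) (simp add: sum_distrib_right sym)
  also have "\<dots> \<le> (\<Sum>e\<in>I. X.form e powr r)"
  proof (intro sum_mono)
    fix e assume e: "e \<in> I"
    have "(\<Sum>g\<in>G. (cmod (cinner g e))\<^sup>2 * X.form g powr r) \<le> (\<Sum>g\<in>G. (cmod (cinner g e))\<^sup>2 * X.form g) powr r"
    proof (rule powr_concave[OF G(1) _ _ _ r])
      show "(\<Sum>g\<in>G. (cmod (cinner g e))\<^sup>2) \<le> 1"
        using bessel[OF on G(1), of e] I(2) e by (simp add: orthonormal_def)
    qed (auto simp: X.form_nonneg)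
    also have "\<dots> \<le> X.form e powr r"
      using X.form_bessel[OF G(2,1), of e] r
      by (intro powr_mono2) (auto simp: mult.commute intro!: sum_nonneg mult_nonneg_nonneg X.form_nonneg)
    finally show "(\<Sum>g\<in>G. (cmod (cinner g e))\<^sup>2 * X.form g powr r) \<le> X.form e powr r" .
  qed
  finally show ?thesis .
qed

text \<open>
  With \<open>Z = C + D = (X + Y) / 2\<close> and a large finite family \<open>I\<close> of eigenvectors of \<open>Z\<close>: by concavity the left-hand
  side is at most \<open>2 \<Sum>\<^sub>e \<langle>e, Z e\<rangle>\<^sup>r\<close> over \<open>I\<close>, up to a factor close to \<open>1\<close>. Splitting
  \<open>\<langle>e, Z e\<rangle>\<^sup>r = \<langle>e, Z e\<rangle>\<^bsup>r-1\<^esup> (\<langle>e, C e\<rangle> + \<langle>e, D e\<rangle>)\<close> then yields the bounds for \<open>C\<close> and \<open>D\<close>.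
\<close>

lemma trace_clarkson:
  fixes C D X Y :: "'h::chilbert_space \<Rightarrow> 'h"
  assumes C: "positive_compact C" and D: "positive_compact D"
    and X: "positive_operator X" and Y: "positive_operator Y"
    and XY: "\<And>x. X x + Y x = 2 *\<^sub>R (C x + D x)"
    and r: "0 < r" "r \<le> 1" and S: "trace_bound C r S" "trace_bound D r S'"
    and G: "finite G" "positive_operator.eigen_family X G"
    and H: "finite H" "positive_operator.eigen_family Y H"
  shows "(\<Sum>e\<in>G. positive_operator.form X e powr r) + (\<Sum>e\<in>H. positive_operator.form Y e powr r) \<le> 2 * (S + S')"
proof -
  interpret C: positive_compact C by fact
  interpret D: positive_compact D by fact
  interpret X: positive_operator X by fact
  interpret Y: positive_operator Y by fact
  define Z where "Z x = C x + D x" for x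
  interpret Z: positive_compact Z unfolding Z_def by (rule positive_compact_add[OF C D])
  have Zform: "Z.form x = C.form x + D.form x" for x
    by (simp add: Z.form_def C.form_def D.form_def Z_def cinner_add_right)
  have XYform: "X.form x + Y.form x = 2 * Z.form x" for x
    using arg_cong[OF XY[of x], of "\<lambda>y. Re (cinner x y)"]
    by (simp add: Z.form_def X.form_def Y.form_def Z_def cinner_add_right cinner_scaleR_right)
  obtain E where E: "Z.spectral_basis E" using Z.spectral_basis_exists by blast
  then have ef: "Z.eigen_family E" by (simp add: Z.spectral_basis_def)
  have kernel: "X.form u = 0" "Y.form u = 0" if "Z u = 0" for u
    using XYform[of u] X.form_nonneg[of u] Y.form_nonneg[of u] that
    by (simp_all add: Z.form_def cinner.zero_right)
  show ?thesis
  proof (rule field_le_mult_one_interval)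
    fix q :: real assume q: "0 < q" "q < 1"
    have "\<forall>g\<in>G \<union> H. \<exists>F\<subseteq>E. finite F \<and> (\<forall>I. finite I \<longrightarrow> F \<subseteq> I \<longrightarrow> I \<subseteq> E \<longrightarrow>
           (norm g)\<^sup>2 - (1 - q) < (\<Sum>e\<in>I. (cmod (cinner e g))\<^sup>2))"
    proof
      fix g assume "g \<in> G \<union> H"
      then have "\<And>u. Z u = 0 \<Longrightarrow> cinner u g = 0"
        using X.eigen_family_perp[OF G(2) _ kernel(1)] Y.eigen_family_perp[OF H(2) _ kernel(2)] by blast
      then show "\<exists>F\<subseteq>E. finite F \<and> (\<forall>I. finite I \<longrightarrow> F \<subseteq> I \<longrightarrow> I \<subseteq> E \<longrightarrow>
           (norm g)\<^sup>2 - (1 - q) < (\<Sum>e\<in>I. (cmod (cinner e g))\<^sup>2))"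
        using Z.norm_approx[OF E, of g "1 - q"] q by simp
    qed
    then obtain F where F: "\<And>g. g \<in> G \<union> H \<Longrightarrow> F g \<subseteq> E" "\<And>g. g \<in> G \<union> H \<Longrightarrow> finite (F g)"
      "\<And>g I. \<lbrakk>g \<in> G \<union> H; finite I; F g \<subseteq> I; I \<subseteq> E\<rbrakk> \<Longrightarrow>
        (norm g)\<^sup>2 - (1 - q) < (\<Sum>e\<in>I. (cmod (cinner e g))\<^sup>2)"
      by metis
    define I where "I = (\<Union>g\<in>G \<union> H. F g)"
    have I: "finite I" "I \<subseteq> E" "\<And>g. g \<in> G \<union> H \<Longrightarrow> F g \<subseteq> I"
      using F(1,2) G(1) H(1) by (auto simp: I_def)
    have efI: "Z.eigen_family I" by (rule Z.eigen_family_subset[OF ef I(2)])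
    have onI: "orthonormal I" by (rule Z.eigen_familyD(1)[OF efI])
    have ge: "q \<le> (\<Sum>e\<in>I. (cmod (cinner e g))\<^sup>2)" if "g \<in> G \<union> H" for g
    proof -
      have "norm g = 1" using that X.eigen_familyD(4)[OF G(2)] Y.eigen_familyD(4)[OF H(2)] by blast
      then show ?thesis using F(3)[OF that I(1) I(3)[OF that] I(2)] by simp
    qed
    have "q * (\<Sum>e\<in>G. X.form e powr r) + q * (\<Sum>e\<in>H. Y.form e powr r)
        \<le> (\<Sum>e\<in>I. X.form e powr r) + (\<Sum>e\<in>I. Y.form e powr r)"
      by (intro add_mono eigen_sum_le_diagonal_sum X Y r G H I(1) onI ge) auto
    also have "\<dots> = (\<Sum>e\<in>I. X.form e powr r + Y.form e powr r)" by (simp add: sum.distrib)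
    also have "\<dots> \<le> (\<Sum>e\<in>I. 2 * Z.form e powr r)"
    proof (rule sum_mono)
      fix e
      have "(\<Sum>i\<in>{False,True}. (1/2) * (if i then X.form e else Y.form e) powr r)
          \<le> (\<Sum>i\<in>{False,True}. (1/2) * (if i then X.form e else Y.form e)) powr r"
        by (rule powr_concave[OF _ _ _ _ r]) (auto simp: X.form_nonneg Y.form_nonneg)
      moreover have "Y.form e / 2 + X.form e / 2 = Z.form e" using XYform[of e] by simp
      ultimately show "X.form e powr r + Y.form e powr r \<le> 2 * Z.form e powr r" by simp
    qed
    also have "\<dots> = 2 * ((\<Sum>e\<in>I. Z.form e powr (r - 1) * C.form e) + (\<Sum>e\<in>I. Z.form e powr (r - 1) * D.form e))"
    proof -
      have "Z.form e powr r = Z.form e powr (r - 1) * C.form e + Z.form e powr (r - 1) * D.form e"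
        if "e \<in> I" for e
        using powr_mult_base[of "Z.form e" "r - 1"] Z.form_nonneg
        by (simp add: Zform algebra_simps)
      then show ?thesis by (simp add: sum_distrib_left sum.distrib)
    qed
    also have "\<dots> \<le> 2 * (S + S')"
    proof (intro mult_left_mono add_mono)
      show "(\<Sum>e\<in>I. Z.form e powr (r - 1) * C.form e) \<le> S"
        by (rule trace_of_smaller_operator[OF C Z.positive_operator_axioms _ r S(1) I(1) efI])
           (simp add: Zform D.form_nonneg)
      show "(\<Sum>e\<in>I. Z.form e powr (r - 1) * D.form e) \<le> S'"
        by (rule trace_of_smaller_operator[OF D Z.positive_operator_axioms _ r S(2) I(1) efI])
           (simp add: Zform C.form_nonneg)
    qed auto
    finally show "q * ((\<Sum>e\<in>G. X.form e powr r) + (\<Sum>e\<in>H. Y.form e powr r)) \<le> 2 * (S + S')"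
      by (simp add: distrib_left)
  qed
qed

section \<open>Singular values\<close>

lemma compact_operator_bounded: "compact_operator T \<Longrightarrow> bounded_operator T"
  unfolding compact_operator_def bounded_operator_def by blast

lemma cadjoint_add:
  assumes "bounded_operator S" "bounded_operator T"
  shows "cadjoint (\<lambda>x. S x + T x) = (\<lambda>x. cadjoint S x + cadjoint T x)"
proof -
  interpret S: bounded_operator S by fact
  interpret T: bounded_operator T by fact
  interpret ST: bounded_operator "\<lambda>x. S x + T x"
    by unfold_locales
       (auto simp: S.add T.add S.scaleR T.scaleR S.scaleC T.scaleC scaleR_add_right scaleC_add_right
         intro!: bounded_linear.bounded bounded_linear_add S.blin T.blin)
  show ?thesis
    by (rule ST.cadjoint_unique)
       (simp add: cinner_add_left cinner_add_right S.cinner_cadjoint T.cinner_cadjoint)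
qed

lemma bounded_operator_scale:
  assumes "bounded_operator T"
  shows "bounded_operator (\<lambda>x. c *\<^sub>C T x)"
proof -
  interpret T: bounded_operator T by fact
  show ?thesis
  proof
    show "c *\<^sub>C T (x + y) = c *\<^sub>C T x + c *\<^sub>C T y" for x y by (simp add: T.add scaleC_add_right)
    show sc: "c *\<^sub>C T (d *\<^sub>C x) = d *\<^sub>C c *\<^sub>C T x" for d x
      by (simp add: T.scaleC scaleC_scaleC mult.commute)
    show "c *\<^sub>C T (r *\<^sub>R x) = r *\<^sub>R c *\<^sub>C T x" for r x by (simp add: scaleR_scaleC sc)
    show "\<exists>K. \<forall>x. norm (c *\<^sub>C T x) \<le> norm x * K"
      by (rule bounded_linear.bounded[OF bounded_linear_compose[OF bounded_linear_scaleC T.blin]])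
  qed
qed

lemma cadjoint_scale:
  assumes "bounded_operator T"
  shows "cadjoint (\<lambda>x. c *\<^sub>C T x) = (\<lambda>x. cnj c *\<^sub>C cadjoint T x)"
proof -
  interpret T: bounded_operator T by fact
  interpret cT: bounded_operator "\<lambda>x. c *\<^sub>C T x" by (rule bounded_operator_scale) fact
  show ?thesis
    by (rule cT.cadjoint_unique)
       (simp add: cinner_scaleC_left cinner_scaleC_right T.cinner_cadjoint)
qed

definition modulus_sq :: "('h::chilbert_space \<Rightarrow> 'h) \<Rightarrow> 'h \<Rightarrow> 'h" where
  "modulus_sq T x = cadjoint T (T x)"

lemma positive_compact_modulus_sq:
  assumes "compact_operator T"
  shows "positive_compact (modulus_sq T)"
proof -
  interpret T: bounded_operator T by (rule compact_operator_bounded) fact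
  interpret A: bounded_operator "cadjoint T" by (rule T.bounded_operator_cadjoint)
  show ?thesis
  proof
    show "modulus_sq T (x + y) = modulus_sq T x + modulus_sq T y" for x y
      by (simp add: modulus_sq_def T.add A.add)
    show "modulus_sq T (r *\<^sub>R x) = r *\<^sub>R modulus_sq T x" for r x
      by (simp add: modulus_sq_def T.scaleR A.scaleR)
    show "\<exists>K. \<forall>x. norm (modulus_sq T x) \<le> norm x * K"
      unfolding modulus_sq_def
      by (rule bounded_linear.bounded[OF bounded_linear_compose[OF A.blin T.blin]])
    show "modulus_sq T (c *\<^sub>C x) = c *\<^sub>C modulus_sq T x" for c x
      by (simp add: modulus_sq_def T.scaleC A.scaleC)
    show "cinner (modulus_sq T x) y = cinner x (modulus_sq T y)" for x y
      by (simp add: modulus_sq_def T.cinner_cadjoint T.cinner_cadjoint_right)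
    show "0 \<le> Re (cinner x (modulus_sq T x))" for x
      by (simp add: modulus_sq_def T.cinner_cadjoint_right cinner_self)
  next
    fix v :: "nat \<Rightarrow> 'a" assume "\<And>n. norm (v n) \<le> 1"
    then have "\<forall>n. T (v n) \<in> closure (T ` cball 0 1)"
      using closure_subset[of "T ` cball 0 1"] by auto
    moreover have "compact (closure (T ` cball 0 1))" using assms by (simp add: compact_operator_def)
    ultimately obtain r l where r: "strict_mono (r :: nat \<Rightarrow> nat)" "((\<lambda>n. T (v n)) \<circ> r) \<longlonglongrightarrow> l"
      unfolding compact_def by metis
    then have "(\<lambda>n. modulus_sq T (v (r n))) \<longlonglongrightarrow> cadjoint T l"
      using A.tendsto[OF r(2)] by (simp add: modulus_sq_def o_def)
    then show "\<exists>r l. strict_mono r \<and> (\<lambda>n. modulus_sq T (v (r n))) \<longlonglongrightarrow> l" using r(1) by blast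
  qed
qed

definition schatten_term :: "real \<Rightarrow> ('h::chilbert_space \<Rightarrow> 'h) \<Rightarrow> real \<Rightarrow> real" where
  "schatten_term p T s = real (sv_mult T s) * s powr p"

locale compact_op =
  fixes T :: "'h::chilbert_space \<Rightarrow> 'h" and p :: real
  assumes compact_op: "compact_operator T"
begin

sublocale M: positive_compact "modulus_sq T"
  by (rule positive_compact_modulus_sq[OF compact_op])

lemma sv_space_eq: "sv_space T s = {x. modulus_sq T x = of_real (s\<^sup>2) *\<^sub>C x}"
  by (simp add: sv_space_def modulus_sq_def)

abbreviation layer where "layer E s \<equiv> {e \<in> E. M.form e = s\<^sup>2}"

lemma layer_in_sv_space: "M.eigen_family E \<Longrightarrow> layer E s \<subseteq> sv_space T s"
  using M.eigen_familyD(3) by (fastforce simp: sv_space_eq)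

text \<open>
  A vector of the eigenspace minus its Fourier sum over the layer is orthogonal to the whole spectral basis,
  to the other layers because eigenvectors for different eigenvalues are orthogonal. Hence it lies in the
  kernel, and in the eigenspace of \<open>s\<^sup>2 \<noteq> 0\<close>, so it is \<open>0\<close>.
\<close>

lemma sv_space_span:
  assumes E: "M.spectral_basis E" and s: "s > 0"
  shows "sv_space T s = complex_vector.span (layer E s)"
proof
  have ef: "M.eigen_family E" using E by (simp add: M.spectral_basis_def)
  have "complex_vector.subspace (sv_space T s)"
    by (rule complex_vector.subspaceI)
       (auto simp: sv_space_eq M.zero M.add M.scaleC scaleC_add_right scaleC_scaleC mult.commute)
  then show "complex_vector.span (layer E s) \<subseteq> sv_space T s"
    by (rule complex_vector.span_minimal[OF layer_in_sv_space[OF ef]])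
  show "sv_space T s \<subseteq> complex_vector.span (layer E s)"
  proof
    fix x assume x: "x \<in> sv_space T s"
    have fin: "finite (layer E s)" using M.finite_eigenspace[OF ef] s by simp
    have on: "orthonormal (layer E s)"
      by (rule orthonormal_subset[OF M.eigen_familyD(1)[OF ef]]) auto
    define y where "y = (\<Sum>e\<in>layer E s. cinner e x *\<^sub>C e)"
    have y: "y \<in> complex_vector.span (layer E s)"
      unfolding y_def
      by (intro complex_vector.span_sum complex_vector.span_scale complex_vector.span_base)
    then have "y \<in> sv_space T s"
      using \<open>complex_vector.span (layer E s) \<subseteq> sv_space T s\<close> by blast
    then have xy: "modulus_sq T (x - y) = of_real (s\<^sup>2) *\<^sub>C (x - y)"
      using x by (simp add: sv_space_eq M.diff complex_vector.scale_right_diff_distrib)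
    have "cinner e (x - y) = 0" if e: "e \<in> E" for e
    proof (cases "M.form e = s\<^sup>2")
      case True
      then show ?thesis
        using cinner_orthonormal_sum[OF on fin, of e "\<lambda>e. cinner e x"] e
        by (simp add: y_def cinner.diff_right)
    next
      case False
      have "of_real (M.form e) * cinner e (x - y) = of_real (s\<^sup>2) * cinner e (x - y)"
        using M.cinner_eigen[OF ef e, of "x - y"] unfolding xy by (simp only: cinner_scaleC_right)
      then show ?thesis using False by (metis mult_cancel_right of_real_eq_iff)
    qed
    then have "modulus_sq T (x - y) = 0" using E by (simp add: M.spectral_basis_def)
    then have "x - y = 0" using xy s by simp
    then show "x \<in> complex_vector.span (layer E s)" using y by simp
  qed
qed

lemma sv_mult_eq_card:
  assumes E: "M.spectral_basis E" and s: "s > 0"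
  shows "sv_mult T s = card (layer E s)"
proof -
  have ef: "M.eigen_family E" using E by (simp add: M.spectral_basis_def)
  have "complex_vector.independent (layer E s)"
    by (intro orthonormal_independent orthonormal_subset[OF M.eigen_familyD(1)[OF ef]]) auto
  then show ?thesis
    unfolding sv_mult_def sv_space_span[OF E s] by (simp add: complex_vector.dim_eq_card_independent)
qed

lemma card_layer_le_sv_mult:
  assumes F: "M.eigen_family F" and s: "s > 0"
  shows "card (layer F s) \<le> sv_mult T s"
proof -
  obtain E where E: "M.spectral_basis E" using M.spectral_basis_exists by blast
  then have ef: "M.eigen_family E" by (simp add: M.spectral_basis_def)
  have ind: "complex_vector.independent (layer F s)"
    by (intro orthonormal_independent orthonormal_subset[OF M.eigen_familyD(1)[OF F]]) auto
  have sub: "layer F s \<subseteq> complex_vector.span (layer E s)"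
    unfolding sv_space_span[OF E s, symmetric] by (rule layer_in_sv_space[OF F])
  have fin: "finite (layer E s)" using M.finite_eigenspace[OF ef] s by simp
  show ?thesis
    unfolding sv_mult_eq_card[OF E s]
    using complex_vector.independent_span_bound[OF fin ind sub] by (rule conjunct2)
qed

text \<open>
  Sums over eigenvectors and sums over singular values with multiplicities agree once the eigenvectors are grouped by
  their eigenvalue \<open>s\<^sup>2\<close>.
\<close>

lemma form_layer_sum:
  assumes "A \<subseteq> {0<..}" "finite A" "finite F" "(\<lambda>e. sqrt (M.form e)) ` F \<subseteq> A"
  shows "(\<Sum>e\<in>F. M.form e powr (p / 2)) = (\<Sum>s\<in>A. real (card (layer F s)) * s powr p)"
proof -
  have "(\<Sum>e\<in>F. M.form e powr (p / 2)) = (\<Sum>s\<in>A. \<Sum>e\<in>{e\<in>F. sqrt (M.form e) = s}. M.form e powr (p / 2))"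
    by (rule sum.group[OF assms(3,2,4), symmetric])
  also have "\<dots> = (\<Sum>s\<in>A. \<Sum>e\<in>layer F s. s powr p)"
  proof (rule sum.cong[OF refl])
    fix s assume "s \<in> A"
    then have s: "s > 0" using assms(1) by auto
    have "{e\<in>F. sqrt (M.form e) = s} = layer F s"
      using s M.form_nonneg by (auto simp: real_sqrt_eq_iff real_sqrt_unique)
    moreover have "(s\<^sup>2) powr (p / 2) = s powr p"
      using s powr_powr[of s 2 "p / 2"] by simp
    ultimately show "(\<Sum>e\<in>{e\<in>F. sqrt (M.form e) = s}. M.form e powr (p / 2)) = (\<Sum>e\<in>layer F s. s powr p)"
      by simp
  qed
  finally show ?thesis by simp
qed

lemma trace_bound_infsum:
  assumes "schatten_term p T summable_on singular_values T"
  shows "trace_bound (modulus_sq T) (p / 2) (infsum (schatten_term p T) (singular_values T))"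
  unfolding trace_bound_def
proof (intro allI impI, elim conjE)
  fix F assume F: "finite F" "M.eigen_family F"
  define A where "A = (\<lambda>e. sqrt (M.form e)) ` F"
  have A: "A \<subseteq> {0<..}" "finite A" using F M.eigen_familyD(2) by (auto simp: A_def)
  have "A \<subseteq> singular_values T"
  proof
    fix s assume "s \<in> A"
    then obtain e where e: "e \<in> F" "s = sqrt (M.form e)" by (auto simp: A_def)
    have "e \<in> sv_space T s"
      using layer_in_sv_space[OF F(2), of s] e M.form_nonneg by auto
    moreover have "e \<noteq> 0" using M.eigen_familyD(4)[OF F(2) e(1)] by auto
    ultimately show "s \<in> singular_values T" using \<open>s \<in> A\<close> A(1) by (auto simp: singular_values_def)
  qed
  have "(\<Sum>e\<in>F. M.form e powr (p / 2)) = (\<Sum>s\<in>A. real (card (layer F s)) * s powr p)"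
    by (rule form_layer_sum[OF A F(1)]) (simp add: A_def)
  also have "\<dots> \<le> (\<Sum>s\<in>A. schatten_term p T s)"
    unfolding schatten_term_def
    using A(1) card_layer_le_sv_mult[OF F(2)] by (intro sum_mono mult_right_mono) auto
  also have "\<dots> \<le> infsum (schatten_term p T) (singular_values T)"
    by (rule finite_sum_le_infsum[OF assms A(2) \<open>A \<subseteq> singular_values T\<close>]) (simp add: schatten_term_def)
  finally show "(\<Sum>e\<in>F. M.form e powr (p / 2)) \<le> infsum (schatten_term p T) (singular_values T)" .
qed

lemma trace_bound_imp:
  assumes S: "trace_bound (modulus_sq T) (p / 2) S"
  shows "schatten_term p T summable_on singular_values T" "infsum (schatten_term p T) (singular_values T) \<le> S"
proof -
  obtain E where E: "M.spectral_basis E" using M.spectral_basis_exists by blast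
  then have ef: "M.eigen_family E" by (simp add: M.spectral_basis_def)
  have le: "sum (schatten_term p T) A \<le> S" if A: "finite A" "A \<subseteq> singular_values T" for A
  proof -
    have A0: "A \<subseteq> {0<..}" using A(2) by (auto simp: singular_values_def)
    define F where "F = (\<Union>s\<in>A. layer E s)"
    have finL: "finite (layer E s)" if "s \<in> A" for s
    proof -
      have "s > 0" using A0 that by auto
      then show ?thesis using M.finite_eigenspace[OF ef] by simp
    qed
    then have F: "finite F" "F \<subseteq> E" using A(1) by (auto simp: F_def)
    have "sum (schatten_term p T) A = (\<Sum>s\<in>A. real (card (layer F s)) * s powr p)"
    proof (rule sum.cong[OF refl])
      fix s assume "s \<in> A"
      then have "layer F s = layer E s" by (auto simp: F_def)
      then show "schatten_term p T s = real (card (layer F s)) * s powr p"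
        using sv_mult_eq_card[OF E, of s] A0 \<open>s \<in> A\<close> by (auto simp: schatten_term_def)
    qed
    also have "\<dots> = (\<Sum>e\<in>F. M.form e powr (p / 2))"
    proof (rule form_layer_sum[OF A0 A(1) F(1), symmetric])
      show "(\<lambda>e. sqrt (M.form e)) ` F \<subseteq> A"
      proof
        fix t assume "t \<in> (\<lambda>e. sqrt (M.form e)) ` F"
        then obtain s where s: "s \<in> A" "t = sqrt (s\<^sup>2)" by (auto simp: F_def)
        have "s > 0" using A0 s(1) by auto
        then show "t \<in> A" using s by simp
      qed
    qed
    also have "\<dots> \<le> S"
      using S F(1) M.eigen_family_subset[OF ef F(2)] unfolding trace_bound_def by blast
    finally show ?thesis .
  qed
  show sm: "schatten_term p T summable_on singular_values T"
  proof (rule nonneg_bdd_above_summable_on)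
    show "bdd_above (sum (schatten_term p T) ` {F. F \<subseteq> singular_values T \<and> finite F})"
      by (rule bdd_aboveI2[of _ _ S]) (use le in auto)
  qed (simp add: schatten_term_def)
  show "infsum (schatten_term p T) (singular_values T) \<le> S"
    by (rule infsum_le_finite_sums[OF sm le])
qed

end

section \<open>The space \<open>L\<^sub>p(\<mu>)\<close>\<close>

lemma powr_subadditive:
  fixes x y r :: real
  assumes "0 \<le> x" "0 \<le> y" "0 < r" "r \<le> 1"
  shows "(x + y) powr r \<le> x powr r + y powr r"
proof -
  have *: "z * (x + y) powr (r - 1) \<le> z powr r" if "0 \<le> z" "z \<le> x + y" for z
  proof (cases "z = 0")
    case False
    then have "z * (x + y) powr (r - 1) \<le> z * z powr (r - 1)"
      using that assms by (intro mult_left_mono powr_mono2') auto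
    then show ?thesis using powr_mult_base[of z "r - 1"] that by simp
  qed simp
  have "(x + y) powr r = x * (x + y) powr (r - 1) + y * (x + y) powr (r - 1)"
    using powr_mult_base[of "x + y" "r - 1"] assms by (simp add: algebra_simps)
  also have "\<dots> \<le> x powr r + y powr r" using assms by (intro add_mono *) auto
  finally show ?thesis .
qed

text \<open>
  The parallelogram law, with concavity of \<open>x\<^bsup>p/2\<^esup>\<close> on the left and subadditivity on the right.
\<close>

lemma complex_clarkson:
  fixes a b :: complex
  assumes p: "0 < p" "p \<le> 2"
  shows "cmod (a + b) powr p + cmod (a - b) powr p \<le> 2 * cmod a powr p + 2 * cmod b powr p"
proof -
  have sq: "cmod z powr p = (cmod z)\<^sup>2 powr (p / 2)" for z
    using powr_powr[of "cmod z" 2 "p / 2"] by (cases "z = 0") simp_all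
  have "(\<Sum>i\<in>{False,True}. (1/2) * (if i then (cmod (a + b))\<^sup>2 else (cmod (a - b))\<^sup>2) powr (p / 2))
      \<le> (\<Sum>i\<in>{False,True}. (1/2) * (if i then (cmod (a + b))\<^sup>2 else (cmod (a - b))\<^sup>2)) powr (p / 2)"
    using p by (intro powr_concave) auto
  moreover have "(cmod (a - b))\<^sup>2 / 2 + (cmod (a + b))\<^sup>2 / 2 = (cmod a)\<^sup>2 + (cmod b)\<^sup>2"
    unfolding cmod_power2 by (simp add: power2_eq_square field_simps)
  moreover have "((cmod a)\<^sup>2 + (cmod b)\<^sup>2) powr (p / 2) \<le> (cmod a)\<^sup>2 powr (p / 2) + (cmod b)\<^sup>2 powr (p / 2)"
    using p by (intro powr_subadditive) auto
  ultimately show ?thesis unfolding sq[of a] sq[of b] sq[of "a + b"] sq[of "a - b"] by simp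
qed

locale Lp_exponent =
  fixes p :: real and M :: "'a measure"
  assumes p: "0 < p" "p \<le> 2"
begin

abbreviation Lp where "Lp \<equiv> Lp_fun p M"
abbreviation cls where "cls f \<equiv> Lp_rel p M `` {f}"
abbreviation pint where "pint f \<equiv> \<integral>x. cmod (f x) powr p \<partial>M"

lemma Lp_measurable: "f \<in> Lp \<Longrightarrow> f \<in> borel_measurable M"
  by (simp add: Lp_fun_def)

lemma Lp_integrable: "f \<in> Lp \<Longrightarrow> integrable M (\<lambda>x. cmod (f x) powr p)"
  by (simp add: Lp_fun_def)

lemma Lp_zero: "(\<lambda>x. 0) \<in> Lp"
  using p by (simp add: Lp_fun_def)

lemma Lp_scale:
  assumes "f \<in> Lp" shows "(\<lambda>x. c * f x) \<in> Lp"
proof -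
  note [measurable] = Lp_measurable[OF assms]
  have "(\<lambda>x. c * f x) \<in> borel_measurable M" by measurable
  then show ?thesis using assms by (simp add: Lp_fun_def norm_mult powr_mult)
qed

lemma Lp_add:
  assumes "f \<in> Lp" "g \<in> Lp"
  shows "(\<lambda>x. f x + g x) \<in> Lp"
proof -
  note [measurable] = Lp_measurable[OF assms(1)] Lp_measurable[OF assms(2)]
  have "integrable M (\<lambda>x. cmod (f x + g x) powr p)"
  proof (rule Bochner_Integration.integrable_bound)
    show "integrable M (\<lambda>x. 2 * cmod (f x) powr p + 2 * cmod (g x) powr p)"
      using Lp_integrable assms by (intro Bochner_Integration.integrable_add integrable_mult_right) auto
    show "AE x in M. norm (cmod (f x + g x) powr p) \<le> norm (2 * cmod (f x) powr p + 2 * cmod (g x) powr p)"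
    proof (rule AE_I2)
      fix x
      have "cmod (f x + g x) powr p \<le> 2 * cmod (f x) powr p + 2 * cmod (g x) powr p"
        using complex_clarkson[OF p, of "f x" "g x"] powr_ge_zero[of "cmod (f x - g x)" p] by linarith
      then show "norm (cmod (f x + g x) powr p) \<le> norm (2 * cmod (f x) powr p + 2 * cmod (g x) powr p)"
        by simp
    qed
  qed measurable
  then show ?thesis by (simp add: Lp_fun_def)
qed

lemma cls_eq: "f \<in> Lp \<Longrightarrow> cls f = {g \<in> Lp. AE x in M. f x = g x}"
  by (auto simp: Lp_rel_def)

lemma cls_eqI:
  assumes "f \<in> Lp" "g \<in> Lp" "AE x in M. f x = g x"
  shows "cls f = cls g"
proof -
  have "(AE x in M. f x = h x) \<longleftrightarrow> (AE x in M. g x = h x)" for h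
    using assms(3) by (intro iffI) (elim AE_mp; auto)+
  then show ?thesis by (simp add: cls_eq assms)
qed

lemma cls_self: "f \<in> Lp \<Longrightarrow> f \<in> cls f"
  by (simp add: cls_eq)

lemma carrier_cls: "A \<in> vcarrier (Lp_space p M) \<longleftrightarrow> (\<exists>f\<in>Lp. A = cls f)"
  by (auto simp: Lp_space_def quotient_def)

lemma vadd_cls:
  assumes "f \<in> Lp" "g \<in> Lp"
  shows "vadd (Lp_space p M) (cls f) (cls g) = cls (\<lambda>x. f x + g x)"
proof -
  have "cls (\<lambda>x. f' x + g' x) = cls (\<lambda>x. f x + g x)" if "f' \<in> cls f" "g' \<in> cls g" for f' g'
  proof (rule cls_eqI)
    have fg: "f' \<in> Lp" "g' \<in> Lp" "AE x in M. f x = f' x" "AE x in M. g x = g' x"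
      using that assms by (auto simp: cls_eq)
    then show "(\<lambda>x. f' x + g' x) \<in> Lp" "(\<lambda>x. f x + g x) \<in> Lp" using Lp_add assms by auto
    show "AE x in M. f' x + g' x = f x + g x" using fg(3,4) by eventually_elim simp
  qed
  then have "(\<Union>f'\<in>cls f. \<Union>g'\<in>cls g. cls (\<lambda>x. f' x + g' x)) = cls (\<lambda>x. f x + g x)"
    by (intro UN_constant_eq[OF cls_self[OF assms(1)]] UN_constant_eq[OF cls_self[OF assms(2)]] ballI)
  then show ?thesis by (simp only: Lp_space_def cnormed.simps)
qed

lemma vscale_cls:
  assumes "f \<in> Lp"
  shows "vscale (Lp_space p M) c (cls f) = cls (\<lambda>x. c * f x)"
proof -
  have "cls (\<lambda>x. c * f' x) = cls (\<lambda>x. c * f x)" if "f' \<in> cls f" for f'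
  proof (rule cls_eqI)
    have f': "f' \<in> Lp" "AE x in M. f x = f' x"
      using that assms by (auto simp: cls_eq)
    then show "(\<lambda>x. c * f' x) \<in> Lp" "(\<lambda>x. c * f x) \<in> Lp" using Lp_scale assms by auto
    show "AE x in M. c * f' x = c * f x" using f'(2) by eventually_elim simp
  qed
  then have "(\<Union>f'\<in>cls f. cls (\<lambda>x. c * f' x)) = cls (\<lambda>x. c * f x)"
    by (intro UN_constant_eq[OF cls_self[OF assms]] ballI)
  then show ?thesis by (simp only: Lp_space_def cnormed.simps)
qed

lemma vnorm_cls:
  assumes f: "f \<in> Lp"
  shows "vnorm (Lp_space p M) (cls f) = pint f powr (1 / p)"
proof -
  have "pint g = pint f" if "g \<in> cls f" for g
  proof (rule integral_cong_AE)
    have g: "g \<in> Lp" "AE x in M. f x = g x" using that f by (auto simp: cls_eq)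
    note [measurable] = Lp_measurable[OF f] Lp_measurable[OF g(1)]
    show "(\<lambda>x. cmod (g x) powr p) \<in> borel_measurable M" "(\<lambda>x. cmod (f x) powr p) \<in> borel_measurable M"
      by measurable
    show "AE x in M. cmod (g x) powr p = cmod (f x) powr p" using g(2) by eventually_elim simp
  qed
  then have "(\<lambda>g. pint g powr (1 / p)) ` cls f = (\<lambda>_. pint f powr (1 / p)) ` cls f"
    by (intro image_cong refl) simp
  also have "\<dots> = {pint f powr (1 / p)}" by (rule image_constant[OF cls_self[OF f]])
  finally show ?thesis by (simp only: Lp_space_def cnormed.simps the_elem_eq)
qed

lemma pint_nonneg: "0 \<le> pint f"
  by (rule integral_nonneg_AE) simp

lemma vnorm_cls_powr: "f \<in> Lp \<Longrightarrow> vnorm (Lp_space p M) (cls f) powr p = pint f"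
  using p pint_nonneg[of f] by (simp add: vnorm_cls powr_powr)

lemma vzero_cls: "vzero (Lp_space p M) = cls (\<lambda>x. 0)"
  by (simp add: Lp_space_def)

lemma clarkson_space_Lp: "clarkson_space (Lp_space p M) p"
proof
  let ?X = "Lp_space p M"
  note ops = vadd_cls vscale_cls vzero_cls Lp_zero Lp_add Lp_scale
  show "0 < p" by (rule p)
  show "vzero ?X \<in> vcarrier ?X" unfolding carrier_cls vzero_cls using Lp_zero by blast
  fix A assume "A \<in> vcarrier ?X"
  then obtain f where f: "f \<in> Lp" "A = cls f" unfolding carrier_cls by blast
  show "vscale ?X c A \<in> vcarrier ?X" for c
    unfolding carrier_cls f(2) vscale_cls[OF f(1)] using Lp_scale[OF f(1)] by blast
  show "vadd ?X A (vzero ?X) = A" "vscale ?X (c + d) A = vadd ?X (vscale ?X c A) (vscale ?X d A)"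
    "vscale ?X c (vscale ?X d A) = vscale ?X (c * d) A" "vscale ?X 1 A = A" "vscale ?X 0 A = vzero ?X" for c d
    using f(1) by (simp_all add: f(2) ops algebra_simps)
  show "0 \<le> vnorm ?X A" by (simp add: f vnorm_cls)
  show "vnorm ?X (vscale ?X c A) = cmod c * vnorm ?X A" for c
    using f(1) p pint_nonneg[of f]
    by (simp add: f(2) ops vnorm_cls norm_mult powr_mult powr_powr)
  show "A = vzero ?X" if "vnorm ?X A = 0"
  proof -
    have "pint f = 0" using that f by (simp add: vnorm_cls)
    then have "AE x in M. cmod (f x) powr p = 0"
      using integral_nonneg_eq_0_iff_AE[OF Lp_integrable[OF f(1)]] by simp
    then have "AE x in M. f x = 0" by eventually_elim simp
    then show ?thesis unfolding f(2) vzero_cls by (intro cls_eqI f(1) Lp_zero)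
  qed
  fix B assume "B \<in> vcarrier ?X"
  then obtain g where g: "g \<in> Lp" "B = cls g" unfolding carrier_cls by blast
  show "vadd ?X A B \<in> vcarrier ?X"
    unfolding carrier_cls f(2) g(2) vadd_cls[OF f(1) g(1)] using Lp_add[OF f(1) g(1)] by blast
  show "vadd ?X A B = vadd ?X B A" "vscale ?X c (vadd ?X A B) = vadd ?X (vscale ?X c A) (vscale ?X c B)" for c
    using f(1) g(1) by (simp_all add: f(2) g(2) ops algebra_simps)
  show "vnorm ?X (vadd ?X A B) powr p + vnorm ?X (vadd ?X A (vscale ?X (- 1) B)) powr p
      \<le> 2 * vnorm ?X A powr p + 2 * vnorm ?X B powr p"
  proof -
    have s: "(\<lambda>x. f x + g x) \<in> Lp" and d: "(\<lambda>x. f x + - 1 * g x) \<in> Lp"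
      using f(1) g(1) by (simp_all only: Lp_add Lp_scale)
    have "pint (\<lambda>x. f x + g x) + pint (\<lambda>x. f x + - 1 * g x)
        = (\<integral>x. cmod (f x + g x) powr p + cmod (f x + - 1 * g x) powr p \<partial>M)"
      by (rule Bochner_Integration.integral_add[OF Lp_integrable[OF s] Lp_integrable[OF d], symmetric])
    also have "\<dots> \<le> (\<integral>x. 2 * cmod (f x) powr p + 2 * cmod (g x) powr p \<partial>M)"
    proof (rule integral_mono)
      show "cmod (f x + g x) powr p + cmod (f x + - 1 * g x) powr p \<le> 2 * cmod (f x) powr p + 2 * cmod (g x) powr p" for x
        using complex_clarkson[OF p, of "f x" "g x"] by simp
    qed (use Lp_integrable s d f(1) g(1) in \<open>auto intro!: Bochner_Integration.integrable_add integrable_mult_right\<close>)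
    also have "\<dots> = 2 * pint f + 2 * pint g"
      using Lp_integrable f(1) g(1) by (subst Bochner_Integration.integral_add) auto
    finally show ?thesis
      using f(1) g(1) s d by (simp only: f(2) g(2) vadd_cls vscale_cls Lp_scale vnorm_cls_powr)
  qed
  fix C assume "C \<in> vcarrier ?X"
  then obtain h where h: "h \<in> Lp" "C = cls h" unfolding carrier_cls by blast
  show "vadd ?X (vadd ?X A B) C = vadd ?X A (vadd ?X B C)"
    using f(1) g(1) h(1) by (simp_all add: f(2) g(2) h(2) ops algebra_simps)
qed

end

section \<open>The Schatten classes\<close>

lemma compact_operator_zero: "compact_operator (\<lambda>x :: 'h::chilbert_space. 0)"
proof -
  have "(\<lambda>x :: 'h. 0 :: 'h) ` cball 0 1 = {0}" by (rule image_constant[of 0]) simp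
  then show ?thesis by (simp add: compact_operator_def bounded_linear_zero)
qed

lemma compact_operator_add:
  assumes "compact_operator S" "compact_operator T"
  shows "compact_operator (\<lambda>x. S x + T x)"
proof -
  let ?S = "closure (S ` cball 0 1)" and ?T = "closure (T ` cball 0 1)"
  have c: "compact {x + y | x y. x \<in> ?S \<and> y \<in> ?T}"
    using assms unfolding compact_operator_def by (intro compact_sums) simp_all
  have "(\<lambda>x. S x + T x) ` cball 0 1 \<subseteq> {x + y | x y. x \<in> ?S \<and> y \<in> ?T}"
  proof
    fix y assume "y \<in> (\<lambda>x. S x + T x) ` cball 0 1"
    then obtain x where x: "x \<in> cball 0 1" "y = S x + T x" by blast
    have "S x \<in> ?S" "T x \<in> ?T" by (rule subsetD[OF closure_subset imageI[OF x(1)]])+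
    then show "y \<in> {x + y | x y. x \<in> ?S \<and> y \<in> ?T}" using x(2) by blast
  qed
  then have sub: "closure ((\<lambda>x. S x + T x) ` cball 0 1) \<subseteq> {x + y | x y. x \<in> ?S \<and> y \<in> ?T}"
    by (rule closure_minimal[OF _ compact_imp_closed[OF c]])
  have "compact (closure ((\<lambda>x. S x + T x) ` cball 0 1))"
    using closed_Int_compact[OF closed_closure[of "(\<lambda>x. S x + T x) ` cball 0 1"] c]
    unfolding Int_absorb2[OF sub] .
  then show ?thesis
    using assms by (simp add: compact_operator_def bounded_linear_add scaleC_add_right)
qed

lemma compact_operator_scale:
  assumes "compact_operator T"
  shows "compact_operator (\<lambda>x. c *\<^sub>C T x)"
proof -
  interpret bounded_operator "\<lambda>x. c *\<^sub>C T x"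
    by (rule bounded_operator_scale[OF compact_operator_bounded[OF assms]])
  let ?T = "closure (T ` cball 0 1)"
  have c: "compact ((\<lambda>x. c *\<^sub>C x) ` ?T)"
    using assms
    by (intro compact_continuous_image linear_continuous_on bounded_linear_scaleC)
       (auto simp: compact_operator_def)
  have "(\<lambda>x. c *\<^sub>C T x) ` cball 0 1 \<subseteq> (\<lambda>x. c *\<^sub>C x) ` ?T"
    using closure_subset[of "T ` cball 0 1"] by blast
  then have sub: "closure ((\<lambda>x. c *\<^sub>C T x) ` cball 0 1) \<subseteq> (\<lambda>x. c *\<^sub>C x) ` ?T"
    by (rule closure_minimal[OF _ compact_imp_closed[OF c]])
  have "compact (closure ((\<lambda>x. c *\<^sub>C T x) ` cball 0 1))"
    using closed_Int_compact[OF closed_closure[of "(\<lambda>x. c *\<^sub>C T x) ` cball 0 1"] c]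
    unfolding Int_absorb2[OF sub] .
  then show ?thesis using blin scaleC by (simp add: compact_operator_def)
qed

lemma modulus_sq_parallelogram:
  assumes "compact_operator A" "compact_operator B"
  shows "modulus_sq (\<lambda>x. A x + B x) x + modulus_sq (\<lambda>x. A x + (- 1) *\<^sub>C B x) x
       = 2 *\<^sub>R (modulus_sq A x + modulus_sq B x)"
proof -
  interpret A: bounded_operator A by (rule compact_operator_bounded) fact
  interpret B: bounded_operator B by (rule compact_operator_bounded) fact
  interpret B': bounded_operator "\<lambda>x. (- 1) *\<^sub>C B x"
    by (rule bounded_operator_scale) (rule B.bounded_operator_axioms)
  interpret A': bounded_operator "cadjoint A" by (rule A.bounded_operator_cadjoint)
  interpret C: bounded_operator "cadjoint B" by (rule B.bounded_operator_cadjoint)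
  have "modulus_sq (\<lambda>x. A x + B x) x = cadjoint A (A x) + cadjoint A (B x) + (cadjoint B (A x) + cadjoint B (B x))"
    unfolding modulus_sq_def cadjoint_add[OF A.bounded_operator_axioms B.bounded_operator_axioms]
    by (simp add: A'.add C.add)
  moreover have "modulus_sq (\<lambda>x. A x + (- 1) *\<^sub>C B x) x
      = cadjoint A (A x) - cadjoint A (B x) - (cadjoint B (A x) - cadjoint B (B x))"
    unfolding modulus_sq_def cadjoint_add[OF A.bounded_operator_axioms B'.bounded_operator_axioms]
      cadjoint_scale[OF B.bounded_operator_axioms]
    by (simp add: A'.diff C.diff)
  ultimately show ?thesis by (simp add: modulus_sq_def scaleR_2 algebra_simps)
qed

text \<open>
  The trace inequality bounds the eigenvalue sums of \<open>U\<close> and \<open>W\<close> over finite families simultaneously. Fixing the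
  family of \<open>W\<close> and taking the supremum over those of \<open>U\<close>, and then conversely, gives the statement about infinite
  sums; the empty family of \<open>W\<close> gives summability for \<open>U\<close>.
\<close>

lemma schatten_clarkson:
  fixes A B :: "'h::chilbert_space \<Rightarrow> 'h"
  assumes p: "0 < p" "p \<le> 2"
    and A: "compact_operator A" "schatten_term p A summable_on singular_values A"
    and B: "compact_operator B" "schatten_term p B summable_on singular_values B"
  defines "U \<equiv> \<lambda>x. A x + B x" and "W \<equiv> \<lambda>x. A x + (- 1) *\<^sub>C B x"
  shows "schatten_term p U summable_on singular_values U"
    and "infsum (schatten_term p U) (singular_values U) + infsum (schatten_term p W) (singular_values W)
      \<le> 2 * infsum (schatten_term p A) (singular_values A) + 2 * infsum (schatten_term p B) (singular_values B)"
proof -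
  interpret A: compact_op A p by unfold_locales fact
  interpret B: compact_op B p by unfold_locales fact
  interpret U: compact_op U p
    unfolding U_def by unfold_locales (intro compact_operator_add A B)
  interpret W: compact_op W p
    unfolding W_def by unfold_locales (intro compact_operator_add compact_operator_scale A B)
  let ?S = "2 * (infsum (schatten_term p A) (singular_values A) + infsum (schatten_term p B) (singular_values B))"
  have *: "(\<Sum>e\<in>G. U.M.form e powr (p / 2)) + (\<Sum>e\<in>H. W.M.form e powr (p / 2)) \<le> ?S"
    if "finite G" "U.M.eigen_family G" "finite H" "W.M.eigen_family H" for G H
  proof (rule trace_clarkson[OF A.M.positive_compact_axioms B.M.positive_compact_axioms
        U.M.positive_operator_axioms W.M.positive_operator_axioms _ _ _
        A.trace_bound_infsum[OF A(2)] B.trace_bound_infsum[OF B(2)] that])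
    show "modulus_sq U x + modulus_sq W x = 2 *\<^sub>R (modulus_sq A x + modulus_sq B x)" for x
      unfolding U_def W_def by (rule modulus_sq_parallelogram[OF A(1) B(1)])
  qed (use p in auto)
  have U: "trace_bound (modulus_sq U) (p / 2) (?S - (\<Sum>e\<in>H. W.M.form e powr (p / 2)))"
    if "finite H" "W.M.eigen_family H" for H
    unfolding trace_bound_def using * that by (fastforce simp: le_diff_eq)
  have "W.M.eigen_family {}" by (simp add: W.M.eigen_family_def orthonormal_def)
  then show "schatten_term p U summable_on singular_values U" using U.trace_bound_imp(1)[OF U[of "{}"]] by simp
  have "trace_bound (modulus_sq W) (p / 2) (?S - infsum (schatten_term p U) (singular_values U))"
    unfolding trace_bound_def using U.trace_bound_imp(2)[OF U] by (force simp: le_diff_eq)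
  from W.trace_bound_imp(2)[OF this]
  show "infsum (schatten_term p U) (singular_values U) + infsum (schatten_term p W) (singular_values W)
      \<le> 2 * infsum (schatten_term p A) (singular_values A) + 2 * infsum (schatten_term p B) (singular_values B)"
    by simp
qed

lemma sv_space_scale:
  assumes T: "bounded_operator T" and c: "c \<noteq> 0"
  shows "sv_space (\<lambda>x. c *\<^sub>C T x) (cmod c * s) = sv_space T s"
proof -
  interpret T: bounded_operator T by fact
  interpret A: bounded_operator "cadjoint T" by (rule T.bounded_operator_cadjoint)
  have eq: "cadjoint (\<lambda>x. c *\<^sub>C T x) (c *\<^sub>C T x) = of_real ((cmod c)\<^sup>2) *\<^sub>C cadjoint T (T x)" for x
    unfolding cadjoint_scale[OF T] complex_norm_square
    by (simp add: A.scaleC scaleC_scaleC mult.commute)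
  have eq': "of_real ((cmod c * s)\<^sup>2) *\<^sub>C x = of_real ((cmod c)\<^sup>2) *\<^sub>C of_real (s\<^sup>2) *\<^sub>C x" for x
    by (simp add: scaleC_scaleC power_mult_distrib)
  then show ?thesis
    unfolding sv_space_def eq eq' complex_vector.scale_cancel_left using c by simp
qed

lemma singular_values_scale:
  assumes T: "bounded_operator T" and c: "c \<noteq> 0"
  shows "singular_values (\<lambda>x. c *\<^sub>C T x) = (\<lambda>s. cmod c * s) ` singular_values T"
proof -
  have "t \<in> (\<lambda>s. cmod c * s) ` singular_values T" if "t \<in> singular_values (\<lambda>x. c *\<^sub>C T x)" for t
  proof
    show "t = cmod c * (t / cmod c)" using c by simp
    show "t / cmod c \<in> singular_values T"
      using that c sv_space_scale[OF T c, of "t / cmod c"] by (simp add: singular_values_def)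
  qed
  moreover have "cmod c * s \<in> singular_values (\<lambda>x. c *\<^sub>C T x)" if "s \<in> singular_values T" for s
    using that c sv_space_scale[OF T c, of s] by (simp add: singular_values_def)
  ultimately show ?thesis by blast
qed

lemma singular_values_zero: "singular_values (\<lambda>x :: 'h::chilbert_space. 0) = {}"
proof -
  have "bounded_operator (cadjoint (\<lambda>x :: 'h. 0 :: 'h))"
    by (intro bounded_operator.bounded_operator_cadjoint compact_operator_bounded compact_operator_zero)
  from bounded_operator.blin[OF this]
  have 0: "cadjoint (\<lambda>x :: 'h. 0 :: 'h) 0 = 0"
    by (rule linear_0[OF bounded_linear.linear])
  have "x = 0" if "s > 0" "x \<in> sv_space (\<lambda>x :: 'h. 0) s" for s x
  proof -
    have "of_real (s\<^sup>2) *\<^sub>C x = 0"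
      using that(2) unfolding sv_space_def mem_Collect_eq 0 by (rule sym)
    then show ?thesis using that(1) unfolding complex_vector.scale_eq_0_iff by simp
  qed
  then have "s \<notin> singular_values (\<lambda>x :: 'h. 0)" for s
    unfolding singular_values_def by blast
  then show ?thesis by blast
qed

lemma schatten_term_scale:
  fixes c :: complex
  assumes T: "bounded_operator T" and sm: "schatten_term p T summable_on singular_values T"
  defines "U \<equiv> \<lambda>x. c *\<^sub>C T x"
  shows "schatten_term p U summable_on singular_values U"
    and "infsum (schatten_term p U) (singular_values U) = cmod c powr p * infsum (schatten_term p T) (singular_values T)"
proof -
  have "schatten_term p U summable_on singular_values U \<and>
    infsum (schatten_term p U) (singular_values U) = cmod c powr p * infsum (schatten_term p T) (singular_values T)"
  proof (cases "c = 0")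
    case True
    then have "U = (\<lambda>x. 0)" by (simp add: U_def)
    then show ?thesis using True by (simp add: singular_values_zero)
  next
    case False
    have inj: "inj_on (\<lambda>s. cmod c * s) (singular_values T)" using False by (auto intro: inj_onI)
    have eq: "schatten_term p U (cmod c * s) = cmod c powr p * schatten_term p T s" if "s \<in> singular_values T" for s
      using that sv_space_scale[OF T False, of s]
      by (simp add: U_def schatten_term_def sv_mult_def powr_mult singular_values_def)
    have SV: "singular_values U = (\<lambda>s. cmod c * s) ` singular_values T"
      unfolding U_def by (rule singular_values_scale[OF T False])
    have "(schatten_term p U \<circ> (\<lambda>s. cmod c * s)) summable_on singular_values T"
      using summable_on_cmult_right[OF sm, of "cmod c powr p"] eq by (simp cong: summable_on_cong)
    moreover have "infsum (schatten_term p U \<circ> (\<lambda>s. cmod c * s)) (singular_values T)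
        = (\<Sum>\<^sub>\<infinity>s\<in>singular_values T. cmod c powr p * schatten_term p T s)"
      by (rule infsum_cong) (simp add: eq)
    ultimately show ?thesis
      unfolding SV by (simp add: summable_on_reindex[OF inj] infsum_reindex[OF inj] infsum_cmult_right[OF sm])
  qed
  then show "schatten_term p U summable_on singular_values U"
    and "infsum (schatten_term p U) (singular_values U) = cmod c powr p * infsum (schatten_term p T) (singular_values T)"
    by auto
qed

lemma infsum_schatten_term_eq_0:
  assumes T: "compact_operator T" and sm: "schatten_term p T summable_on singular_values T"
    and 0: "infsum (schatten_term p T) (singular_values T) = 0"
  shows "T = (\<lambda>x. 0)"
proof -
  interpret compact_op T p by unfold_locales fact
  interpret T: bounded_operator T by (rule compact_operator_bounded[OF T])
  obtain E where E: "M.spectral_basis E" using M.spectral_basis_exists by blast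
  then have ef: "M.eigen_family E" by (simp add: M.spectral_basis_def)
  have "False" if e: "e \<in> E" for e
  proof -
    have "M.eigen_family {e}" using M.eigen_family_subset[OF ef] e by blast
    then have "(\<Sum>e\<in>{e}. M.form e powr (p / 2)) \<le> 0"
      using trace_bound_infsum[OF sm] unfolding trace_bound_def 0 by blast
    moreover have "M.form e > 0" by (rule M.eigen_familyD(2)[OF ef e])
    ultimately show False by simp
  qed
  then have "modulus_sq T x = 0" for x using E unfolding M.spectral_basis_def by blast
  then have "cinner x (cadjoint T (T x)) = 0" for x
    by (simp add: modulus_sq_def cinner.zero_right)
  then have "cinner (T x) (T x) = 0" for x by (simp only: T.cinner_cadjoint_right)
  then show ?thesis by (auto simp: cinner_self fun_eq_iff)
qed

lemma schatten_carrier: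
  "T \<in> vcarrier (schatten_class p) \<longleftrightarrow> compact_operator T \<and> schatten_term p T summable_on singular_values T"
  by (simp add: schatten_class_def schatten_term_def[abs_def])

lemma schatten_norm: "vnorm (schatten_class p) T = infsum (schatten_term p T) (singular_values T) powr (1 / p)"
  by (simp add: schatten_class_def schatten_term_def[abs_def])

lemma infsum_schatten_term_nonneg: "0 \<le> infsum (schatten_term p T) (singular_values T)"
  by (rule infsum_nonneg) (simp add: schatten_term_def)

lemma schatten_ops:
  "vadd (schatten_class p) S T = (\<lambda>x. S x + T x)"
  "vscale (schatten_class p) c T = (\<lambda>x. c *\<^sub>C T x)"
  "vzero (schatten_class p) = (\<lambda>x. 0)"
  by (simp_all add: schatten_class_def)

lemma clarkson_space_schatten:
  assumes p: "0 < p" "p \<le> 2"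
  shows "clarkson_space (schatten_class p :: ('h::chilbert_space \<Rightarrow> 'h) cnormed) p"
proof
  let ?X = "schatten_class p :: ('h \<Rightarrow> 'h) cnormed"
  have N: "vnorm ?X T powr p = infsum (schatten_term p T) (singular_values T)" for T
    using p infsum_schatten_term_nonneg[of p T] by (simp add: schatten_norm powr_powr)
  show "0 < p" by (rule p)
  show "vzero ?X \<in> vcarrier ?X"
    by (simp add: schatten_carrier schatten_ops compact_operator_zero singular_values_zero)
  fix A assume A: "A \<in> vcarrier ?X"
  note A' = A[unfolded schatten_carrier]
  have bA: "bounded_operator A" using A' compact_operator_bounded by blast
  show "vscale ?X c A \<in> vcarrier ?X" for c
    using A' schatten_term_scale(1)[OF bA] unfolding schatten_carrier schatten_ops
    by (simp add: compact_operator_scale)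
  show "vadd ?X A (vzero ?X) = A" "vscale ?X (c + d) A = vadd ?X (vscale ?X c A) (vscale ?X d A)"
    "vscale ?X c (vscale ?X d A) = vscale ?X (c * d) A" "vscale ?X 1 A = A" "vscale ?X 0 A = vzero ?X" for c d
    by (simp_all add: schatten_ops scaleC_add_left scaleC_scaleC scaleC_one)
  show "0 \<le> vnorm ?X A" by (simp add: schatten_norm)
  show "vnorm ?X (vscale ?X c A) = cmod c * vnorm ?X A" for c
    using A' p by (simp add: schatten_ops schatten_norm schatten_term_scale(2)[OF bA] powr_mult powr_powr infsum_schatten_term_nonneg)
  show "A = vzero ?X" if "vnorm ?X A = 0"
    using that A' infsum_schatten_term_eq_0[of A p] by (simp add: schatten_norm schatten_ops)
  fix B assume B: "B \<in> vcarrier ?X"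
  note B' = B[unfolded schatten_carrier]
  show "vadd ?X A B \<in> vcarrier ?X"
    unfolding schatten_carrier schatten_ops
    using compact_operator_add schatten_clarkson(1)[OF p] A' B' by blast
  show "vadd ?X A B = vadd ?X B A" "vscale ?X c (vadd ?X A B) = vadd ?X (vscale ?X c A) (vscale ?X c B)" for c
    by (simp_all add: schatten_ops scaleC_add_right add.commute)
  show "vnorm ?X (vadd ?X A B) powr p + vnorm ?X (vadd ?X A (vscale ?X (- 1) B)) powr p
      \<le> 2 * vnorm ?X A powr p + 2 * vnorm ?X B powr p"
    unfolding N schatten_ops using schatten_clarkson(2)[OF p] A' B' by blast
  fix C assume "C \<in> vcarrier ?X"
  show "vadd ?X (vadd ?X A B) C = vadd ?X A (vadd ?X B C)"
    by (simp add: schatten_ops add.assoc)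
qed

section \<open>Polynomial planks\<close>

lemma (in clarkson_space) plank_1_to_n:
  fixes k :: "nat \<Rightarrow> nat" and a :: "nat \<Rightarrow> real"
  assumes n: "n \<ge> 1" and k: "\<forall>i\<in>{1..n}. k i \<ge> 1" and a: "\<forall>i\<in>{1..n}. a i \<ge> 0"
  shows "(\<forall>i\<in>{1..n}. continuous_hom_poly X (k i) (P i) \<and> poly_norm X (P i) = 1) \<longrightarrow>
         ((\<Sum>i=1..n. a i powr p) < 1 / real n ^ (n - 1) \<longrightarrow>
           (\<exists>z\<in>unit_ball X. \<forall>i\<in>{1..n}. cmod (P i z) \<ge> a i ^ k i)) \<and>
         (finite_dimensional X \<and> (\<Sum>i=1..n. a i powr p) = 1 / real n ^ (n - 1) \<longrightarrow>
           (\<exists>z\<in>unit_ball X. \<forall>i\<in>{1..n}. cmod (P i z) \<ge> a i ^ k i))" (is "_ \<longrightarrow> ?plank")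
proof
  assume P: "\<forall>i\<in>{1..n}. continuous_hom_poly X (k i) (P i) \<and> poly_norm X (P i) = 1"
  have shift: "(\<forall>i\<in>{1..n}. R i) \<longleftrightarrow> (\<forall>i<n. R (Suc i))" for R
  proof (intro iffI ballI allI impI)
    fix i assume "\<forall>i<n. R (Suc i)" "i \<in> {1..n}"
    then show "R i" by (cases i) auto
  qed auto
  have P': "unit_hom_poly X p (k (Suc i)) (P (Suc i))" if "i < n" for i
  proof
    show "continuous_hom_poly X (k (Suc i)) (P (Suc i))" "poly_norm X (P (Suc i)) = 1" "1 \<le> k (Suc i)"
      using P k that unfolding shift by auto
  qed
  have a': "0 \<le> a (Suc i)" if "i < n" for i using a that unfolding shift by auto
  have sum: "(\<Sum>i=1..n. a i powr p) = (\<Sum>i<n. a (Suc i) powr p)"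
    by (simp add: sum.atLeast1_atMost_eq)
  show ?plank
    unfolding shift sum
  proof (intro conjI impI, goal_cases)
    case 1
    show ?case
      by (rule plank_strict[of n "\<lambda>i. k (Suc i)" "\<lambda>i. P (Suc i)" "\<lambda>i. a (Suc i)"]) (fact n P' a' 1)+
  next
    case 2
    show ?case
      by (rule plank_equality[of n "\<lambda>i. k (Suc i)" "\<lambda>i. P (Suc i)" "\<lambda>i. a (Suc i)"])
         (fact n P' a' conjunct1[OF 2] conjunct2[OF 2])+
  qed
qed

theorem theorem1p6:
  fixes p :: real and n :: nat and k :: "nat \<Rightarrow> nat" and a :: "nat \<Rightarrow> real"
    and M :: "'a measure"
    and P :: "nat \<Rightarrow> ('a \<Rightarrow> complex) set \<Rightarrow> complex"
    and Q :: "nat \<Rightarrow> ('h::chilbert_space \<Rightarrow> 'h) \<Rightarrow> complex"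
  assumes "1 \<le> p" and "p \<le> 2" and "n \<ge> 1"
    and "\<forall>i\<in>{1..n}. k i \<ge> 1"
    and "\<forall>i\<in>{1..n}. a i \<ge> 0"
  shows "((\<forall>i\<in>{1..n}. continuous_hom_poly (Lp_space p M) (k i) (P i) \<and>
                       poly_norm (Lp_space p M) (P i) = 1) \<longrightarrow>
          ((\<Sum>i=1..n. a i powr p) < 1 / real n ^ (n - 1) \<longrightarrow>
             (\<exists>z\<in>unit_ball (Lp_space p M). \<forall>i\<in>{1..n}. cmod (P i z) \<ge> a i ^ k i)) \<and>
          (finite_dimensional (Lp_space p M) \<and>
           (\<Sum>i=1..n. a i powr p) = 1 / real n ^ (n - 1) \<longrightarrow>
             (\<exists>z\<in>unit_ball (Lp_space p M). \<forall>i\<in>{1..n}. cmod (P i z) \<ge> a i ^ k i)))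
       \<and>
         ((\<forall>i\<in>{1..n}. continuous_hom_poly (schatten_class p) (k i) (Q i) \<and>
                       poly_norm (schatten_class p) (Q i) = 1) \<longrightarrow>
          ((\<Sum>i=1..n. a i powr p) < 1 / real n ^ (n - 1) \<longrightarrow>
             (\<exists>z\<in>unit_ball (schatten_class p). \<forall>i\<in>{1..n}. cmod (Q i z) \<ge> a i ^ k i)) \<and>
          (finite_dimensional (schatten_class p :: ('h \<Rightarrow> 'h) cnormed) \<and>
           (\<Sum>i=1..n. a i powr p) = 1 / real n ^ (n - 1) \<longrightarrow>
             (\<exists>z\<in>unit_ball (schatten_class p). \<forall>i\<in>{1..n}. cmod (Q i z) \<ge> a i ^ k i)))"
proof -
  have p: "0 < p" "p \<le> 2" using assms(1,2) by auto
  show ?thesis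
  proof (rule conjI, goal_cases)
    case 1
    show ?case
      by (rule clarkson_space.plank_1_to_n[OF Lp_exponent.clarkson_space_Lp[OF Lp_exponent.intro[OF p]] assms(3-5)])
  next
    case 2
    show ?case
      by (rule clarkson_space.plank_1_to_n[OF clarkson_space_schatten[OF p] assms(3-5)])
  qed
qed

end
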